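(* For every $L>L_1$ there exists $\varphi_L\in C^\infty(\mathbb{T}^3_L)$ such that $\mathcal{M}^{\mathcal{F}}_L=\Omega_L(\varphi_L)$. Moreover, $$\varphi_L=\sigma_{\psi_L}:=(-\Delta_L)^{-1/2}|\psi_L|^2,\qquad \psi_L=\text{the unique positive ground state of } h_{\varphi_L}.$$ Finally, there exists $\kappa'>0$ independent of $L$ such that, for all $L>L_1$ and all $\varphi\in L^2_{\mathbb{R}}(\mathbb{T}^3_L)$, $$\mathcal{F}_L(\varphi)-e_L\ \geq\ \min_{y\in\mathbb{T}^3_L}\Big\langle\varphi-\varphi_L^y\Big|\,\mathbb{1}-\big(\mathbb{1}+\kappa'(-\Delta_L)^{1/2}\big)^{-1}\Big|\varphi-\varphi_L^y\Big\rangle+\Big|L^{-3/2}\int_{\mathbb{T}^3_L}\varphi\Big|^2,$$ and this implies $$\mathcal{F}_L(\varphi)-e_L\ \geq\ \tau_L\,\mathrm{dist}^2_{L^2}\big(\mathcal{M}^{\mathcal{F}}_L,\varphi\big),\qquad \tau_L:=\frac{\kappa'(2\pi/L)^2}{1+\kappa'(2\pi/L)^2}.$$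
   Context: For $L>0$, $\mathbb{T}^3_L$ is the flat three-dimensional torus of side length $L$ (the box $[-L/2,L/2]^3$ with periodic boundary conditions), and $\Delta_L$ is its Laplacian. For $s>0$, $(-\Delta_L)^{-s}$ multiplies the $k$-th Fourier coefficient, $k\in\frac{2\pi}{L}\mathbb{Z}^3$, by $|k|^{-2s}$ if $k\neq0$ and by $0$ if $k=0$. For $\psi\in H^1(\mathbb{T}^3_L)$ with $\|\psi\|_2=1$ and real-valued $\varphi\in L^2_{\mathbb{R}}(\mathbb{T}^3_L)$ define $$\mathcal{G}_L(\psi,\varphi)=\langle\psi|h_\varphi|\psi\rangle+\|\varphi\|_2^2,\quad h_\varphi=-\Delta_L+V_\varphi,\quad V_\varphi=-2(-\Delta_L)^{-1/2}\varphi,$$ $e_L=\min_{\psi,\varphi}\mathcal{G}_L(\psi,\varphi)$, $\mathcal{E}_L(\psi)=\min_\varphi\mathcal{G}_L(\psi,\varphi)$, $\mathcal{F}_L(\varphi)=\min_\psi\mathcal{G}_L(\psi,\varphi)$, and $$\mathcal{M}^{\mathcal{E}}_L=\{\psi\in H^1:\|\psi\|_2=1,\ \mathcal{E}_L(\psi)=e_L\},\qquad \mathcal{M}^{\mathcal{F}}_L=\{\varphi\in L^2_{\mathbb{R}}(\mathbb{T}^3_L):\mathcal{F}_L(\varphi)=e_L\}.$$ Write $g^y(\cdot)=g(\cdot-y)$, $\Theta_L(\psi)=\{e^{i\theta}\psi^y:\theta\in[0,2\pi),y\in\mathbb{T}^3_L\}$, $\Omega_L(\varphi)=\{\varphi^y:y\in\mathbb{T}^3_L\}$.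 $L_1>0$ (together with $\kappa_1>0$), independent of $L$, and the functions $\psi_L$, $L>L_1$, are fixed with the following property (whose existence is established in the paper): for every $L>L_1$, $0<\psi_L\in C^\infty(\mathbb{T}^3_L)$, $e_L<0$, $\mathcal{M}^{\mathcal{E}}_L=\Theta_L(\psi_L)$, $\psi_L^y\neq\psi_L$ for $0\neq y\in\mathbb{T}^3_L$, and $\mathcal{E}_L(f)-e_L\geq\kappa_1\mathrm{dist}^2_{H^1}(\mathcal{M}^{\mathcal{E}}_L,f)$ for all $L^2$-normalized $f\in H^1(\mathbb{T}^3_L)$. *)

theory Defs
  imports "HOL-Analysis.Analysis"
begin

section \<open>The flat torus of side length L\<close>

text \<open>
  Functions on the torus are represented by functions on \<open>real ^ 3\<close> that are periodic of
  period \<open>L\<close> in each coordinate; points \<open>y\<close> of the torus are represented by arbitrary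
  \<open>y :: real ^ 3\<close>. Elements of Lebesgue spaces are Borel representatives, compared by
  equality almost everywhere. All sets of such functions below are saturated, that is,
  closed under replacing a representative by an almost everywhere equal one.
\<close>

definition torus_measure :: "real \<Rightarrow> (real ^ 3) measure" where
  "torus_measure L = restrict_space lborel (cbox (\<chi> i. - L / 2) (\<chi> i. L / 2))"

definition periodic :: "real \<Rightarrow> (real ^ 3 \<Rightarrow> 'a) \<Rightarrow> bool" where
  "periodic L f \<longleftrightarrow> (\<forall>x i. f (x + L *\<^sub>R axis i 1) = f x)"

definition cubic_lattice :: "real \<Rightarrow> (real ^ 3) set" where
  "cubic_lattice a = {k. \<forall>i. \<exists>n :: int. k $ i = a * of_int n}"

abbreviation dual_lattice :: "real \<Rightarrow> (real ^ 3) set" where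
  "dual_lattice L \<equiv> cubic_lattice (2 * pi / L)"

definition translate :: "real ^ 3 \<Rightarrow> (real ^ 3 \<Rightarrow> 'a) \<Rightarrow> real ^ 3 \<Rightarrow> 'a" where
  "translate y g = (\<lambda>x. g (x - y))"

abbreviation cplx :: "(real ^ 3 \<Rightarrow> real) \<Rightarrow> real ^ 3 \<Rightarrow> complex" where
  "cplx f \<equiv> (\<lambda>x. complex_of_real (f x))"

text \<open>\<open>Ck n\<close>: all iterated partial derivatives up to order \<open>n\<close> exist and are continuous.\<close>

primrec Ck :: "nat \<Rightarrow> (real ^ 3 \<Rightarrow> 'a::real_normed_vector) \<Rightarrow> bool" where
  "Ck 0 f \<longleftrightarrow> continuous_on UNIV f"
| "Ck (Suc n) f \<longleftrightarrow> f differentiable_on UNIV \<and>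
     (\<forall>i. Ck n (\<lambda>x. frechet_derivative f (at x) (axis i 1)))"

definition smooth_torus :: "real \<Rightarrow> (real ^ 3 \<Rightarrow> 'a::real_normed_vector) \<Rightarrow> bool" where
  "smooth_torus L f \<longleftrightarrow> periodic L f \<and> (\<forall>n. Ck n f)"


section \<open>Square-integrable functions, Fourier coefficients and Sobolev norms\<close>

definition L2 :: "real \<Rightarrow> (real ^ 3 \<Rightarrow> 'a::real_normed_vector) set" where
  "L2 L = {f. periodic L f \<and> f \<in> borel_measurable borel \<and>
              integrable (torus_measure L) (\<lambda>x. (norm (f x))\<^sup>2)}"

definition L2_norm :: "real \<Rightarrow> (real ^ 3 \<Rightarrow> 'a::real_normed_vector) \<Rightarrow> real" where
  "L2_norm L f = sqrt (\<integral>x. (norm (f x))\<^sup>2 \<partial>torus_measure L)"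

definition L2_inner :: "real \<Rightarrow> (real ^ 3 \<Rightarrow> real) \<Rightarrow> (real ^ 3 \<Rightarrow> real) \<Rightarrow> real" where
  "L2_inner L f g = (\<integral>x. f x * g x \<partial>torus_measure L)"

text \<open>
  The coefficient of \<open>f\<close> with respect to the orthonormal system of plane waves
  \<open>L powr (-3/2) * exp (\<i> k \<bullet> x)\<close>, where \<open>k\<close> ranges over \<open>dual_lattice L\<close>.
\<close>

definition fourier :: "real \<Rightarrow> (real ^ 3 \<Rightarrow> complex) \<Rightarrow> real ^ 3 \<Rightarrow> complex" where
  "fourier L f k =
     of_real (L powr (- 3 / 2)) * (\<integral>x. f x * cis (- (k \<bullet> x)) \<partial>torus_measure L)"

definition H1 :: "real \<Rightarrow> (real ^ 3 \<Rightarrow> complex) set" where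
  "H1 L = {f \<in> L2 L. (\<lambda>k. (norm k)\<^sup>2 * (cmod (fourier L f k))\<^sup>2) summable_on dual_lattice L}"

text \<open>The quadratic form of the negative Laplacian.\<close>

definition kinetic :: "real \<Rightarrow> (real ^ 3 \<Rightarrow> complex) \<Rightarrow> real" where
  "kinetic L f = (\<Sum>\<^sub>\<infinity>k\<in>dual_lattice L. (norm k)\<^sup>2 * (cmod (fourier L f k))\<^sup>2)"

definition H1_norm :: "real \<Rightarrow> (real ^ 3 \<Rightarrow> complex) \<Rightarrow> real" where
  "H1_norm L f = sqrt ((L2_norm L f)\<^sup>2 + kinetic L f)"

definition dist_L2 :: "real \<Rightarrow> (real ^ 3 \<Rightarrow> real) set \<Rightarrow> (real ^ 3 \<Rightarrow> real) \<Rightarrow> real" where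
  "dist_L2 L M f = (INF g\<in>M. L2_norm L (\<lambda>x. f x - g x))"

definition dist_H1 :: "real \<Rightarrow> (real ^ 3 \<Rightarrow> complex) set \<Rightarrow> (real ^ 3 \<Rightarrow> complex) \<Rightarrow> real" where
  "dist_H1 L M f = (INF g\<in>M. H1_norm L (\<lambda>x. f x - g x))"


section \<open>Functions of the Laplacian on real-valued functions\<close>

text \<open>
  \<open>fourier_mult L m f\<close> is a representative of the element of real \<open>L2\<close> whose \<open>k\<close>-th Fourier
  coefficient is \<open>m k\<close> times that of \<open>f\<close>; it is determined up to null sets. It exists for
  \<open>f \<in> L2 L\<close> and the multipliers used below, since these are real, bounded on the dual
  lattice, and even in \<open>k\<close> (so that real-valuedness is preserved).
\<close>

definition fourier_mult ::
    "real \<Rightarrow> (real ^ 3 \<Rightarrow> real) \<Rightarrow> (real ^ 3 \<Rightarrow> real) \<Rightarrow> real ^ 3 \<Rightarrow> real" where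
  "fourier_mult L m f = (SOME g. g \<in> L2 L \<and>
     (\<forall>k\<in>dual_lattice L. fourier L (cplx g) k = of_real (m k) * fourier L (cplx f) k))"

text \<open>The operator \<open>(-\<Delta>) powr (-s)\<close>, for \<open>s > 0\<close>.\<close>

definition lap_inv_pow :: "real \<Rightarrow> real \<Rightarrow> (real ^ 3 \<Rightarrow> real) \<Rightarrow> real ^ 3 \<Rightarrow> real" where
  "lap_inv_pow L s = fourier_mult L (\<lambda>k. if k = 0 then 0 else norm k powr (- 2 * s))"

text \<open>The inverse of the operator \<open>1 + \<kappa> (-\<Delta>) powr (1/2)\<close>.\<close>

definition sqrt_lap_resolvent :: "real \<Rightarrow> real \<Rightarrow> (real ^ 3 \<Rightarrow> real) \<Rightarrow> real ^ 3 \<Rightarrow> real" where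
  "sqrt_lap_resolvent L \<kappa> = fourier_mult L (\<lambda>k. inverse (1 + \<kappa> * norm k))"


section \<open>The Pekar functionals\<close>

definition V_pot :: "real \<Rightarrow> (real ^ 3 \<Rightarrow> real) \<Rightarrow> real ^ 3 \<Rightarrow> real" where
  "V_pot L \<phi> = (\<lambda>x. - 2 * lap_inv_pow L (1 / 2) \<phi> x)"

text \<open>The expectation value of \<open>h = -\<Delta> + V_pot L \<phi>\<close> in the state \<open>\<psi>\<close>.\<close>

definition h_form :: "real \<Rightarrow> (real ^ 3 \<Rightarrow> real) \<Rightarrow> (real ^ 3 \<Rightarrow> complex) \<Rightarrow> real" where
  "h_form L \<phi> \<psi> = kinetic L \<psi> + (\<integral>x. V_pot L \<phi> x * (cmod (\<psi> x))\<^sup>2 \<partial>torus_measure L)"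

definition G_fun :: "real \<Rightarrow> (real ^ 3 \<Rightarrow> complex) \<Rightarrow> (real ^ 3 \<Rightarrow> real) \<Rightarrow> real" where
  "G_fun L \<psi> \<phi> = h_form L \<phi> \<psi> + (L2_norm L \<phi>)\<^sup>2"

definition states :: "real \<Rightarrow> (real ^ 3 \<Rightarrow> complex) set" where
  "states L = {\<psi> \<in> H1 L. L2_norm L \<psi> = 1}"

definition e_min :: "real \<Rightarrow> real" where
  "e_min L = (INF (\<psi>, \<phi>) \<in> states L \<times> L2 L. G_fun L \<psi> \<phi>)"

definition E_fun :: "real \<Rightarrow> (real ^ 3 \<Rightarrow> complex) \<Rightarrow> real" where
  "E_fun L \<psi> = (INF \<phi> \<in> L2 L. G_fun L \<psi> \<phi>)"

definition F_fun :: "real \<Rightarrow> (real ^ 3 \<Rightarrow> real) \<Rightarrow> real" where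
  "F_fun L \<phi> = (INF \<psi> \<in> states L. G_fun L \<psi> \<phi>)"

definition M_E :: "real \<Rightarrow> (real ^ 3 \<Rightarrow> complex) set" where
  "M_E L = {\<psi> \<in> states L. E_fun L \<psi> = e_min L}"

definition M_F :: "real \<Rightarrow> (real ^ 3 \<Rightarrow> real) set" where
  "M_F L = {\<phi> \<in> L2 L. F_fun L \<phi> = e_min L}"

definition Theta :: "real \<Rightarrow> (real ^ 3 \<Rightarrow> complex) \<Rightarrow> (real ^ 3 \<Rightarrow> complex) set" where
  "Theta L \<psi> = {f \<in> L2 L. \<exists>\<theta>\<in>{0..<2 * pi}. \<exists>y.
     AE x in torus_measure L. f x = cis \<theta> * translate y \<psi> x}"

definition Omega :: "real \<Rightarrow> (real ^ 3 \<Rightarrow> real) \<Rightarrow> (real ^ 3 \<Rightarrow> real) set" where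
  "Omega L \<phi> = {f \<in> L2 L. \<exists>y. AE x in torus_measure L. f x = translate y \<phi> x}"

definition sigma_fun :: "real \<Rightarrow> (real ^ 3 \<Rightarrow> complex) \<Rightarrow> real ^ 3 \<Rightarrow> real" where
  "sigma_fun L \<psi> = lap_inv_pow L (1 / 2) (\<lambda>x. (cmod (\<psi> x))\<^sup>2)"


section \<open>Ground states\<close>

text \<open>
  \<open>h \<psi> = E \<psi>\<close> for \<open>h = -\<Delta> + V_pot L \<phi>\<close>, tested on plane waves. A solution \<open>\<psi>\<close> in \<open>H1\<close>
  automatically lies in the operator domain \<open>H2\<close>: \<open>V_pot L \<phi>\<close> and \<open>\<psi>\<close> are both in
  \<open>H1 \<subseteq> L4\<close>, so their product and hence \<open>\<Delta> \<psi>\<close> is in \<open>L2\<close>.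
\<close>

definition h_eigenfunction ::
    "real \<Rightarrow> (real ^ 3 \<Rightarrow> real) \<Rightarrow> real \<Rightarrow> (real ^ 3 \<Rightarrow> complex) \<Rightarrow> bool" where
  "h_eigenfunction L \<phi> E \<psi> \<longleftrightarrow>
     \<psi> \<in> H1 L \<and> \<not> (AE x in torus_measure L. \<psi> x = 0) \<and>
     (\<forall>k\<in>dual_lattice L.
        of_real ((norm k)\<^sup>2) * fourier L \<psi> k
          + fourier L (\<lambda>x. of_real (V_pot L \<phi> x) * \<psi> x) k = of_real E * fourier L \<psi> k)"

text \<open>A normalized eigenfunction for the lowest eigenvalue.\<close>

definition ground_state ::
    "real \<Rightarrow> (real ^ 3 \<Rightarrow> real) \<Rightarrow> (real ^ 3 \<Rightarrow> complex) \<Rightarrow> bool" where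
  "ground_state L \<phi> \<psi> \<longleftrightarrow> L2_norm L \<psi> = 1 \<and>
     (\<exists>E. h_eigenfunction L \<phi> E \<psi> \<and> (\<forall>E' \<eta>. h_eigenfunction L \<phi> E' \<eta> \<longrightarrow> E \<le> E'))"

definition positive_ground_state ::
    "real \<Rightarrow> (real ^ 3 \<Rightarrow> real) \<Rightarrow> (real ^ 3 \<Rightarrow> real) \<Rightarrow> bool" where
  "positive_ground_state L \<phi> \<psi> \<longleftrightarrow>
     ground_state L \<phi> (cplx \<psi>) \<and> (AE x in torus_measure L. 0 < \<psi> x)"

definition unique_positive_ground_state ::
    "real \<Rightarrow> (real ^ 3 \<Rightarrow> real) \<Rightarrow> (real ^ 3 \<Rightarrow> real) \<Rightarrow> bool" where
  "unique_positive_ground_state L \<phi> \<psi> \<longleftrightarrow> positive_ground_state L \<phi> \<psi> \<and>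
     (\<forall>\<eta>. positive_ground_state L \<phi> \<eta> \<longrightarrow> (AE x in torus_measure L. \<eta> x = \<psi> x))"


section \<open>The lower bounds\<close>

text \<open>The quadratic form of \<open>1 - R\<close> in \<open>u\<close>, where \<open>R\<close> is the operator \<open>sqrt_lap_resolvent L \<kappa>\<close>.\<close>

definition resolvent_form :: "real \<Rightarrow> real \<Rightarrow> (real ^ 3 \<Rightarrow> real) \<Rightarrow> real" where
  "resolvent_form L \<kappa> u = L2_inner L u (\<lambda>x. u x - sqrt_lap_resolvent L \<kappa> u x)"

definition tau :: "real \<Rightarrow> real \<Rightarrow> real" where
  "tau L \<kappa> = \<kappa> * (2 * pi / L)\<^sup>2 / (1 + \<kappa> * (2 * pi / L)\<^sup>2)"

end

theory Submission
  imports Defs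
begin

text \<open>
  Completing the square in \<open>\<phi>\<close> gives \<open>G(\<psi>, \<phi>) = E(\<psi>) + \<parallel>\<phi> - \<sigma>\<^sub>\<psi>\<parallel>\<^sup>2\<close>, hence
  \<open>F(\<phi>) - e = inf\<^sub>\<psi> (E(\<psi>) - e + \<parallel>\<phi> - \<sigma>\<^sub>\<psi>\<parallel>\<^sup>2)\<close>. By coercivity \<open>E(\<psi>) - e\<close> is at least \<open>\<kappa>\<^sub>1\<close> times the
  squared \<open>H\<^sup>1\<close> distance from \<open>\<psi>\<close> to some \<open>\<eta>\<close> in the orbit of \<open>\<psi>\<^sub>L\<close>. As
  \<open>\<bar>\<psi>\<bar>\<^sup>2 - \<bar>\<eta>\<bar>\<^sup>2 = Re ((\<psi> - \<eta>) cnj (\<psi> + \<eta>))\<close> and the product of an \<open>H\<^sup>1\<close> and an \<open>L\<^sup>2\<close> function is bounded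
  in \<open>H\<close> of order \<open>-1/2\<close>, uniformly in \<open>L\<close>, that distance controls
  \<open>\<kappa> \<langle>\<sigma>\<^sub>\<psi> - \<sigma>\<^sub>\<eta> | (-\<Delta>) powr (1/2) | \<sigma>\<^sub>\<psi> - \<sigma>\<^sub>\<eta>\<rangle>\<close>. Minimizing over \<open>\<sigma>\<^sub>\<psi>\<close> separately in each Fourier mode
  produces the operator \<open>1 - (1 + \<kappa> (-\<Delta>) powr (1/2)) powr (-1)\<close>, and the mode \<open>k = 0\<close> the term with the mean, because
  \<open>\<sigma>\<^sub>\<psi>\<close> has mean zero. Everything is done in Fourier space; Sobolev embeddings are replaced by lattice sums.
  A ground state of \<open>h\<close> for the field \<open>\<phi>\<^sub>L\<close> minimizes \<open>E\<close>, so its uniqueness follows from that of \<open>\<psi>\<^sub>L\<close> up to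
  symmetries and needs no Perron-Frobenius argument.
\<close>

section \<open>The torus measure and its translation invariance\<close>

text \<open>The multipliers pick a representative by choice, so \<open>sigma_fun\<close> is known
  only through its Fourier coefficients. Identities between functions are therefore proved for
  coefficients and carried back by uniqueness, while existence comes from Riesz-Fischer. For the
  same reason the smooth field is a separate Fourier series that agrees with
  \<open>sigma_fun\<close> almost everywhere. The threshold \<open>L\<^sub>1\<close> enters through
  the product estimate: its constant \<open>4 + 2 / L\<^sup>2\<close> contains the contribution of
  the zero mode in a small volume and is bounded only away from \<open>L = 0\<close>. No nearest
  point of the orbit and no optimal \<open>\<psi>\<close> is ever selected. The estimate is shown
  for every state \<open>\<psi>\<close> and every minimizer \<open>\<eta>\<close>, with the
  translation that minimizes the resolvent form fixed beforehand; the infima are taken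
  afterwards.\<close>

lemma cubic_lattice_eq_range:
  "cubic_lattice a =
     range (\<lambda>(l :: int, m :: int, n :: int). \<chi> i :: 3. a * of_int (if i = 1 then l else if i = 2 then m else n))"
proof -
  have "k \<in> range (\<lambda>(l :: int, m :: int, n :: int). \<chi> i :: 3. a * of_int (if i = 1 then l else if i = 2 then m else n))"
    if k: "k \<in> cubic_lattice a" for k
  proof -
    from k obtain l m n :: int where "k $ 1 = a * of_int l" "k $ 2 = a * of_int m" "k $ 3 = a * of_int n"
      unfolding cubic_lattice_def by blast
    then have "k = (\<lambda>(l :: int, m :: int, n :: int). \<chi> i :: 3. a * of_int (if i = 1 then l else if i = 2 then m else n)) (l, m, n)"
      by (simp add: vec_eq_iff forall_3)
    then show ?thesis by blast
  qed
  then show ?thesis by (auto simp: cubic_lattice_def)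
qed

lemma countable_cubic_lattice: "countable (cubic_lattice a)"
  unfolding cubic_lattice_eq_range by (rule countable_image) simp

lemma cubic_lattice_zero [simp]: "0 \<in> cubic_lattice a"
  by (auto simp: cubic_lattice_def intro: exI[of _ 0])

lemma cubic_lattice_add: "x \<in> cubic_lattice a \<Longrightarrow> y \<in> cubic_lattice a \<Longrightarrow> x + y \<in> cubic_lattice a"
  unfolding cubic_lattice_def by (auto simp: algebra_simps) (metis distrib_left of_int_add)

lemma cubic_lattice_minus: "x \<in> cubic_lattice a \<Longrightarrow> - x \<in> cubic_lattice a"
  unfolding cubic_lattice_def by auto (metis mult_minus_right of_int_minus)

lemma cubic_lattice_minus_iff [simp]: "- x \<in> cubic_lattice a \<longleftrightarrow> x \<in> cubic_lattice a"
  using cubic_lattice_minus[of x a] cubic_lattice_minus[of "- x" a] by auto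

lemma cubic_lattice_diff: "x \<in> cubic_lattice a \<Longrightarrow> y \<in> cubic_lattice a \<Longrightarrow> x - y \<in> cubic_lattice a"
  using cubic_lattice_add[of x a "- y"] by simp

lemma infinite_cubic_lattice:
  assumes "a \<noteq> 0"
  shows "infinite (cubic_lattice a)"
proof
  assume fin: "finite (cubic_lattice a)"
  have "range (\<lambda>n :: int. \<chi> i :: 3. a * of_int n) \<subseteq> cubic_lattice a"
    by (auto simp: cubic_lattice_def)
  moreover have "inj (\<lambda>n :: int. \<chi> i :: 3. a * of_int n)"
    using assms by (auto simp: inj_on_def vec_eq_iff)
  ultimately show False
    using fin finite_subset finite_imageD infinite_UNIV_int by blast
qed

lemma periodic_lattice:
  assumes f: "periodic L f" and k: "k \<in> cubic_lattice L"
  shows "f (x + k) = f x"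
proof -
  have nat_per: "f (x + (L * real n) *\<^sub>R axis i 1) = f x" for x i and n :: nat
  proof (induction n)
    case (Suc n)
    have "f (x + (L * real (Suc n)) *\<^sub>R axis i 1) = f ((x + (L * real n) *\<^sub>R axis i 1) + L *\<^sub>R axis i 1)"
      by (simp add: algebra_simps)
    with Suc f show ?case by (simp add: periodic_def)
  qed simp
  have int_per: "f (x + (L * of_int n) *\<^sub>R axis i 1) = f x" for x i and n :: int
  proof (cases "n \<ge> 0")
    case True
    then show ?thesis using nat_per[of x "nat n" i] by simp
  next
    case False
    \<comment> \<open>For negative \<open>n\<close> start at the shifted point and go forward by
      \<open>- n\<close> periods, back to \<open>x\<close>.\<close>
    then show ?thesis using nat_per[of "x + (L * of_int n) *\<^sub>R axis i 1" "nat (- n)" i]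
      by (simp add: algebra_simps)
  qed
  from k obtain l m n :: int where "k $ 1 = L * of_int l" "k $ 2 = L * of_int m" "k $ 3 = L * of_int n"
    unfolding cubic_lattice_def by blast
  then have "k = (L * of_int l) *\<^sub>R axis 1 1 + (L * of_int m) *\<^sub>R axis 2 1 + (L * of_int n) *\<^sub>R axis 3 1"
    by (simp add: vec_eq_iff forall_3 axis_def)
  then have "f (x + k) = f (((x + (L * of_int l) *\<^sub>R axis 1 1) + (L * of_int m) *\<^sub>R axis 2 1) + (L * of_int n) *\<^sub>R axis 3 1)"
    by (simp add: algebra_simps)
  then show ?thesis by (simp only: int_per)
qed

lemma periodic_translate: "periodic L f \<Longrightarrow> periodic L (translate y f)"
  unfolding periodic_def translate_def by (metis add_diff_eq diff_add_eq add.commute)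

text \<open>The representative modulo \<open>cubic_lattice L\<close> in the half-open cell; adding
  1/2 under the floor rounds to the nearest multiple of \<open>L\<close> and sends the upper face to
  the lower one. Closed boxes overlap in their faces, while a tiling has to meet every point exactly
  once.\<close>

definition wrap :: "real \<Rightarrow> real ^ 3 \<Rightarrow> real ^ 3" where
  "wrap L x = (\<chi> i. x $ i - L * of_int \<lfloor>x $ i / L + 1 / 2\<rfloor>)"

locale torus =
  fixes L :: real
  assumes L_pos: "0 < L"
begin

abbreviation "M \<equiv> torus_measure L"
abbreviation "\<Gamma> \<equiv> dual_lattice L"

section \<open>Reduction of points modulo the lattice\<close>

lemma wrap_diff: "wrap L x - x \<in> cubic_lattice L"
proof -
  have "(wrap L x - x) $ i = L * of_int (- \<lfloor>x $ i / L + 1 / 2\<rfloor>)" for i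
    by (simp add: wrap_def)
  then show ?thesis unfolding cubic_lattice_def by blast
qed

lemma periodic_wrap: "periodic L f \<Longrightarrow> f (wrap L x) = f x"
  using periodic_lattice[of L f "wrap L x - x" x] wrap_diff by simp

lemma wrap_lattice:
  assumes "k \<in> cubic_lattice L" shows "wrap L (x + k) = wrap L x"
proof -
  have "wrap L (x + k) $ i = wrap L x $ i" for i
  proof -
    obtain n :: int where n: "k $ i = L * of_int n" using assms by (auto simp: cubic_lattice_def)
    have "(x $ i + k $ i) / L + 1 / 2 = (x $ i / L + 1 / 2) + of_int n"
      using L_pos by (simp add: n field_simps)
    then have "\<lfloor>(x $ i + k $ i) / L + 1 / 2\<rfloor> = \<lfloor>x $ i / L + 1 / 2\<rfloor> + n"
      by (metis floor_add_int)
    then show ?thesis by (simp add: wrap_def n algebra_simps)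
  qed
  then show ?thesis by (simp add: vec_eq_iff)
qed

lemma wrap_wrap [simp]: "wrap L (wrap L x) = wrap L x"
  using wrap_lattice[OF wrap_diff, of x x] by simp

lemma wrap_bounds: "- L / 2 \<le> wrap L x $ i" "wrap L x $ i < L / 2"
proof -
  define y where "y = x $ i / L + 1 / 2"
  have x: "x $ i = L * y - L / 2" using L_pos by (simp add: y_def field_simps)
  have "L * of_int \<lfloor>y\<rfloor> \<le> L * y" "L * y < L * (of_int \<lfloor>y\<rfloor> + 1)"
    using L_pos by (simp_all add: mult_strict_left_mono)
  moreover have "wrap L x $ i = x $ i - L * of_int \<lfloor>y\<rfloor>" by (simp add: wrap_def y_def)
  ultimately show "- L / 2 \<le> wrap L x $ i" "wrap L x $ i < L / 2"
    unfolding x by (simp_all add: algebra_simps)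
qed

lemma wrap_eq_iff: "wrap L x = x \<longleftrightarrow> (\<forall>i. - L / 2 \<le> x $ i \<and> x $ i < L / 2)"
proof
  assume r: "\<forall>i. - L / 2 \<le> x $ i \<and> x $ i < L / 2"
  have "\<lfloor>x $ i / L + 1 / 2\<rfloor> = 0" for i
    using r[rule_format, of i] L_pos by (simp add: floor_eq_iff field_simps)
  then show "wrap L x = x" by (simp add: wrap_def vec_eq_iff)
qed (metis wrap_bounds)

lemma wrap_in_box: "wrap L x \<in> cbox (\<chi> i. - L / 2) (\<chi> i. L / 2)"
  using wrap_bounds by (simp add: mem_box_cart less_imp_le)

lemma periodic_comp_wrap: "periodic L (\<lambda>x. f (wrap L x))"
proof -
  have "L *\<^sub>R axis i 1 \<in> cubic_lattice L" for i :: 3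
    by (auto simp: cubic_lattice_def axis_def intro: exI[of _ 0] exI[of _ 1])
  then show ?thesis by (simp add: periodic_def wrap_lattice)
qed

lemma measurable_vec_nth' [measurable]: "(\<lambda>x :: real ^ 3. x $ i) \<in> borel_measurable borel"
  by (intro borel_measurable_continuous_onI continuous_intros)

lemma wrap_measurable [measurable]: "wrap L \<in> borel_measurable borel"
proof -
  have eq: "wrap L = (\<lambda>x. \<Sum>j\<in>UNIV. (x $ j - L * of_int \<lfloor>x $ j / L + 1 / 2\<rfloor>) *\<^sub>R axis j 1)"
    by (auto simp: fun_eq_iff wrap_def vec_eq_iff sum_component axis_def if_distrib cong: if_cong)
  show ?thesis unfolding eq by measurable
qed

section \<open>The measure of the box and its invariance under translations\<close>

lemma space_M: "space M = cbox (\<chi> i. - L / 2) (\<chi> i. L / 2)"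
  by (simp add: torus_measure_def space_restrict_space)

lemma measurable_M [measurable (raw)]:
  "f \<in> measurable borel N \<Longrightarrow> f \<in> measurable M N"
  unfolding torus_measure_def by (rule measurable_restrict_space1) simp

lemma emeasure_M_space: "emeasure M (space M) = ennreal (L ^ 3)"
proof -
  have "emeasure lborel (cbox (\<chi> i :: 3. - L / 2) (\<chi> i. L / 2)) = ennreal (L ^ 3)"
  proof -
    have "cbox (\<chi> i :: 3. - L / 2) (\<chi> i. L / 2) \<noteq> {}"
      using L_pos by (simp add: interval_ne_empty_cart)
    then have "measure lborel (cbox (\<chi> i :: 3. - L / 2) (\<chi> i. L / 2)) = L ^ 3"
      by (simp add: content_cbox_cart)
    then show ?thesis
      by (metis emeasure_eq_ennreal_measure emeasure_lborel_cbox_finite less_irrefl infinity_ennreal_def top.not_eq_extremum)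
  qed
  then show ?thesis
    unfolding space_M by (simp add: torus_measure_def emeasure_restrict_space)
qed

sublocale fm: finite_measure M
  by standard (simp add: emeasure_M_space)

lemma measure_M_space: "measure M (space M) = L ^ 3"
  using L_pos by (simp add: measure_def emeasure_M_space)

text \<open>Box and half-open cell differ only in the faces where some coordinate equals
  \<open>L / 2\<close>, and these lie in null hyperplanes.\<close>

lemma AE_wrap: "AE x in M. wrap L x = x"
proof -
  have "AE x in lborel. \<forall>i :: 3. x $ i \<noteq> L / 2"
  proof (subst AE_all_countable, intro allI)
    fix i :: 3
    have "negligible {x :: real ^ 3. x \<bullet> axis i 1 = L / 2}"
      by (rule negligible_standard_hyperplane) (simp add: axis_in_Basis_iff)
    then have "negligible {x :: real ^ 3. x $ i = L / 2}"
      by (simp add: inner_axis)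
    then have "{x :: real ^ 3. x $ i = L / 2} \<in> null_sets lebesgue"
      by (simp add: negligible_iff_null_sets)
    moreover have "{x :: real ^ 3. x $ i = L / 2} \<in> sets borel" by measurable
    ultimately have "{x :: real ^ 3. x $ i = L / 2} \<in> null_sets lborel"
      by (simp add: null_sets_def)
    then show "AE x in lborel. x $ i \<noteq> L / 2" by (rule AE_I') auto
  qed
  then show ?thesis
    unfolding torus_measure_def
    by (auto simp: AE_restrict_space_iff mem_box_cart wrap_eq_iff order_less_le elim!: eventually_mono)
qed

text \<open>Trades the closed box for the half-open cell, whose lattice translates are
  disjoint.\<close>

lemma nn_integral_M:
  "(\<integral>\<^sup>+x. f x \<partial>M) = (\<integral>\<^sup>+x. f x * indicator {x. wrap L x = x} x \<partial>lborel)"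
  if [measurable]: "f \<in> borel_measurable borel"
proof -
  let ?B = "cbox (\<chi> i. - L / 2) (\<chi> i. L / 2) :: (real ^ 3) set"
  have "AE x in lborel. x \<in> ?B \<longrightarrow> wrap L x = x"
    using AE_wrap unfolding torus_measure_def by (simp add: AE_restrict_space_iff)
  moreover have "wrap L x = x \<Longrightarrow> x \<in> ?B" for x using wrap_in_box[of x] by simp
  ultimately have "AE x in lborel. indicator ?B x = (indicator {x. wrap L x = x} x :: ennreal)"
    by (auto elim!: eventually_mono simp: indicator_def)
  then show ?thesis
    by (auto simp: torus_measure_def nn_integral_restrict_space intro!: nn_integral_cong_AE elim!: eventually_mono)
qed

text \<open>The lattice translates of the half-open fundamental cell tile space, which lets one
  exchange the cell for any of its translates.\<close>

lemma nn_integral_M_translate: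
  fixes f :: "real ^ 3 \<Rightarrow> ennreal"
  assumes [measurable]: "f \<in> borel_measurable borel" and per: "periodic L f"
  shows "(\<integral>\<^sup>+x. f (x - y) \<partial>M) = (\<integral>\<^sup>+x. f x \<partial>M)"
proof -
  define Q where "Q = {x. wrap L x = x}"
  have Q [measurable]: "Q \<in> sets borel" unfolding Q_def by measurable
  define g where "g = from_nat_into (cubic_lattice L)"
  have bij: "bij_betw g UNIV (cubic_lattice L)"
    unfolding g_def using L_pos by (intro bij_betw_from_nat_into countable_cubic_lattice infinite_cubic_lattice) auto
  then have g: "g n \<in> cubic_lattice L" for n by (auto simp: bij_betw_def)
  have tile: "(\<Sum>n. indicator Q (x + s n)) = (1 :: ennreal)" if s: "bij_betw s UNIV (cubic_lattice L)" for x s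
  proof -
    \<comment> \<open>The only lattice vector that moves \<open>x\<close> into the cell is
      \<open>wrap L x - x\<close>, so exactly one summand equals 1.\<close>
    obtain m where m: "s m = wrap L x - x" using s wrap_diff[of x] by (metis bij_betw_imp_surj_on rangeE)
    have "indicator Q (x + s n) = (if n = m then 1 else 0 :: ennreal)" for n
    proof -
      have "s n \<in> cubic_lattice L" using s by (auto simp: bij_betw_def)
      then have "x + s n \<in> Q \<longleftrightarrow> s n = s m"
        unfolding Q_def m by (auto simp: wrap_lattice algebra_simps)
      also have "\<dots> \<longleftrightarrow> n = m" using s by (auto simp: bij_betw_def inj_on_def)
      finally show ?thesis by (auto simp: indicator_def)
    qed
    then have "(\<lambda>n. indicator Q (x + s n)) = (\<lambda>n. if n = m then 1 else 0 :: ennreal)" by auto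
    then show ?thesis using sums_single[of m "\<lambda>_. 1 :: ennreal"] by (simp add: sums_iff)
  qed
  have bij': "bij_betw (\<lambda>n. - g n) UNIV (cubic_lattice L)"
  proof -
    have "bij_betw uminus (cubic_lattice L) (cubic_lattice L)"
      by (rule bij_betw_byWitness[where f' = uminus]) auto
    from bij_betw_trans[OF bij this] show ?thesis by (simp add: comp_def)
  qed
  have tr: "(\<integral>\<^sup>+x. h (x + v) \<partial>lborel) = (\<integral>\<^sup>+x. h x \<partial>lborel)"
    if [measurable]: "h \<in> borel_measurable borel" for h :: "real ^ 3 \<Rightarrow> ennreal" and v
  proof -
    have "(\<integral>\<^sup>+x. h x \<partial>lborel) = (\<integral>\<^sup>+x. h x \<partial>distr lborel borel ((+) v))"
      by (simp add: lborel_distr_plus)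
    then show ?thesis by (simp add: nn_integral_distr add.commute)
  qed
  have "(\<integral>\<^sup>+x. f (x - y) \<partial>M) = (\<integral>\<^sup>+x. f (x - y) * indicator Q x \<partial>lborel)"
    unfolding Q_def by (rule nn_integral_M) measurable
  also have "\<dots> = (\<integral>\<^sup>+x. f x * indicator Q (x + y) \<partial>lborel)"
    by (subst tr[symmetric, where v = y]) simp_all
  also have "\<dots> = (\<integral>\<^sup>+x. (\<Sum>n. f x * indicator Q (x + y) * indicator Q (x + g n)) \<partial>lborel)"
    by (simp add: tile[OF bij])
  also have "\<dots> = (\<Sum>n. \<integral>\<^sup>+x. f x * indicator Q (x + y) * indicator Q (x + g n) \<partial>lborel)"
    by (rule nn_integral_suminf) measurable
  \<comment> \<open>The shift by \<open>g n\<close> leaves \<open>f\<close> unchanged by periodicity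
    and moves the lattice vector onto the translated cell, which now does the tiling.\<close>
  also have "\<dots> = (\<Sum>n. \<integral>\<^sup>+x. f x * indicator Q (x + y - g n) * indicator Q x \<partial>lborel)"
  proof (intro suminf_cong)
    fix n
    have "f (x - g n) = f x" for x
      using periodic_lattice[OF per g[of n], of "x - g n"] by simp
    then show "(\<integral>\<^sup>+x. f x * indicator Q (x + y) * indicator Q (x + g n) \<partial>lborel) =
        (\<integral>\<^sup>+x. f x * indicator Q (x + y - g n) * indicator Q x \<partial>lborel)"
      by (subst tr[symmetric, where v = "- g n"]) (simp_all add: algebra_simps)
  qed
  also have "\<dots> = (\<integral>\<^sup>+x. (\<Sum>n. f x * indicator Q (x + y - g n) * indicator Q x) \<partial>lborel)"
    by (rule nn_integral_suminf[symmetric]) measurable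
  also have "\<dots> = (\<integral>\<^sup>+x. f x * indicator Q x \<partial>lborel)"
  proof -
    have "(\<Sum>n. f x * indicator Q (x + y - g n) * indicator Q x) = f x * indicator Q x" for x
    proof -
      have "(\<Sum>n. f x * indicator Q (x + y - g n) * indicator Q x) = (\<Sum>n. (f x * indicator Q x) * indicator Q (x + y - g n))"
        by (simp add: mult.assoc mult.commute mult.left_commute)
      then show ?thesis using tile[OF bij', of "x + y"] by simp
    qed
    then show ?thesis by simp
  qed
  also have "\<dots> = (\<integral>\<^sup>+x. f x \<partial>M)"
    unfolding Q_def by (rule nn_integral_M[symmetric]) measurable
  finally show ?thesis .
qed

lemma wrap_measurable_M [measurable]: "(\<lambda>x. wrap L (x - y)) \<in> measurable M M"
proof -
  have "(\<lambda>x. wrap L (x - y)) \<in> measurable M borel" by measurable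
  then show ?thesis
    using wrap_in_box unfolding torus_measure_def
    by (intro measurable_restrict_space2) auto
qed

lemma sets_M_borel: "B \<in> sets M \<Longrightarrow> B \<in> sets borel"
  by (auto simp: torus_measure_def sets_restrict_space)

text \<open>Translation modulo the lattice as a measure-preserving map: this carries the invariance
  from nonnegative integrands to Bochner integrals and to integrability.\<close>

lemma distr_wrap: "distr M M (\<lambda>x. wrap L (x - y)) = M"
proof (rule measure_eqI)
  fix B assume "B \<in> sets (distr M M (\<lambda>x. wrap L (x - y)))"
  then have B: "B \<in> sets M" by simp
  then have [measurable]: "B \<in> sets borel" by (rule sets_M_borel)
  have "emeasure (distr M M (\<lambda>x. wrap L (x - y))) B = (\<integral>\<^sup>+x. indicator B x \<partial>distr M M (\<lambda>x. wrap L (x - y)))"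
    using B by simp
  also have "\<dots> = (\<integral>\<^sup>+x. indicator B (wrap L (x - y)) \<partial>M)"
    by (intro nn_integral_distr) (use B in measurable)
  also have "\<dots> = (\<integral>\<^sup>+x. indicator B (wrap L x) \<partial>M)"
    by (rule nn_integral_M_translate[of "\<lambda>x. indicator B (wrap L x)" y]) (measurable, rule periodic_comp_wrap)
  also have "\<dots> = (\<integral>\<^sup>+x. indicator B x \<partial>M)"
    by (rule nn_integral_cong_AE) (use AE_wrap in \<open>auto elim!: eventually_mono\<close>)
  finally show "emeasure (distr M M (\<lambda>x. wrap L (x - y))) B = emeasure M B"
    using B by simp
qed simp

lemma integral_M_translate:
  fixes f :: "real ^ 3 \<Rightarrow> 'b :: {banach, second_countable_topology}"
  assumes [measurable]: "f \<in> borel_measurable borel" and per: "periodic L f"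
  shows "(\<integral>x. f (x - y) \<partial>M) = (\<integral>x. f x \<partial>M)"
proof -
  have "(\<integral>x. f x \<partial>M) = (\<integral>x. f x \<partial>distr M M (\<lambda>x. wrap L (x - y)))" by (simp add: distr_wrap)
  also have "\<dots> = (\<integral>x. f (wrap L (x - y)) \<partial>M)" by (rule integral_distr) measurable
  finally show ?thesis by (simp add: periodic_wrap[OF per])
qed

lemma integrable_M_translate:
  fixes f :: "real ^ 3 \<Rightarrow> 'b :: {banach, second_countable_topology}"
  assumes [measurable]: "f \<in> borel_measurable borel" and per: "periodic L f" and "integrable M f"
  shows "integrable M (\<lambda>x. f (x - y))"
proof -
  have "integrable (distr M M (\<lambda>x. wrap L (x - y))) f" using assms by (simp add: distr_wrap)
  then have "integrable M (\<lambda>x. f (wrap L (x - y)))" by (subst (asm) integrable_distr_eq) measurable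
  then show ?thesis by (simp add: periodic_wrap[OF per])
qed

end

section \<open>Fourier coefficients and their uniqueness\<close>

context torus
begin

text \<open>The spacings \<open>2 * pi / L\<close> and \<open>L\<close> multiply to
  \<open>2 * pi\<close>, which is what makes plane waves with frequencies in the dual lattice
  periodic.\<close>

lemma dual_lattice_inner:
  assumes "k \<in> \<Gamma>" "x \<in> cubic_lattice L"
  shows "\<exists>n :: int. k \<bullet> x = 2 * pi * of_int n"
proof -
  have "\<forall>i. \<exists>n :: int. k $ i = (2 * pi / L) * of_int n" "\<forall>i. \<exists>n :: int. x $ i = L * of_int n"
    using assms unfolding cubic_lattice_def by auto
  then obtain l m where l: "\<And>i. k $ i = (2 * pi / L) * of_int (l i :: int)"
    and m: "\<And>i. x $ i = L * of_int (m i :: int)"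
    by metis
  have "k $ i * x $ i = 2 * pi * of_int (l i * m i)" for i
    using L_pos by (simp add: l m)
  then have "k \<bullet> x = 2 * pi * of_int (\<Sum>i\<in>UNIV. l i * m i)"
    by (simp add: inner_vec_def sum_distrib_left)
  then show ?thesis by blast
qed

lemma periodicI:
  assumes "\<And>x y. y \<in> cubic_lattice L \<Longrightarrow> f (x + y) = f x"
  shows "periodic L f"
proof -
  have "L *\<^sub>R axis i 1 \<in> cubic_lattice L" for i :: 3
    by (auto simp: cubic_lattice_def axis_def intro: exI[of _ 0] exI[of _ 1])
  then show ?thesis using assms by (simp add: periodic_def)
qed

lemma periodic_cis: "k \<in> \<Gamma> \<Longrightarrow> periodic L (\<lambda>x. cis (k \<bullet> x))"
proof (rule periodicI)
  fix x y assume k: "k \<in> \<Gamma>" "y \<in> cubic_lattice L"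
  then obtain n :: int where "k \<bullet> y = 2 * pi * of_int n" using dual_lattice_inner by blast
  then have "cis (k \<bullet> y) = 1" by (simp add: cis_multiple_2pi)
  then show "cis (k \<bullet> (x + y)) = cis (k \<bullet> x)"
    by (simp add: inner_add_right cis_mult[symmetric])
qed

lemma measurable_inner [measurable]: "(\<lambda>x :: real ^ 3. k \<bullet> x) \<in> borel_measurable borel"
  by (intro borel_measurable_continuous_onI continuous_intros)

lemma measurable_cis_inner [measurable]: "(\<lambda>x :: real ^ 3. cis (k \<bullet> x)) \<in> borel_measurable borel"
  by (intro borel_measurable_continuous_onI continuous_intros)

lemma measurable_cis_minus_inner [measurable]: "(\<lambda>x :: real ^ 3. cis (- (k \<bullet> x))) \<in> borel_measurable borel"
  by (intro borel_measurable_continuous_onI continuous_intros)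

lemma integrable_mult_bounded:
  fixes f g :: "real ^ 3 \<Rightarrow> 'b :: {real_normed_algebra, second_countable_topology, banach}"
  assumes f: "integrable M f" and g: "g \<in> borel_measurable M" "\<And>x. norm (g x) \<le> B"
  shows "integrable M (\<lambda>x. f x * g x)"
proof (rule Bochner_Integration.integrable_bound)
  show "integrable M (\<lambda>x. B * norm (f x))" using f by simp
  show "(\<lambda>x. f x * g x) \<in> borel_measurable M" using f g by measurable
  show "AE x in M. norm (f x * g x) \<le> norm (B * norm (f x))"
  proof (rule AE_I2)
    fix x
    have "norm (f x * g x) \<le> norm (f x) * norm (g x)" by (rule norm_mult_ineq)
    also have "\<dots> \<le> norm (f x) * B" using g by (simp add: mult_left_mono)
    finally show "norm (f x * g x) \<le> norm (B * norm (f x))"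
      by (smt (verit) real_norm_def mult.commute)
  qed
qed

lemma integrable_mult_cis: "integrable M f \<Longrightarrow> integrable M (\<lambda>x. f x * cis (k \<bullet> x))"
  by (rule integrable_mult_bounded[where B = 1]) simp_all

lemma integrable_mult_cis_minus: "integrable M f \<Longrightarrow> integrable M (\<lambda>x. f x * cis (- (k \<bullet> x)))"
  by (rule integrable_mult_bounded[where B = 1]) simp_all

section \<open>Rules for Fourier coefficients\<close>

lemma fourier_cong_AE:
  assumes "f \<in> borel_measurable borel" "g \<in> borel_measurable borel" "AE x in M. f x = g x"
  shows "fourier L f k = fourier L g k"
proof -
  note [measurable] = assms(1,2)
  show ?thesis unfolding fourier_def
    by (intro arg_cong2[where f = "(*)"] refl integral_cong_AE) (use assms(3) in \<open>auto elim!: eventually_mono\<close>)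
qed

lemma fourier_add:
  assumes "integrable M f" "integrable M g"
  shows "fourier L (\<lambda>x. f x + g x) k = fourier L f k + fourier L g k"
  unfolding fourier_def using integrable_mult_cis_minus[OF assms(1)] integrable_mult_cis_minus[OF assms(2)]
  by (simp add: distrib_right distrib_left)

lemma fourier_diff:
  assumes "integrable M f" "integrable M g"
  shows "fourier L (\<lambda>x. f x - g x) k = fourier L f k - fourier L g k"
  unfolding fourier_def using integrable_mult_cis_minus[OF assms(1)] integrable_mult_cis_minus[OF assms(2)]
  by (simp add: left_diff_distrib right_diff_distrib)

lemma fourier_cmult: "fourier L (\<lambda>x. c * f x) k = c * fourier L f k"
  unfolding fourier_def by (simp add: mult.assoc)

lemma fourier_zero [simp]: "fourier L (\<lambda>x. 0) k = 0"
  unfolding fourier_def by simp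

lemma fourier_cnj: "fourier L (\<lambda>x. cnj (f x)) k = cnj (fourier L f (- k))"
proof -
  have "(\<integral>x. cnj (f x) * cis (- (k \<bullet> x)) \<partial>M) = (\<integral>x. cnj (f x * cis (k \<bullet> x)) \<partial>M)"
    by (intro Bochner_Integration.integral_cong) (auto simp: cis_cnj)
  then show ?thesis unfolding fourier_def by (simp add: integral_cnj del: complex_cnj_mult)  (simp add: complex_cnj_mult)
qed

lemma fourier_mult_cis: "fourier L (\<lambda>x. f x * cis (l \<bullet> x)) k = fourier L f (k - l)"
proof -
  have "f x * cis (l \<bullet> x) * cis (- (k \<bullet> x)) = f x * cis (- ((k - l) \<bullet> x))" for x
    by (simp add: mult.assoc cis_mult inner_diff_left)
  then show ?thesis unfolding fourier_def by presburger
qed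

lemma measurable_translate [measurable]:
  assumes "f \<in> measurable borel N"
  shows "translate y f \<in> measurable borel N"
  unfolding translate_def by (rule measurable_compose[OF _ assms]) simp

lemma fourier_translate:
  assumes [measurable]: "f \<in> borel_measurable borel" and f: "periodic L f" and k: "k \<in> \<Gamma>"
  shows "fourier L (translate y f) k = cis (- (k \<bullet> y)) * fourier L f k"
proof -
  have "- k \<in> \<Gamma>" using k by simp
  then have per: "periodic L (\<lambda>x. f x * cis (- (k \<bullet> x)))"
    using f periodic_cis[of "- k"] by (simp add: periodic_def)
  have "f (x - y) * cis (- (k \<bullet> x)) = cis (- (k \<bullet> y)) * (f (x - y) * cis (- (k \<bullet> (x - y))))" for x
    by (simp add: inner_diff_right cis_mult mult.left_commute)
  then have "(\<integral>x. translate y f x * cis (- (k \<bullet> x)) \<partial>M) =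
      (\<integral>x. cis (- (k \<bullet> y)) * (f (x - y) * cis (- (k \<bullet> (x - y)))) \<partial>M)"
    unfolding translate_def by (simp only:)
  also have "\<dots> = cis (- (k \<bullet> y)) * (\<integral>x. f (x - y) * cis (- (k \<bullet> (x - y))) \<partial>M)" by simp
  also have "(\<integral>x. f (x - y) * cis (- (k \<bullet> (x - y))) \<partial>M) = (\<integral>x. f x * cis (- (k \<bullet> x)) \<partial>M)"
    by (rule integral_M_translate[OF _ per]) measurable
  finally show ?thesis unfolding fourier_def by simp
qed

text \<open>For nonzero \<open>k\<close>, translation by a vector \<open>y\<close> with
  \<open>k \<bullet> y = pi\<close> reverses the sign of the integrand; by invariance the integral
  equals its own negative.\<close>

lemma integral_cis:
  assumes k: "k \<in> \<Gamma>"
  shows "(\<integral>x. cis (k \<bullet> x) \<partial>M) = (if k = 0 then of_real (L ^ 3) else 0)"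
proof (cases "k = 0")
  case True
  then show ?thesis using measure_M_space by (simp add: scaleR_conv_of_real)
next
  case False
  define y where "y = (pi / (k \<bullet> k)) *\<^sub>R k"
  have y: "k \<bullet> y = pi" using False by (simp add: y_def)
  have "(\<integral>x. cis (k \<bullet> x) \<partial>M) = (\<integral>x. cis (k \<bullet> (x - y)) \<partial>M)"
    by (rule integral_M_translate[symmetric]) (use periodic_cis[OF k] in simp_all)
  also have "\<dots> = (\<integral>x. cis (k \<bullet> x) * cis (- pi) \<partial>M)"
    by (simp add: inner_diff_right y cis_mult)
  also have "\<dots> = - (\<integral>x. cis (k \<bullet> x) \<partial>M)" by (simp add: cis_divide[symmetric] flip: cis_cnj)
  finally show ?thesis using False by simp
qed

end

text \<open>Continuous ramps approximating the indicator of the positive half-line; composed with a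
  multiplier they yield the indicators of its superlevel sets.\<close>

lemma tendsto_ramp_indicator:
  fixes t :: real
  shows "(\<lambda>n. min 1 (max 0 (real n * t))) \<longlonglongrightarrow> (if 0 < t then 1 else 0)"
proof (cases "0 < t")
  case True
  have "\<forall>\<^sub>F n in sequentially. min 1 (max 0 (real n * t)) = 1"
  proof -
    obtain N where "1 / t < real N" using reals_Archimedean2 by blast
    then have "1 \<le> real n * t" if "n \<ge> N" for n
    proof -
      have "1 / t \<le> real n" using that \<open>1 / t < real N\<close> by linarith
      then show ?thesis using True by (simp add: field_simps)
    qed
    then show ?thesis by (intro eventually_sequentiallyI[of N]) (force simp: min_def max_def)
  qed
  then show ?thesis using True by (simp add: tendsto_eventually)
next
  case False
  then have "min 1 (max 0 (real n * t)) = 0" for n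
    by (simp add: max_def mult_nonneg_nonpos antisym_conv)
  then show ?thesis using False by simp
qed

section \<open>Uniqueness of Fourier coefficients by a monotone class argument\<close>

locale annihilated = torus +
  fixes f :: "real ^ 3 \<Rightarrow> complex"
  assumes f_int: "integrable (torus_measure L) f"
    and f_zero: "\<And>k. k \<in> dual_lattice L \<Longrightarrow> fourier L f k = 0"
begin

text \<open>The real multipliers that preserve the space of bounded functions \<open>g\<close> for which all
  Fourier coefficients of \<open>f g\<close> vanish form an algebra that is closed under bounded pointwise
  limits. It contains the trigonometric functions, hence all indicators of Borel sets.\<close>

definition null_space :: "(real ^ 3 \<Rightarrow> complex) set" where
  "null_space = {g. g \<in> borel_measurable M \<and> (\<exists>B. \<forall>x. cmod (g x) \<le> B) \<and>
           (\<forall>k\<in>\<Gamma>. (\<integral>x. f x * g x * cis (- (k \<bullet> x)) \<partial>M) = 0)}"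

definition multipliers :: "(real ^ 3 \<Rightarrow> real) set" where
  "multipliers = {h. h \<in> borel_measurable M \<and> (\<exists>B. \<forall>x. \<bar>h x\<bar> \<le> B) \<and> (\<forall>g\<in>null_space. (\<lambda>x. of_real (h x) * g x) \<in> null_space)}"

lemma null_space_integrable:
  assumes "g \<in> null_space" shows "integrable M (\<lambda>x. f x * g x * cis (- (k \<bullet> x)))"
proof -
  obtain B where "g \<in> borel_measurable M" "\<And>x. cmod (g x) \<le> B" using assms unfolding null_space_def by blast
  then show ?thesis by (intro integrable_mult_cis_minus integrable_mult_bounded[OF f_int])
qed

lemma one_null_space: "(\<lambda>x. 1) \<in> null_space"
proof -
  have "L powr (- 3 / 2) \<noteq> 0" using L_pos by simp
  then have "(\<integral>x. f x * 1 * cis (- (k \<bullet> x)) \<partial>M) = 0" if "k \<in> \<Gamma>" for k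
    using f_zero[OF that] by (auto simp: fourier_def)
  then show ?thesis unfolding null_space_def by (auto intro: exI[of _ 1])
qed

lemma null_space_add: assumes "g \<in> null_space" "h \<in> null_space" shows "(\<lambda>x. g x + h x) \<in> null_space"
proof -
  obtain B C where "\<And>x. cmod (g x) \<le> B" "\<And>x. cmod (h x) \<le> C" using assms unfolding null_space_def by blast
  then have "cmod (g x + h x) \<le> B + C" for x by (meson add_mono norm_triangle_le)
  moreover have "(\<integral>x. f x * (g x + h x) * cis (- (k \<bullet> x)) \<partial>M) = 0" if "k \<in> \<Gamma>" for k
    using null_space_integrable[OF assms(1), of k] null_space_integrable[OF assms(2), of k] assms that
    by (simp add: null_space_def distrib_left distrib_right)
  ultimately show ?thesis using assms unfolding null_space_def by (auto intro: exI[of _ "B + C"])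
qed

lemma null_space_cmult: assumes "g \<in> null_space" shows "(\<lambda>x. c * g x) \<in> null_space"
proof -
  obtain B where "\<And>x. cmod (g x) \<le> B" using assms unfolding null_space_def by blast
  then have "cmod (c * g x) \<le> cmod c * B" for x by (simp add: norm_mult mult_left_mono)
  moreover have "(\<integral>x. f x * (c * g x) * cis (- (k \<bullet> x)) \<partial>M) = 0" if "k \<in> \<Gamma>" for k
  proof -
    have "(\<lambda>x. f x * (c * g x) * cis (- (k \<bullet> x))) = (\<lambda>x. c * (f x * g x * cis (- (k \<bullet> x))))" by (simp add: fun_eq_iff)
    then show ?thesis using assms that by (simp add: null_space_def)
  qed
  moreover have "(\<lambda>x. c * g x) \<in> borel_measurable M" using assms unfolding null_space_def by auto
  ultimately show ?thesis unfolding null_space_def by blast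
qed

lemma null_space_cis: assumes "g \<in> null_space" "l \<in> \<Gamma>" shows "(\<lambda>x. cis (l \<bullet> x) * g x) \<in> null_space"
proof -
  obtain B where "\<And>x. cmod (g x) \<le> B" using assms unfolding null_space_def by blast
  then have "cmod (cis (l \<bullet> x) * g x) \<le> B" for x by (simp add: norm_mult)
  moreover have "(\<integral>x. f x * (cis (l \<bullet> x) * g x) * cis (- (k \<bullet> x)) \<partial>M) = 0" if "k \<in> \<Gamma>" for k
  proof -
    have "f x * (cis (l \<bullet> x) * g x) * cis (- (k \<bullet> x)) = f x * g x * cis (- ((k - l) \<bullet> x))" for x
    proof -
      have "f x * (cis (l \<bullet> x) * g x) * cis (- (k \<bullet> x)) = f x * g x * (cis (l \<bullet> x) * cis (- (k \<bullet> x)))"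
        by (simp add: mult_ac)
      then show ?thesis by (simp add: cis_mult inner_diff_left)
    qed
    then show ?thesis using assms cubic_lattice_diff[OF that assms(2)] unfolding null_space_def by (simp only: mem_Collect_eq)
  qed
  moreover have "(\<lambda>x. cis (l \<bullet> x) * g x) \<in> borel_measurable M"
  proof -
    have [measurable]: "g \<in> borel_measurable M" using assms unfolding null_space_def by auto
    show ?thesis by measurable
  qed
  ultimately show ?thesis unfolding null_space_def by blast
qed

lemma multipliers_null_space: "h \<in> multipliers \<Longrightarrow> g \<in> null_space \<Longrightarrow> (\<lambda>x. of_real (h x) * g x) \<in> null_space"
  unfolding multipliers_def by blast

lemma multipliers_add: assumes "g \<in> multipliers" "h \<in> multipliers" shows "(\<lambda>x. g x + h x) \<in> multipliers"
proof -
  obtain B C where "\<And>x. \<bar>g x\<bar> \<le> B" "\<And>x. \<bar>h x\<bar> \<le> C" using assms unfolding multipliers_def by blast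
  then have "\<bar>g x + h x\<bar> \<le> B + C" for x by (meson add_mono abs_triangle_ineq order_trans)
  then show ?thesis using assms unfolding multipliers_def by (auto simp: distrib_right intro: null_space_add exI[of _ "B + C"])
qed

lemma multipliers_mult: assumes "g \<in> multipliers" "h \<in> multipliers" shows "(\<lambda>x. g x * h x) \<in> multipliers"
proof -
  obtain B C where "\<And>x. \<bar>g x\<bar> \<le> B" "\<And>x. \<bar>h x\<bar> \<le> C" using assms unfolding multipliers_def by blast
  then have "\<bar>g x * h x\<bar> \<le> B * C" for x
    using mult_mono[of "\<bar>g x\<bar>" B "\<bar>h x\<bar>" C] order_trans[OF abs_ge_zero, of "g x" B] by (simp add: abs_mult)
  then show ?thesis using assms unfolding multipliers_def by (auto simp: mult.assoc intro: exI[of _ "B * C"])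
qed

lemma multipliers_const: "(\<lambda>x. c) \<in> multipliers"
  unfolding multipliers_def by (auto intro: null_space_cmult exI[of _ "\<bar>c\<bar>"])

lemma multipliers_cos: assumes k: "k \<in> \<Gamma>" shows "(\<lambda>x. cos (k \<bullet> x)) \<in> multipliers"
proof -
  have "(\<lambda>x. of_real (cos (k \<bullet> x)) * g x) \<in> null_space" if g: "g \<in> null_space" for g
  proof -
    have "of_real (cos (k \<bullet> x)) = (cis (k \<bullet> x) + cis ((- k) \<bullet> x)) / 2" for x
      by (simp add: complex_eq_iff)
    then have "(\<lambda>x. of_real (cos (k \<bullet> x)) * g x) = (\<lambda>x. (1/2) * (cis (k \<bullet> x) * g x + cis ((- k) \<bullet> x) * g x))"
      by (simp only:) (simp add: distrib_right)
    then show ?thesis using null_space_cmult[OF null_space_add[OF null_space_cis[OF g k] null_space_cis[OF g, of "- k"]], of "1/2"] k by simp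
  qed
  then show ?thesis unfolding multipliers_def by (auto intro: exI[of _ 1])
qed

lemma multipliers_sin: assumes k: "k \<in> \<Gamma>" shows "(\<lambda>x. sin (k \<bullet> x)) \<in> multipliers"
proof -
  have "(\<lambda>x. of_real (sin (k \<bullet> x)) * g x) \<in> null_space" if g: "g \<in> null_space" for g
  proof -
    have "of_real (sin (k \<bullet> x)) = (- \<i> / 2) * cis (k \<bullet> x) + (\<i> / 2) * cis ((- k) \<bullet> x)" for x
      by (simp add: complex_eq_iff)
    then have "of_real (sin (k \<bullet> x)) * g x = (- \<i> / 2) * (cis (k \<bullet> x) * g x) + (\<i> / 2) * (cis ((- k) \<bullet> x) * g x)" for x
      by (simp only: distrib_right mult.assoc)
    then show ?thesis
      using null_space_add[OF null_space_cmult[OF null_space_cis[OF g k], of "- \<i> / 2"] null_space_cmult[OF null_space_cis[OF g, of "- k"], of "\<i> / 2"]] k by simp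
  qed
  then show ?thesis unfolding multipliers_def by (auto intro: exI[of _ 1])
qed

text \<open>Dominated convergence with majorant \<open>B * C\<close> times the modulus of
  \<open>f\<close>; the common bound \<open>B\<close> also keeps the limit bounded.\<close>

lemma multipliers_limit:
  assumes mem: "\<And>n. h n \<in> multipliers" and bd: "\<And>n x. \<bar>h n x\<bar> \<le> B" and lim: "\<And>x. (\<lambda>n. h n x) \<longlonglongrightarrow> l x"
  shows "l \<in> multipliers"
proof -
  have [measurable]: "h n \<in> borel_measurable M" for n using mem unfolding multipliers_def by blast
  have l: "l \<in> borel_measurable M"
    by (rule borel_measurable_LIMSEQ_metric[of h]) (use lim in auto)
  have lB: "\<bar>l x\<bar> \<le> B" for x
    by (rule LIMSEQ_le_const2[OF tendsto_rabs[OF lim]]) (use bd in auto)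
  have "(\<lambda>x. of_real (l x) * g x) \<in> null_space" if g: "g \<in> null_space" for g
  proof -
    obtain C where [measurable]: "g \<in> borel_measurable M" and C: "\<And>x. cmod (g x) \<le> C" using g unfolding null_space_def by blast
    have "cmod (of_real (l x) * g x) \<le> B * C" for x
      using mult_mono[OF lB[of x] C[of x]] lB[of x] by (simp add: norm_mult)
    moreover have "(\<integral>x. f x * (of_real (l x) * g x) * cis (- (k \<bullet> x)) \<partial>M) = 0" if k: "k \<in> \<Gamma>" for k
    proof -
      have "(\<lambda>n. \<integral>x. f x * (of_real (h n x) * g x) * cis (- (k \<bullet> x)) \<partial>M)
          \<longlonglongrightarrow> (\<integral>x. f x * (of_real (l x) * g x) * cis (- (k \<bullet> x)) \<partial>M)"
      proof (rule integral_dominated_convergence[where w = "\<lambda>x. cmod (f x) * (B * C)"])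
        show "integrable M (\<lambda>x. cmod (f x) * (B * C))" using f_int by simp
        show "AE x in M. (\<lambda>n. f x * (of_real (h n x) * g x) * cis (- (k \<bullet> x)))
            \<longlonglongrightarrow> f x * (of_real (l x) * g x) * cis (- (k \<bullet> x))"
          using lim by (intro AE_I2 tendsto_intros)
        show "AE x in M. cmod (f x * (of_real (h n x) * g x) * cis (- (k \<bullet> x))) \<le> cmod (f x) * (B * C)" for n
        proof (rule AE_I2)
          fix x
          have "cmod (of_real (h n x) * g x) \<le> B * C"
            using mult_mono[OF bd[of n x] C[of x]] bd[of n x] by (simp add: norm_mult)
          then show "cmod (f x * (of_real (h n x) * g x) * cis (- (k \<bullet> x))) \<le> cmod (f x) * (B * C)"
            by (simp add: norm_mult mult_left_mono)
        qed
      qed (use f_int l in measurable)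
      moreover have "(\<integral>x. f x * (of_real (h n x) * g x) * cis (- (k \<bullet> x)) \<partial>M) = 0" for n
        using mem[of n] g k unfolding multipliers_def by (auto simp: null_space_def)
      ultimately show ?thesis by (simp add: LIMSEQ_const_iff)
    qed
    moreover have "(\<lambda>x. of_real (l x) * g x) \<in> borel_measurable M" using l by measurable
    ultimately show ?thesis unfolding null_space_def by blast
  qed
  then show ?thesis using l lB unfolding multipliers_def by blast
qed

lemma multipliers_polynomial:
  assumes "real_polynomial_function p" "h \<in> multipliers"
  shows "(\<lambda>x. p (h x)) \<in> multipliers"
  using assms(1)
proof induction
  case (linear q)
  \<comment> \<open>A linear map on the reals is multiplication by its value at 1, hence
    \<open>q (h x)\<close> is a multiplier times a constant.\<close>
  have "q t = t * q 1" for t :: real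
    using linear_scale[OF bounded_linear.linear[OF linear], of t 1] by simp
  then have eq: "(\<lambda>x. q (h x)) = (\<lambda>x. h x * q 1)" by (rule ext)
  show ?case unfolding eq by (rule multipliers_mult[OF assms(2) multipliers_const])
qed (auto intro: multipliers_const multipliers_add multipliers_mult)

text \<open>A multiplier takes values in a compact interval, on which polynomials approximate
  \<open>q\<close> uniformly. Errors of at most 1 keep the approximants below \<open>C + 1\<close>,
  so that \<open>multipliers_limit\<close> applies.\<close>

lemma multipliers_continuous:
  fixes q :: "real \<Rightarrow> real"
  assumes h: "h \<in> multipliers" and cont: "continuous_on UNIV q"
  shows "(\<lambda>x. q (h x)) \<in> multipliers"
proof -
  obtain B where B: "\<And>x. \<bar>h x\<bar> \<le> B" using h unfolding multipliers_def by blast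
  have c: "continuous_on {-B..B} q" using cont continuous_on_subset by blast
  have "\<exists>p. real_polynomial_function p \<and> (\<forall>t\<in>{-B..B}. \<bar>q t - p t\<bar> < 1 / real (Suc n))" for n
  proof -
    obtain p where "real_polynomial_function p" "\<And>t. t \<in> {-B..B} \<Longrightarrow> \<bar>q t - p t\<bar> < 1 / real (Suc n)"
      by (rule Stone_Weierstrass_real_polynomial_function[OF compact_Icc c, of "1 / real (Suc n)"]) auto
    then show ?thesis by blast
  qed
  then obtain p where p: "\<And>n. real_polynomial_function (p n)"
    and pc: "\<And>n t. t \<in> {-B..B} \<Longrightarrow> \<bar>q t - p n t\<bar> < 1 / real (Suc n)" by metis
  have hB: "h x \<in> {-B..B}" for x using B[of x] by auto
  obtain C where C: "\<And>t. t \<in> {-B..B} \<Longrightarrow> \<bar>q t\<bar> \<le> C"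
    using compact_imp_bounded[OF compact_continuous_image[OF c compact_Icc]] unfolding bounded_iff by (metis imageI real_norm_def)
  show ?thesis
  proof (rule multipliers_limit[of "\<lambda>n x. p n (h x)" "C + 1"])
    show "(\<lambda>x. p n (h x)) \<in> multipliers" for n by (rule multipliers_polynomial[OF p h])
    show "\<bar>p n (h x)\<bar> \<le> C + 1" for n x
    proof -
      have "1 / real (Suc n) \<le> 1" by simp
      then show ?thesis using pc[OF hB[of x], of n] C[OF hB[of x]] by linarith
    qed
    show "(\<lambda>n. p n (h x)) \<longlonglongrightarrow> q (h x)" for x
    proof -
      have "(\<lambda>n. p n (h x) - q (h x)) \<longlonglongrightarrow> 0"
      proof (rule Lim_null_comparison[OF _ LIMSEQ_Suc[OF lim_1_over_n]])
        show "\<forall>\<^sub>F n in sequentially. norm (p n (h x) - q (h x)) \<le> 1 / real (Suc n)"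
          using pc[OF hB[of x]] by (intro always_eventually allI) (simp add: abs_minus_commute less_imp_le)
      qed
      then show ?thesis by (rule LIM_zero_cancel)
    qed
  qed
qed

section \<open>The sigma-algebra of sets whose indicators are multipliers\<close>

definition multiplier_sets :: "(real ^ 3) set set" where
  "multiplier_sets = {B \<in> sets M. indicator B \<in> multipliers}"

text \<open>Differences and intersections come from sums and products of multipliers, countable
  unions from the bounded limit of the indicators of partial unions.\<close>

lemma sigma_algebra_multiplier_sets: "sigma_algebra (space M) multiplier_sets"
proof (rule sigma_algebra_disjoint_iff[THEN iffD2], intro conjI)
  have diff: "C - B \<in> multiplier_sets" if "B \<in> multiplier_sets" "C \<in> multiplier_sets" for B C
  proof -
    have "indicator (C - B) = (\<lambda>x. indicator C x + (- 1) * (indicator C x * indicator B x) :: real)"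
      by (auto simp: fun_eq_iff indicator_def)
    moreover have "(\<lambda>x. indicator C x + (- 1) * (indicator C x * indicator B x) :: real) \<in> multipliers"
      using that unfolding multiplier_sets_def by (intro multipliers_add multipliers_mult multipliers_const) blast+
    ultimately have "indicator (C - B) \<in> multipliers" by simp
    then show ?thesis using that unfolding multiplier_sets_def by auto
  qed
  have inter: "C \<inter> B \<in> multiplier_sets" if "B \<in> multiplier_sets" "C \<in> multiplier_sets" for B C
  proof -
    have "indicator (C \<inter> B) = (\<lambda>x. indicator C x * indicator B x :: real)"
      by (auto simp: fun_eq_iff indicator_def)
    then have "indicator (C \<inter> B) \<in> multipliers"
      using that by (auto simp: multiplier_sets_def intro!: multipliers_mult)
    then show ?thesis using that unfolding multiplier_sets_def by auto
  qed
  \<comment> \<open>This indicator is not the constant 1 as a function on all of space: it vanishes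
    off the box, where integrals over \<open>M\<close> do not see it.\<close>
  have sp: "space M \<in> multiplier_sets"
  proof -
    have "(\<lambda>x. of_real (indicator (space M) x) * g x) \<in> null_space" if "g \<in> null_space" for g
    proof -
      obtain B where [measurable]: "g \<in> borel_measurable M" and "\<And>x. cmod (g x) \<le> B" using \<open>g \<in> null_space\<close> unfolding null_space_def by blast
      then have "cmod (of_real (indicator (space M) x) * g x) \<le> B" for x
        using order_trans[OF norm_ge_zero, of "g x" B] by (auto simp: indicator_def)
      moreover have "(\<integral>x. f x * (of_real (indicator (space M) x) * g x) * cis (- (k \<bullet> x)) \<partial>M) = 0" if "k \<in> \<Gamma>" for k
      proof -
        have "(\<integral>x. f x * (of_real (indicator (space M) x) * g x) * cis (- (k \<bullet> x)) \<partial>M) = (\<integral>x. f x * g x * cis (- (k \<bullet> x)) \<partial>M)"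
          by (intro Bochner_Integration.integral_cong) auto
        then show ?thesis using \<open>g \<in> null_space\<close> that by (simp add: null_space_def)
      qed
      moreover have "(\<lambda>x. of_real (indicator (space M) x) * g x) \<in> borel_measurable M" by measurable
      ultimately show ?thesis unfolding null_space_def by blast
    qed
    then have "indicator (space M) \<in> multipliers"
      unfolding multipliers_def by (auto simp: indicator_def intro: exI[of _ 1])
    then show ?thesis unfolding multiplier_sets_def by auto
  qed
  have empty: "{} \<in> multiplier_sets" using diff[OF sp sp] by simp
  have un: "B \<union> C \<in> multiplier_sets" if "B \<in> multiplier_sets" "C \<in> multiplier_sets" for B C
  proof -
    have "B \<union> C \<subseteq> space M" using that sets.sets_into_space unfolding multiplier_sets_def by blast
    then have "B \<union> C = space M - ((space M - B) \<inter> (space M - C))" by blast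
    then show ?thesis using diff inter sp that by metis
  qed
  show "algebra (space M) multiplier_sets"
    unfolding algebra_iff_Un
  proof (intro conjI ballI)
    show "multiplier_sets \<subseteq> Pow (space M)" using sets.sets_into_space unfolding multiplier_sets_def by auto
  qed (use diff un empty sp in auto)
  show "\<forall>D :: nat \<Rightarrow> _. range D \<subseteq> multiplier_sets \<longrightarrow> disjoint_family D \<longrightarrow> (\<Union>i. D i) \<in> multiplier_sets"
  proof (intro allI impI)
    fix D :: "nat \<Rightarrow> (real ^ 3) set" assume D: "range D \<subseteq> multiplier_sets"
    define E where "E n = (\<Union>i<n. D i)" for n
    have "E n \<in> multiplier_sets" for n
      by (induction n) (use D in \<open>auto simp: E_def lessThan_Suc empty intro!: un\<close>)
    then have "indicator (E n) \<in> multipliers" for n unfolding multiplier_sets_def by blast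
    moreover have "(\<lambda>n. indicator (E n) x :: real) \<longlonglongrightarrow> indicator (\<Union>i. D i) x" for x
    proof -
      have "incseq E" unfolding E_def incseq_def by force
      moreover have "(\<Union>n. E n) = (\<Union>i. D i)" unfolding E_def by auto
      ultimately show ?thesis using LIMSEQ_indicator_incseq[of E] by simp
    qed
    moreover have "\<bar>indicator (E n) x\<bar> \<le> (1 :: real)" for n x by (simp add: indicator_def)
    ultimately have "indicator (\<Union>i. D i) \<in> multipliers"
      using multipliers_limit[of "\<lambda>n. indicator (E n)" 1 "indicator (\<Union>i. D i)"] by blast
    then show "(\<Union>i. D i) \<in> multiplier_sets" using D unfolding multiplier_sets_def by auto
  qed
qed

definition multiplier_algebra :: "(real ^ 3) measure" where "multiplier_algebra = sigma (space M) multiplier_sets"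

lemma multiplier_sets_subset: "multiplier_sets \<subseteq> Pow (space M)"
  using sets.sets_into_space unfolding multiplier_sets_def by auto

lemma sets_multiplier_algebra: "sets multiplier_algebra = multiplier_sets"
  using sigma_algebra.sigma_sets_eq[OF sigma_algebra_multiplier_sets] multiplier_sets_subset by (simp add: multiplier_algebra_def)

lemma space_multiplier_algebra: "space multiplier_algebra = space M"
  using multiplier_sets_subset by (simp add: multiplier_algebra_def)

text \<open>Each superlevel set of \<open>h\<close> has as its indicator the bounded limit of ramps
  of \<open>h - a\<close>, which are continuous functions of a multiplier.\<close>

lemma multipliers_measurable_multiplier_algebra: assumes h: "h \<in> multipliers" shows "h \<in> borel_measurable multiplier_algebra"
proof (rule borel_measurable_iff_greater[THEN iffD2], rule allI)
  fix a
  define D where "D = {x \<in> space M. a < h x}"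
  have "(\<lambda>x. if 0 < h x - a then 1 else 0 :: real) \<in> multipliers"
  proof (rule multipliers_limit[of "\<lambda>n x. min 1 (max 0 (real n * (h x - a)))" 1])
    show "(\<lambda>x. min 1 (max 0 (real n * (h x - a)))) \<in> multipliers" for n
      by (rule multipliers_continuous[OF h]) (intro continuous_intros)
    show "\<bar>min 1 (max 0 (real n * (h x - a)))\<bar> \<le> 1" for n x by auto
  qed (rule tendsto_ramp_indicator)
  \<comment> \<open>The limit of the ramps is an indicator on all of space; this factor cuts it down
    to \<open>D\<close>.\<close>
  moreover have "indicator (space M) \<in> multipliers"
    using algebra.top[OF sigma_algebra.axioms(1)[OF sigma_algebra_multiplier_sets]] unfolding multiplier_sets_def by simp
  ultimately have "(\<lambda>x. (if 0 < h x - a then 1 else 0) * indicator (space M) x) \<in> multipliers" by (rule multipliers_mult)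
  also have "(\<lambda>x. (if 0 < h x - a then 1 else 0) * indicator (space M) x) = (indicator D :: _ \<Rightarrow> real)"
    by (auto simp: D_def fun_eq_iff indicator_def)
  finally have "indicator D \<in> multipliers" .
  moreover have "D \<in> sets M"
  proof -
    have [measurable]: "h \<in> borel_measurable M" using h unfolding multipliers_def by blast
    show ?thesis unfolding D_def by measurable
  qed
  ultimately show "{x \<in> space multiplier_algebra. a < h x} \<in> sets multiplier_algebra" unfolding sets_multiplier_algebra multiplier_sets_def space_multiplier_algebra D_def by blast
qed

text \<open>Off the boundary of the cell \<open>x\<close> is recovered from its trigonometric functions by the half-angle
  formula \<open>tan (t / 2) = sin t / (1 + cos t)\<close>.\<close>

definition coordinates :: "real ^ 3 \<Rightarrow> real ^ 3" where
  "coordinates x = (\<Sum>i\<in>UNIV. (L / pi * arctan (sin (2 * pi / L * x $ i) / (1 + cos (2 * pi / L * x $ i)))) *\<^sub>R axis i 1)"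

lemma coordinates_measurable: "coordinates \<in> measurable multiplier_algebra borel"
proof -
  have "axis i (2 * pi / L) \<in> \<Gamma>" for i :: 3
    by (auto simp: cubic_lattice_def axis_def intro: exI[of _ 0] exI[of _ 1])
  then have [measurable]: "(\<lambda>x. sin (2 * pi / L * x $ i)) \<in> borel_measurable multiplier_algebra"
      "(\<lambda>x. cos (2 * pi / L * x $ i)) \<in> borel_measurable multiplier_algebra" for i
    using multipliers_measurable_multiplier_algebra[OF multipliers_sin[of "axis i (2 * pi / L)"]] multipliers_measurable_multiplier_algebra[OF multipliers_cos[of "axis i (2 * pi / L)"]]
    by (simp_all add: inner_axis')
  have [measurable]: "arctan \<in> borel_measurable borel"
    by (intro borel_measurable_continuous_onI continuous_intros)
  show ?thesis unfolding coordinates_def by measurable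
qed

text \<open>The half-angle formula breaks down only where \<open>1 + cos\<close> vanishes, on the
  faces of the box, because division by zero returns 0. The condition \<open>wrap L x = x\<close>
  excludes the upper faces, and the lower ones are removed as null sets.\<close>

lemma AE_coordinates: "AE x in M. coordinates x = x"
proof -
  have "coordinates x = x" if w: "wrap L x = x" and b: "\<forall>i. x $ i \<noteq> - L / 2" for x
  proof -
    have "L / pi * arctan (sin (2 * pi / L * x $ i) / (1 + cos (2 * pi / L * x $ i))) = x $ i" for i
    proof -
      define t where "t = pi * x $ i / L"
      have "- L / 2 < x $ i" "x $ i < L / 2" using w b unfolding wrap_eq_iff by (auto simp: order_less_le)
      then have t: "- (pi / 2) < t" "t < pi / 2"
        using L_pos mult_strict_left_mono[of "- L / 2" "x $ i" pi] mult_strict_left_mono[of "x $ i" "L / 2" pi]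
        by (simp_all add: t_def field_simps)
      then have c: "cos t > 0" by (intro cos_gt_zero_pi) auto
      have "2 * pi / L * x $ i = 2 * t" by (simp add: t_def)
      then have "sin (2 * pi / L * x $ i) / (1 + cos (2 * pi / L * x $ i)) = (2 * sin t * cos t) / (2 * (cos t)\<^sup>2)"
        by (simp add: sin_double cos_double_cos)
      also have "\<dots> = tan t" using c by (simp add: tan_def power2_eq_square)
      finally have "arctan (sin (2 * pi / L * x $ i) / (1 + cos (2 * pi / L * x $ i))) = t"
        using t by (simp add: arctan_tan)
      then show ?thesis using L_pos by (simp add: t_def)
    qed
    then show ?thesis by (simp add: coordinates_def vec_eq_iff sum_component axis_def if_distrib cong: if_cong)
  qed
  moreover have "AE x in M. \<forall>i. x $ i \<noteq> - L / 2"
  proof (subst AE_all_countable, intro allI)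
    fix i :: 3
    have "negligible {x :: real ^ 3. x \<bullet> axis i 1 = - L / 2}"
      by (rule negligible_standard_hyperplane) (simp add: axis_in_Basis_iff)
    then have "{x :: real ^ 3. x $ i = - L / 2} \<in> null_sets lebesgue"
      by (simp add: negligible_iff_null_sets inner_axis)
    moreover have "{x :: real ^ 3. x $ i = - L / 2} \<in> sets borel" by measurable
    ultimately have "{x :: real ^ 3. x $ i = - L / 2} \<in> null_sets lborel"
      by (simp add: null_sets_def)
    then have "AE x in lborel. x $ i \<noteq> - L / 2" by (rule AE_I') auto
    then show "AE x in M. x $ i \<noteq> - L / 2"
      unfolding torus_measure_def by (auto simp: AE_restrict_space_iff elim!: eventually_mono)
  qed
  ultimately show ?thesis using AE_wrap by (auto elim!: eventually_elim2)
qed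

text \<open>\<open>coordinates\<close> is measurable for the multiplier algebra and almost
  everywhere the identity, so every Borel subset of the box agrees up to a null set with a set
  \<open>D\<close> whose indicator is a multiplier. Applied to the constant 1 at frequency 0, that
  multiplier shows that \<open>f\<close> integrates to zero over the set.\<close>

lemma AE_zero: "AE x in M. f x = 0"
proof (rule fm.density_zero[OF f_int])
  fix B assume B: "B \<in> sets M"
  then have [measurable]: "B \<in> sets borel" by (rule sets_M_borel)
  define D where "D = coordinates -` B \<inter> space M"
  have "D \<in> sets multiplier_algebra" unfolding D_def space_multiplier_algebra[symmetric] by (rule measurable_sets[OF coordinates_measurable]) simp
  then have D: "D \<in> sets M" "indicator D \<in> multipliers" unfolding sets_multiplier_algebra multiplier_sets_def by blast+
  have "set_lebesgue_integral M B f = set_lebesgue_integral M D f"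
    unfolding set_lebesgue_integral_def
  proof (rule integral_cong_AE)
    show "AE x in M. indicator B x *\<^sub>R f x = indicator D x *\<^sub>R f x"
      using AE_coordinates AE_space by eventually_elim (simp add: D_def indicator_def)
  qed (use B D f_int in measurable)
  also have "\<dots> = (\<integral>x. f x * (of_real (indicator D x) * 1) * cis (- (0 \<bullet> x)) \<partial>M)"
    unfolding set_lebesgue_integral_def
    by (intro Bochner_Integration.integral_cong) (auto simp: indicator_def)
  also have "\<dots> = 0"
  proof -
    have "(\<lambda>x. of_real (indicator D x) * 1) \<in> null_space" by (rule multipliers_null_space[OF D(2) one_null_space])
    then show ?thesis using cubic_lattice_zero[of "2 * pi / L"] unfolding null_space_def by blast
  qed
  finally show "set_lebesgue_integral M B f = 0" .
qed

end

lemma (in torus) fourier_unique: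
  assumes "integrable M f" "integrable M g" "\<And>k. k \<in> \<Gamma> \<Longrightarrow> fourier L f k = fourier L g k"
  shows "AE x in M. f x = g x"
proof -
  interpret annihilated L "\<lambda>x. f x - g x"
    by standard (use assms in \<open>auto simp: fourier_diff\<close>)
  show ?thesis using AE_zero by simp
qed

section \<open>The theorems of Riesz-Fischer and Parseval\<close>

context torus
begin

section \<open>The space of square-integrable functions\<close>

lemma L2D:
  assumes "f \<in> L2 L"
  shows "periodic L f" "f \<in> borel_measurable borel" "integrable M (\<lambda>x. (norm (f x))\<^sup>2)"
  using assms unfolding L2_def by auto

lemma L2I:
  assumes "periodic L f" "f \<in> borel_measurable borel" "integrable M (\<lambda>x. (norm (f x))\<^sup>2)"
  shows "f \<in> L2 L"
  using assms unfolding L2_def by auto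

lemma L2_norm_sq: "(L2_norm L f)\<^sup>2 = (\<integral>x. (norm (f x))\<^sup>2 \<partial>M)"
  unfolding L2_norm_def by (simp add: integral_nonneg_AE)

lemma L2_norm_nonneg [simp]: "0 \<le> L2_norm L f"
  unfolding L2_norm_def by simp

lemma L2_norm_cplx [simp]: "L2_norm L (cplx f) = L2_norm L f"
  unfolding L2_norm_def by simp

lemma L2_cplx_iff [simp]: "cplx f \<in> L2 L \<longleftrightarrow> f \<in> L2 L"
proof -
  have "cplx f \<in> borel_measurable borel \<longleftrightarrow> f \<in> borel_measurable borel"
    unfolding borel_measurable_complex_iff[of "cplx f"] by simp
  moreover have "periodic L (cplx f) \<longleftrightarrow> periodic L f" by (simp add: periodic_def)
  ultimately show ?thesis by (simp add: L2_def)
qed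

lemma L2_integrable:
  fixes f :: "real ^ 3 \<Rightarrow> 'b :: {banach, second_countable_topology}"
  assumes "f \<in> L2 L" shows "integrable M f"
proof (rule Bochner_Integration.integrable_bound)
  note [measurable] = L2D(2)[OF assms]
  show "integrable M (\<lambda>x. 1 + (norm (f x))\<^sup>2)" using L2D(3)[OF assms] by simp
  show "f \<in> borel_measurable M" by measurable
  show "AE x in M. norm (f x) \<le> norm (1 + (norm (f x))\<^sup>2)"
  proof (rule AE_I2)
    fix x
    have "0 \<le> (norm (f x) - 1)\<^sup>2" "0 \<le> norm (f x)" by simp_all
    then have "norm (f x) \<le> 1 + (norm (f x))\<^sup>2"
      unfolding power2_diff power_one by linarith
    then show "norm (f x) \<le> norm (1 + (norm (f x))\<^sup>2)" by simp
  qed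
qed

lemma L2_mult_integrable:
  fixes f g :: "real ^ 3 \<Rightarrow> 'b :: {real_normed_algebra, banach, second_countable_topology}"
  assumes "f \<in> L2 L" "g \<in> L2 L" shows "integrable M (\<lambda>x. f x * g x)"
proof (rule Bochner_Integration.integrable_bound)
  note [measurable] = L2D(2)[OF assms(1)] L2D(2)[OF assms(2)]
  show "integrable M (\<lambda>x. (norm (f x))\<^sup>2 + (norm (g x))\<^sup>2)" using L2D(3)[OF assms(1)] L2D(3)[OF assms(2)] by simp
  show "(\<lambda>x. f x * g x) \<in> borel_measurable M" by measurable
  show "AE x in M. norm (f x * g x) \<le> norm ((norm (f x))\<^sup>2 + (norm (g x))\<^sup>2)"
  proof (rule AE_I2)
    fix x
    have "norm (f x * g x) \<le> norm (f x) * norm (g x)" by (rule norm_mult_ineq)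
    moreover have "0 \<le> (norm (f x) - norm (g x))\<^sup>2" "0 \<le> norm (f x) * norm (g x)" by simp_all
    ultimately have "norm (f x * g x) \<le> (norm (f x))\<^sup>2 + (norm (g x))\<^sup>2"
      unfolding power2_diff mult.assoc by linarith
    then show "norm (f x * g x) \<le> norm ((norm (f x))\<^sup>2 + (norm (g x))\<^sup>2)" by simp
  qed
qed

lemma L2_add:
  fixes f g :: "real ^ 3 \<Rightarrow> 'b :: {banach, second_countable_topology}"
  assumes "f \<in> L2 L" "g \<in> L2 L" shows "(\<lambda>x. f x + g x) \<in> L2 L"
proof (rule L2I)
  note [measurable] = L2D(2)[OF assms(1)] L2D(2)[OF assms(2)]
  show "periodic L (\<lambda>x. f x + g x)" using L2D(1)[OF assms(1)] L2D(1)[OF assms(2)] by (simp add: periodic_def)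
  show "(\<lambda>x. f x + g x) \<in> borel_measurable borel" by measurable
  show "integrable M (\<lambda>x. (norm (f x + g x))\<^sup>2)"
  proof (rule Bochner_Integration.integrable_bound)
    show "integrable M (\<lambda>x. 2 * (norm (f x))\<^sup>2 + 2 * (norm (g x))\<^sup>2)" using L2D(3)[OF assms(1)] L2D(3)[OF assms(2)] by simp
    show "AE x in M. norm ((norm (f x + g x))\<^sup>2) \<le> norm (2 * (norm (f x))\<^sup>2 + 2 * (norm (g x))\<^sup>2)"
    proof (rule AE_I2)
      fix x
      have "(norm (f x + g x))\<^sup>2 \<le> (norm (f x) + norm (g x))\<^sup>2" by (simp add: norm_triangle_ineq power_mono)
      moreover have "0 \<le> (norm (f x) - norm (g x))\<^sup>2" by simp
      ultimately show "norm ((norm (f x + g x))\<^sup>2) \<le> norm (2 * (norm (f x))\<^sup>2 + 2 * (norm (g x))\<^sup>2)"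
        by (simp add: power2_eq_square algebra_simps)
    qed
  qed measurable
qed

lemma L2_cmult:
  fixes f :: "real ^ 3 \<Rightarrow> 'b :: {real_normed_field, banach, second_countable_topology}"
  assumes "f \<in> L2 L" shows "(\<lambda>x. c * f x) \<in> L2 L"
proof (rule L2I)
  note [measurable] = L2D(2)[OF assms(1)]
  show "periodic L (\<lambda>x. c * f x)" using L2D(1)[OF assms(1)] by (simp add: periodic_def)
  show "(\<lambda>x. c * f x) \<in> borel_measurable borel" by measurable
  show "integrable M (\<lambda>x. (norm (c * f x))\<^sup>2)" using L2D(3)[OF assms] by (simp add: norm_mult power_mult_distrib)
qed

lemma L2_uminus:
  fixes f :: "real ^ 3 \<Rightarrow> 'b :: {banach, second_countable_topology}"
  assumes "f \<in> L2 L" shows "(\<lambda>x. - f x) \<in> L2 L"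
  using L2D[OF assms] by (intro L2I) (simp_all add: periodic_def)

lemma L2_diff:
  fixes f g :: "real ^ 3 \<Rightarrow> 'b :: {banach, second_countable_topology}"
  assumes "f \<in> L2 L" "g \<in> L2 L" shows "(\<lambda>x. f x - g x) \<in> L2 L"
  using L2_add[OF assms(1) L2_uminus[OF assms(2)]] by simp

lemma borel_measurable_cnj:
  assumes "f \<in> borel_measurable borel"
  shows "(\<lambda>x. cnj (f x)) \<in> borel_measurable borel"
  using measurable_compose[OF assms borel_measurable_continuous_onI[OF continuous_on_cnj[OF continuous_on_id]]] .

lemma L2_cnj: "f \<in> L2 L \<Longrightarrow> (\<lambda>x. cnj (f x)) \<in> L2 L"
  using L2D[of f] by (intro L2I borel_measurable_cnj) (simp_all add: periodic_def)

lemma L2_bounded: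
  fixes f :: "real ^ 3 \<Rightarrow> 'b :: {banach, second_countable_topology}"
  assumes "periodic L f" "f \<in> borel_measurable borel" "\<And>x. norm (f x) \<le> B"
  shows "f \<in> L2 L"
proof (rule L2I)
  note [measurable] = assms(2)
  show "integrable M (\<lambda>x. (norm (f x))\<^sup>2)"
    by (rule fm.integrable_const_bound[where B = "B\<^sup>2"]) (use assms(3) in \<open>auto intro!: power_mono\<close>)
qed (use assms in auto)

lemma L2_zero: "(\<lambda>x. 0 :: 'b :: {banach, second_countable_topology}) \<in> L2 L"
  by (rule L2_bounded[of _ 0]) (auto simp: periodic_def)

lemma L2_sum:
  fixes f :: "'c \<Rightarrow> real ^ 3 \<Rightarrow> 'b :: {banach, second_countable_topology}"
  assumes "\<And>i. i \<in> I \<Longrightarrow> f i \<in> L2 L" shows "(\<lambda>x. \<Sum>i\<in>I. f i x) \<in> L2 L"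
  using assms by (induction I rule: infinite_finite_induct) (simp_all add: L2_zero L2_add)

lemma L2_translate:
  fixes f :: "real ^ 3 \<Rightarrow> 'b :: {banach, second_countable_topology}"
  assumes "f \<in> L2 L" shows "translate y f \<in> L2 L"
proof (rule L2I)
  note [measurable] = L2D(2)[OF assms]
  show "periodic L (translate y f)" using L2D(1)[OF assms] by (rule periodic_translate)
  show "translate y f \<in> borel_measurable borel" by measurable
  have "integrable M (\<lambda>x. (norm (f (x - y)))\<^sup>2)"
    by (rule integrable_M_translate[of "\<lambda>x. (norm (f x))\<^sup>2"])
      (use L2D[OF assms] in \<open>auto simp: periodic_def\<close>)
  then show "integrable M (\<lambda>x. (norm (translate y f x))\<^sup>2)" by (simp add: translate_def)
qed

section \<open>Trigonometric polynomials and Bessel's inequality\<close>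

definition wave_const :: complex where "wave_const = of_real (L powr (- 3 / 2))"

lemma wave_const_sq: "wave_const * wave_const * of_real (L ^ 3) = 1"
proof -
  have "L powr (- 3 / 2) * L powr (- 3 / 2) * L ^ 3 = L powr (- 3 / 2) * L powr (- 3 / 2) * L powr 3"
    using L_pos powr_realpow[of L 3] by simp
  also have "\<dots> = L powr ((- 3 / 2) + (- 3 / 2) + 3)" unfolding powr_add by simp
  also have "\<dots> = 1" using L_pos by simp
  finally show ?thesis unfolding wave_const_def by (metis of_real_1 of_real_mult)
qed

lemma cnj_wave_const [simp]: "cnj wave_const = wave_const" by (simp add: wave_const_def)

definition trig :: "(real ^ 3) set \<Rightarrow> (real ^ 3 \<Rightarrow> complex) \<Rightarrow> real ^ 3 \<Rightarrow> complex" where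
  "trig F c x = (\<Sum>k\<in>F. c k * wave_const * cis (k \<bullet> x))"

lemma trig_measurable [measurable]: "trig F c \<in> borel_measurable borel"
  unfolding trig_def by measurable

lemma L2_plane_wave:
  assumes "k \<in> \<Gamma>" shows "(\<lambda>x. c * cis (k \<bullet> x)) \<in> L2 L"
proof (rule L2_bounded[of _ "cmod c"])
  show "periodic L (\<lambda>x. c * cis (k \<bullet> x))" using periodic_cis[OF assms] by (simp add: periodic_def)
qed (simp_all add: norm_mult)

lemma L2_trig: "F \<subseteq> \<Gamma> \<Longrightarrow> trig F c \<in> L2 L"
  unfolding trig_def by (intro L2_sum) (auto intro: L2_plane_wave)

lemma integral_mult_cnj_trig:
  assumes "integrable M f"
  shows "(\<integral>x. f x * cnj (trig F c x) \<partial>M) = (\<Sum>k\<in>F. fourier L f k * cnj (c k))"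
proof -
  have "f x * cnj (trig F c x) = (\<Sum>k\<in>F. (cnj (c k) * wave_const) * (f x * cis (- (k \<bullet> x))))" for x
    by (simp add: trig_def sum_distrib_left cis_cnj mult_ac)
  then have "(\<integral>x. f x * cnj (trig F c x) \<partial>M) = (\<integral>x. (\<Sum>k\<in>F. (cnj (c k) * wave_const) * (f x * cis (- (k \<bullet> x)))) \<partial>M)"
    by simp
  also have "\<dots> = (\<Sum>k\<in>F. \<integral>x. (cnj (c k) * wave_const) * (f x * cis (- (k \<bullet> x))) \<partial>M)"
    by (rule Bochner_Integration.integral_sum) (use integrable_mult_cis_minus[OF assms] in simp)
  also have "\<dots> = (\<Sum>k\<in>F. fourier L f k * cnj (c k))"
    by (intro sum.cong) (simp_all add: fourier_def wave_const_def)
  finally show ?thesis .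
qed

lemma fourier_plane_wave:
  assumes "k \<in> \<Gamma>" "l \<in> \<Gamma>"
  shows "fourier L (\<lambda>x. wave_const * cis (l \<bullet> x)) k = (if k = l then 1 else 0)"
proof -
  have "(\<integral>x. wave_const * cis (l \<bullet> x) * cis (- (k \<bullet> x)) \<partial>M) = (\<integral>x. wave_const * cis ((l - k) \<bullet> x) \<partial>M)"
    by (intro Bochner_Integration.integral_cong) (simp_all add: mult.assoc cis_mult inner_diff_left)
  also have "\<dots> = wave_const * (if l - k = 0 then of_real (L ^ 3) else 0)"
    using integral_cis[OF cubic_lattice_diff[OF assms(2,1)]] by simp
  finally show ?thesis using wave_const_sq unfolding fourier_def wave_const_def[symmetric] by (auto simp: mult.assoc)
qed

lemma fourier_trig:
  assumes "F \<subseteq> \<Gamma>" "finite F" "k \<in> \<Gamma>"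
  shows "fourier L (trig F c) k = (if k \<in> F then c k else 0)"
  using assms(2,1)
proof (induction F rule: finite_induct)
  case empty
  then show ?case by (simp add: trig_def)
next
  case (insert l F)
  have int: "integrable M (\<lambda>x. c l * (wave_const * cis (l \<bullet> x)))" "integrable M (trig F c)"
    using insert.prems by (auto intro!: L2_integrable L2_cmult L2_plane_wave L2_trig)
  have "trig (insert l F) c = (\<lambda>x. c l * (wave_const * cis (l \<bullet> x)) + trig F c x)"
    using insert.hyps by (auto simp: trig_def mult.assoc)
  then have "fourier L (trig (insert l F) c) k = c l * (if k = l then 1 else 0) + fourier L (trig F c) k"
    using fourier_add[OF int, of k] fourier_plane_wave[OF assms(3), of l] insert.prems
    by (simp add: fourier_cmult)
  then show ?case using insert by auto
qed

lemma norm_sq_trig: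
  assumes "F \<subseteq> \<Gamma>" "finite F"
  shows "(\<integral>x. (cmod (trig F c x))\<^sup>2 \<partial>M) = (\<Sum>k\<in>F. (cmod (c k))\<^sup>2)"
proof -
  have "complex_of_real (\<integral>x. (cmod (trig F c x))\<^sup>2 \<partial>M) = (\<integral>x. trig F c x * cnj (trig F c x) \<partial>M)"
    unfolding integral_complex_of_real[symmetric] by (simp add: complex_norm_square[symmetric])
  also have "\<dots> = (\<Sum>k\<in>F. fourier L (trig F c) k * cnj (c k))"
    by (rule integral_mult_cnj_trig[OF L2_integrable[OF L2_trig[OF assms(1)]]])
  also have "\<dots> = (\<Sum>k\<in>F. c k * cnj (c k))"
    using assms by (intro sum.cong refl) (simp add: fourier_trig subset_iff)
  also have "\<dots> = complex_of_real (\<Sum>k\<in>F. (cmod (c k))\<^sup>2)"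
    by (simp add: complex_norm_square[symmetric])
  finally show ?thesis using of_real_eq_iff by blast
qed

lemma cmod_diff_sq: "(cmod (a - b))\<^sup>2 = (cmod a)\<^sup>2 - 2 * Re (a * cnj b) + (cmod b)\<^sup>2"
  unfolding cmod_power2 by (simp add: power2_eq_square algebra_simps)

lemma cmod_add_sq: "(cmod (a + b))\<^sup>2 = (cmod a)\<^sup>2 + 2 * Re (a * cnj b) + (cmod b)\<^sup>2"
  unfolding cmod_power2 by (simp add: power2_eq_square algebra_simps)

text \<open>Expand the square of the distance from \<open>f\<close> to its partial Fourier sum
  \<open>S\<close>: the pairing of \<open>f\<close> with \<open>S\<close> and the squared norm of
  \<open>S\<close> are both the sum on the left.\<close>

lemma bessel:
  assumes f: "f \<in> L2 L" and F: "F \<subseteq> \<Gamma>" "finite F"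
  shows "(\<Sum>k\<in>F. (cmod (fourier L f k))\<^sup>2) \<le> (L2_norm L f)\<^sup>2"
proof -
  define S where "S = trig F (fourier L f)"
  have S: "S \<in> L2 L" unfolding S_def by (rule L2_trig[OF F(1)])
  have int: "integrable M (\<lambda>x. f x * cnj (S x))"
    using L2_mult_integrable[OF f L2_cnj[OF S]] .
  have "0 \<le> (\<integral>x. (cmod (f x - S x))\<^sup>2 \<partial>M)" by simp
  also have "\<dots> = (\<integral>x. (cmod (f x))\<^sup>2 - 2 * Re (f x * cnj (S x)) + (cmod (S x))\<^sup>2 \<partial>M)"
    by (simp only: cmod_diff_sq)
  also have "\<dots> = (\<integral>x. (cmod (f x))\<^sup>2 \<partial>M) - 2 * Re (\<integral>x. f x * cnj (S x) \<partial>M) + (\<integral>x. (cmod (S x))\<^sup>2 \<partial>M)"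
    using L2D(3)[OF f] L2D(3)[OF S] integrable_Re[OF int] integral_Re[OF int]
    by (simp del: times_complex.sel cnj.sel)
  also have "(\<integral>x. f x * cnj (S x) \<partial>M) = of_real (\<Sum>k\<in>F. (cmod (fourier L f k))\<^sup>2)"
    unfolding S_def integral_mult_cnj_trig[OF L2_integrable[OF f]] by (simp add: complex_norm_square[symmetric])
  also have "(\<integral>x. (cmod (S x))\<^sup>2 \<partial>M) = (\<Sum>k\<in>F. (cmod (fourier L f k))\<^sup>2)"
    unfolding S_def by (rule norm_sq_trig[OF F])
  finally show ?thesis by (simp add: L2_norm_sq)
qed

lemma fourier_sq_summable:
  assumes "f \<in> L2 L" shows "(\<lambda>k. (cmod (fourier L f k))\<^sup>2) summable_on \<Gamma>"
  by (rule nonneg_bounded_partial_sums_imp_summable_on[where C = "(L2_norm L f)\<^sup>2"])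
    (use bessel[OF assms] in \<open>auto simp: eventually_finite_subsets_at_top_weakI\<close>)

end

text \<open>Cuts a convergent series into blocks with geometrically decaying sums, so that in
  \<open>riesz_fischer\<close> the blocks converge absolutely at almost every point. The first block
  is uncontrolled, which is why \<open>D\<close> appears.\<close>

lemma fast_blocks:
  fixes b :: "nat \<Rightarrow> real"
  assumes "summable b" "\<And>n. 0 \<le> b n"
  obtains N :: "nat \<Rightarrow> nat" and D where "N 0 = 0" "mono N" "\<And>j. j \<le> N j" "\<And>j. (\<Sum>n = N j..<N (Suc j). b n) \<le> D / 4 ^ j" "0 \<le> D"
proof -
  have "\<exists>P. \<forall>m\<ge>P. \<forall>n. norm (sum b {m..<n}) < 1 / 4 ^ j" for j :: nat
    using assms(1)[unfolded summable_Cauchy] by (simp add: zero_less_power)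
  then obtain P where P: "\<And>j m n. m \<ge> P j \<Longrightarrow> norm (sum b {m..<n}) < 1 / 4 ^ j" by metis
  \<comment> \<open>The sum over all \<open>i \<le> j\<close> makes \<open>N\<close> monotone and at
    least \<open>P j\<close>; the summand \<open>j\<close> lets the blocks exhaust all
    indices.\<close>
  define N where "N j = (if j = 0 then 0 else j + (\<Sum>i\<le>j. P i))" for j :: nat
  have step: "N j \<le> N (Suc j)" for j by (simp add: N_def)
  have "N j \<ge> P j" if "j \<noteq> 0" for j using that by (cases j) (auto simp: N_def)
  then have le1: "(\<Sum>n = N j..<N (Suc j). b n) \<le> 1 / 4 ^ j" if "j \<noteq> 0" for j
    using P[of j "N j" "N (Suc j)"] that by (auto simp: abs_le_iff)
  have nonneg: "0 \<le> (\<Sum>n = N 0..<N 1. b n)" using assms(2) by (simp add: sum_nonneg)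
  show thesis
  proof (rule that[of N "1 + (\<Sum>n = N 0..<N 1. b n)"])
    show "mono N" using step by (rule monoI[OF lift_Suc_mono_le])
    show "(\<Sum>n = N j..<N (Suc j). b n) \<le> (1 + (\<Sum>n = N 0..<N 1. b n)) / 4 ^ j" for j
    proof (cases "j = 0")
      case False
      have "1 / 4 ^ j \<le> (1 + (\<Sum>n = N 0..<N 1. b n)) / 4 ^ j" using nonneg by (intro divide_right_mono) auto
      then show ?thesis using le1[OF False] by linarith
    qed simp
  qed (use nonneg in \<open>auto simp: N_def\<close>)
qed

context torus
begin

section \<open>Completeness of the plane waves\<close>

lemma dual_lattice_enum: obtains e :: "nat \<Rightarrow> real ^ 3" where "bij_betw e UNIV \<Gamma>"
proof (rule that)
  show "bij_betw (from_nat_into \<Gamma>) UNIV \<Gamma>"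
    using L_pos by (intro bij_betw_from_nat_into countable_cubic_lattice infinite_cubic_lattice) auto
qed

text \<open>On a space of finite volume the rapidly decaying \<open>L2\<close> norms of the blocks
  give summable \<open>L1\<close> norms. Hence the block series converges absolutely almost
  everywhere; Fatou's lemma bounds the norm of its sum, and integration term by term identifies the
  coefficients.\<close>

lemma riesz_fischer:
  assumes c: "(\<lambda>k. (cmod (c k))\<^sup>2) summable_on \<Gamma>"
  obtains g where "g \<in> L2 L" "\<And>k. k \<in> \<Gamma> \<Longrightarrow> fourier L g k = c k"
    "(L2_norm L g)\<^sup>2 \<le> (\<Sum>\<^sub>\<infinity>k\<in>\<Gamma>. (cmod (c k))\<^sup>2)"
proof -
  obtain e :: "nat \<Rightarrow> real ^ 3" where bij: "bij_betw e UNIV \<Gamma>" by (rule dual_lattice_enum)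
  then have e: "e n \<in> \<Gamma>" for n by (auto simp: bij_betw_def)
  have inj: "inj e" using bij by (simp add: bij_betw_def)
  define b where "b n = (cmod (c (e n)))\<^sup>2" for n
  have "b summable_on UNIV"
    using summable_on_reindex_bij_betw[OF bij, of "\<lambda>k. (cmod (c k))\<^sup>2"] c by (simp add: b_def[abs_def])
  then have "summable b" by (rule summable_on_imp_summable)
  then obtain N D where N: "N 0 = 0" "mono N" "\<And>j :: nat. j \<le> N j"
      "\<And>j. (\<Sum>n = N j..<N (Suc j). b n) \<le> D / 4 ^ j" "0 \<le> D"
    by (rule fast_blocks) (auto simp: b_def)
  define u where "u j = trig (e ` {N j..<N (Suc j)}) c" for j
  define T where "T j = trig (e ` {..<N j}) c" for j
  have u_L2: "u j \<in> L2 L" and T_L2: "T j \<in> L2 L" for j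
    unfolding u_def T_def using e by (auto intro!: L2_trig)
  note [measurable] = L2D(2)[OF u_L2] L2D(2)[OF T_L2]
  have T_sum: "T J x = (\<Sum>j<J. u j x)" for J x
  proof (induction J)
    case 0
    then show ?case by (simp add: T_def N(1) trig_def)
  next
    case (Suc J)
    have "N J \<le> N (Suc J)" using N(2) by (simp add: mono_def)
    then have "{..<N (Suc J)} = {..<N J} \<union> {N J..<N (Suc J)}" by auto
    then have "e ` {..<N (Suc J)} = e ` {..<N J} \<union> e ` {N J..<N (Suc J)}" by auto
    moreover have "e ` {..<N J} \<inter> e ` {N J..<N (Suc J)} = {}"
      by (subst image_Int[OF inj, symmetric]) auto
    ultimately have "T (Suc J) x = T J x + u J x"
      unfolding T_def u_def trig_def by (simp add: sum.union_disjoint)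
    with Suc show ?case by simp
  qed
  have u_norm: "(\<integral>x. (cmod (u j x))\<^sup>2 \<partial>M) \<le> D / 4 ^ j" for j
    using N(4)[of j] e inj by (simp add: u_def norm_sq_trig image_subset_iff sum.reindex b_def inj_on_def)
  have u_L1: "(\<integral>x. cmod (u j x) \<partial>M) \<le> (L ^ 3 + D) / 2 ^ j" for j
  proof -
    have "(\<integral>x. cmod (u j x) \<partial>M) \<le> (\<integral>x. 1 / 2 ^ j + 2 ^ j * (cmod (u j x))\<^sup>2 \<partial>M)"
    proof (rule integral_mono)
      show "integrable M (\<lambda>x. cmod (u j x))" using L2_integrable[OF u_L2] by simp
      show "integrable M (\<lambda>x. 1 / 2 ^ j + 2 ^ j * (cmod (u j x))\<^sup>2)" using L2D(3)[OF u_L2] by simp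
      fix x
      \<comment> \<open>The scale \<open>2 ^ j\<close> balances both terms: the constant one gains
        \<open>1 / 2 ^ j\<close>, the quadratic one loses \<open>2 ^ j\<close> against a bound with
        \<open>1 / 4 ^ j\<close>.\<close>
      define s where "s = 2 ^ j * cmod (u j x)"
      have "0 \<le> (s - 1)\<^sup>2" "0 \<le> s" by (simp_all add: s_def)
      then have "s \<le> 1 + s\<^sup>2" by (simp add: power2_eq_square algebra_simps)
      then have "s / 2 ^ j \<le> (1 + s\<^sup>2) / 2 ^ j" by (rule divide_right_mono) simp
      then show "cmod (u j x) \<le> 1 / 2 ^ j + 2 ^ j * (cmod (u j x))\<^sup>2"
        by (simp add: s_def add_divide_distrib power2_eq_square mult_ac)
    qed
    also have "\<dots> = L ^ 3 / 2 ^ j + 2 ^ j * (\<integral>x. (cmod (u j x))\<^sup>2 \<partial>M)"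
      using L2D(3)[OF u_L2] measure_M_space by simp
    also have "\<dots> \<le> L ^ 3 / 2 ^ j + 2 ^ j * (D / 4 ^ j)"
      using u_norm by (intro add_left_mono mult_left_mono) auto
    also have "2 ^ j * (D / 4 ^ j) = D / 2 ^ j"
    proof -
      have "(4 :: real) ^ j = 2 ^ j * 2 ^ j" by (simp add: power_mult_distrib[symmetric])
      then show ?thesis by simp
    qed
    finally show ?thesis by (simp add: add_divide_distrib)
  qed
  have sum_L1: "summable (\<lambda>j. \<integral>x. cmod (u j x) \<partial>M)"
  proof (rule summable_comparison_test'[where g = "\<lambda>j. (L ^ 3 + D) * (1 / 2) ^ j" and N = 0])
    show "summable (\<lambda>j. (L ^ 3 + D) * (1 / 2 :: real) ^ j)" by (intro summable_mult summable_geometric) auto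
    show "norm (\<integral>x. cmod (u j x) \<partial>M) \<le> (L ^ 3 + D) * (1 / 2) ^ j" for j
      using u_L1[of j] by (simp add: power_divide)
  qed
  have AE_sum: "AE x in M. summable (\<lambda>j. cmod (u j x))"
  proof -
    have "(\<integral>\<^sup>+x. (\<Sum>j. ennreal (cmod (u j x))) \<partial>M) = (\<Sum>j. \<integral>\<^sup>+x. ennreal (cmod (u j x)) \<partial>M)"
      by (rule nn_integral_suminf) measurable
    also have "\<dots> = (\<Sum>j. ennreal (\<integral>x. cmod (u j x) \<partial>M))"
      using L2_integrable[OF u_L2] by (intro suminf_cong nn_integral_eq_integral) auto
    also have "\<dots> \<noteq> \<infinity>" using sum_L1 by (simp add: suminf_ennreal_eq summable_sums_iff[symmetric] ennreal_suminf_neq_top)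
    finally have "AE x in M. (\<Sum>j. ennreal (cmod (u j x))) \<noteq> \<infinity>"
      by (intro nn_integral_PInf_AE) measurable
    then show ?thesis by eventually_elim (auto intro!: summable_suminf_not_top)
  qed
  \<comment> \<open>\<open>suminf\<close> has a value at every point, also where the series
    diverges, so \<open>g\<close> is a periodic Borel function without any modification on a null
    set.\<close>
  define g where "g x = (\<Sum>j. u j x)" for x
  have g_meas [measurable]: "g \<in> borel_measurable borel" unfolding g_def by measurable
  have g_per: "periodic L g" using L2D(1)[OF u_L2] unfolding g_def periodic_def by simp
  have g_lim: "AE x in M. (\<lambda>J. T J x) \<longlonglongrightarrow> g x"
    using AE_sum unfolding T_sum g_def
    by eventually_elim (rule summable_LIMSEQ[OF summable_norm_cancel])
  have sum_c: "(\<Sum>k\<in>F. (cmod (c k))\<^sup>2) \<le> (\<Sum>\<^sub>\<infinity>k\<in>\<Gamma>. (cmod (c k))\<^sup>2)" if "finite F" "F \<subseteq> \<Gamma>" for F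
    using that c by (intro finite_sum_le_infsum) auto
  \<comment> \<open>Fatou's lemma: the partial sums converge to \<open>g\<close> almost everywhere,
    and their squared norms are partial sums of the right-hand side.\<close>
  have "(\<integral>\<^sup>+x. ennreal ((cmod (g x))\<^sup>2) \<partial>M) \<le> (\<integral>\<^sup>+x. liminf (\<lambda>J. ennreal ((cmod (T J x))\<^sup>2)) \<partial>M)"
  proof (rule nn_integral_mono_AE)
    show "AE x in M. ennreal ((cmod (g x))\<^sup>2) \<le> liminf (\<lambda>J. ennreal ((cmod (T J x))\<^sup>2))"
      using g_lim
    proof eventually_elim
      case (elim x)
      then have "(\<lambda>J. ennreal ((cmod (T J x))\<^sup>2)) \<longlonglongrightarrow> ennreal ((cmod (g x))\<^sup>2)"
        by (intro tendsto_ennrealI tendsto_intros)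
      from lim_imp_Liminf[OF _ this] show ?case by simp
    qed
  qed
  also have "\<dots> \<le> liminf (\<lambda>J. \<integral>\<^sup>+x. ennreal ((cmod (T J x))\<^sup>2) \<partial>M)"
    by (rule nn_integral_liminf) measurable
  also have "\<dots> \<le> ennreal (\<Sum>\<^sub>\<infinity>k\<in>\<Gamma>. (cmod (c k))\<^sup>2)"
  proof (rule order_trans[OF Liminf_le_Limsup[OF trivial_limit_sequentially]], rule Limsup_bounded,
      rule always_eventually, rule allI)
    fix J
    have "(\<integral>\<^sup>+x. ennreal ((cmod (T J x))\<^sup>2) \<partial>M) = ennreal (\<integral>x. (cmod (T J x))\<^sup>2 \<partial>M)"
      using L2D(3)[OF T_L2] by (intro nn_integral_eq_integral) auto
    also have "(\<integral>x. (cmod (T J x))\<^sup>2 \<partial>M) = (\<Sum>k\<in>e ` {..<N J}. (cmod (c k))\<^sup>2)"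
      unfolding T_def using e by (intro norm_sq_trig) auto
    also have "\<dots> \<le> (\<Sum>\<^sub>\<infinity>k\<in>\<Gamma>. (cmod (c k))\<^sup>2)" using e by (intro sum_c) auto
    finally show "(\<integral>\<^sup>+x. ennreal ((cmod (T J x))\<^sup>2) \<partial>M) \<le> ennreal (\<Sum>\<^sub>\<infinity>k\<in>\<Gamma>. (cmod (c k))\<^sup>2)"
      by (simp add: ennreal_leI)
  qed
  finally have nn: "(\<integral>\<^sup>+x. ennreal ((cmod (g x))\<^sup>2) \<partial>M) \<le> ennreal (\<Sum>\<^sub>\<infinity>k\<in>\<Gamma>. (cmod (c k))\<^sup>2)" .
  then have "integrable M (\<lambda>x. (cmod (g x))\<^sup>2)"
    using le_less_trans[OF nn ennreal_less_top] by (intro integrableI_bounded) simp_all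
  then have g_L2: "g \<in> L2 L" using g_per g_meas by (intro L2I) auto
  have "(L2_norm L g)\<^sup>2 \<le> (\<Sum>\<^sub>\<infinity>k\<in>\<Gamma>. (cmod (c k))\<^sup>2)"
  proof -
    have "ennreal (\<integral>x. (cmod (g x))\<^sup>2 \<partial>M) \<le> ennreal (\<Sum>\<^sub>\<infinity>k\<in>\<Gamma>. (cmod (c k))\<^sup>2)"
      using nn nn_integral_eq_integral[OF L2D(3)[OF g_L2]] by simp
    then show ?thesis by (simp add: L2_norm_sq infsum_nonneg)
  qed
  moreover have "fourier L g k = c k" if k: "k \<in> \<Gamma>" for k
  proof -
    have "(\<lambda>j. \<integral>x. u j x * cis (- (k \<bullet> x)) \<partial>M) sums (\<integral>x. (\<Sum>j. u j x * cis (- (k \<bullet> x))) \<partial>M)"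
    proof (rule sums_integral)
      show "integrable M (\<lambda>x. u j x * cis (- (k \<bullet> x)))" for j
        by (rule integrable_mult_cis_minus[OF L2_integrable[OF u_L2]])
      show "AE x in M. summable (\<lambda>j. norm (u j x * cis (- (k \<bullet> x))))" using AE_sum by (simp add: norm_mult)
      show "summable (\<lambda>j. \<integral>x. norm (u j x * cis (- (k \<bullet> x))) \<partial>M)" using sum_L1 by (simp add: norm_mult)
    qed
    also have "(\<integral>x. (\<Sum>j. u j x * cis (- (k \<bullet> x))) \<partial>M) = (\<integral>x. g x * cis (- (k \<bullet> x)) \<partial>M)"
    proof (rule integral_cong_AE)
      show "AE x in M. (\<Sum>j. u j x * cis (- (k \<bullet> x))) = g x * cis (- (k \<bullet> x))"
        using AE_sum unfolding g_def by eventually_elim (rule suminf_mult2[symmetric, OF summable_norm_cancel])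
    qed measurable
    finally have "(\<lambda>j. wave_const * (\<integral>x. u j x * cis (- (k \<bullet> x)) \<partial>M)) sums (wave_const * (\<integral>x. g x * cis (- (k \<bullet> x)) \<partial>M))"
      by (rule sums_mult)
    then have "(\<lambda>J. \<Sum>j<J. fourier L (u j) k) \<longlonglongrightarrow> fourier L g k"
      unfolding sums_def fourier_def wave_const_def .
    moreover have "(\<Sum>j<J. fourier L (u j) k) = fourier L (T J) k" for J
    proof (induction J)
      case 0
      then show ?case by (simp add: T_def N(1) trig_def)
    next
      case (Suc J)
      have "T (Suc J) = (\<lambda>x. T J x + u J x)" by (simp add: fun_eq_iff T_sum)
      then show ?case using Suc fourier_add[OF L2_integrable[OF T_L2] L2_integrable[OF u_L2], of J J k] by simp
    qed
    moreover have "\<forall>\<^sub>F J in sequentially. fourier L (T J) k = c k"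
    proof -
      \<comment> \<open>Since \<open>J \<le> N J\<close>, the frequency with number \<open>n\<close>
        occurs in \<open>T J\<close> as soon as \<open>n < J\<close>; from then on its coefficient
        is constant.\<close>
      obtain n where n: "e n = k" using bij k by (metis bij_betw_imp_surj_on rangeE)
      have "fourier L (T J) k = c k" if "J \<ge> Suc n" for J
      proof -
        have "n < N J" using N(3)[of J] that by linarith
        then have "k \<in> e ` {..<N J}" using n by auto
        then show ?thesis unfolding T_def using e k by (subst fourier_trig) auto
      qed
      then show ?thesis unfolding eventually_sequentially by blast
    qed
    ultimately have "(\<lambda>J. fourier L (T J) k) \<longlonglongrightarrow> fourier L g k" "(\<lambda>J. fourier L (T J) k) \<longlonglongrightarrow> c k"
      by (simp_all add: tendsto_eventually)
    then show ?thesis by (rule LIMSEQ_unique)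
  qed
  ultimately show thesis using that g_L2 by blast
qed

text \<open>Completeness follows from uniqueness: the function that Riesz-Fischer builds from the
  coefficients of \<open>f\<close> is \<open>f\<close> almost everywhere, so its norm bound is the
  converse of Bessel's inequality.\<close>

theorem parseval:
  assumes f: "f \<in> L2 L"
  shows "((\<lambda>k. (cmod (fourier L f k))\<^sup>2) has_sum (L2_norm L f)\<^sup>2) \<Gamma>"
proof -
  note s = fourier_sq_summable[OF f]
  obtain g where g: "g \<in> L2 L" "\<And>k. k \<in> \<Gamma> \<Longrightarrow> fourier L g k = fourier L f k"
    "(L2_norm L g)\<^sup>2 \<le> (\<Sum>\<^sub>\<infinity>k\<in>\<Gamma>. (cmod (fourier L f k))\<^sup>2)"
    by (rule riesz_fischer[OF s]) blast
  have "AE x in M. f x = g x" by (rule fourier_unique) (use f g in \<open>auto intro: L2_integrable\<close>)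
  then have "(L2_norm L f)\<^sup>2 = (L2_norm L g)\<^sup>2"
    unfolding L2_norm_sq using L2D(2)[OF f] L2D(2)[OF g(1)] by (intro integral_cong_AE) auto
  moreover have "(\<Sum>\<^sub>\<infinity>k\<in>\<Gamma>. (cmod (fourier L f k))\<^sup>2) \<le> (L2_norm L f)\<^sup>2"
    by (rule infsum_le_finite_sums[OF s bessel[OF f]])
  ultimately show ?thesis using g(3) s by (simp add: has_sum_iff)
qed

text \<open>Polarization: the norm identity is applied to \<open>f + c g\<close> for the four fourth
  roots of unity \<open>c\<close>.\<close>

theorem parseval_inner:
  assumes f: "f \<in> L2 L" and g: "g \<in> L2 L"
  shows "((\<lambda>k. fourier L f k * cnj (fourier L g k)) has_sum (\<integral>x. f x * cnj (g x) \<partial>M)) \<Gamma>"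
proof -
  have pol: "4 * (a * cnj b) = of_real ((cmod (a + b))\<^sup>2) - of_real ((cmod (a - b))\<^sup>2)
      + \<i> * of_real ((cmod (a + \<i> * b))\<^sup>2) - \<i> * of_real ((cmod (a - \<i> * b))\<^sup>2)" for a b :: complex
    unfolding cmod_power2 by (simp add: complex_eq_iff power2_eq_square algebra_simps)
  let ?h = "\<lambda>c x. f x + c * g x"
  have h: "?h c \<in> L2 L" for c by (intro L2_add L2_cmult f g)
  have four: "fourier L (?h c) k = fourier L f k + c * fourier L g k" for c k
    using fourier_add[OF L2_integrable[OF f] L2_integrable[OF L2_cmult[OF g]]] by (simp add: fourier_cmult)
  have hs: "((\<lambda>k. complex_of_real ((cmod (fourier L f k + c * fourier L g k))\<^sup>2)) has_sum
      of_real (\<integral>x. (cmod (?h c x))\<^sup>2 \<partial>M)) \<Gamma>" for c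
    using parseval[OF h[of c]] unfolding four L2_norm_sq by (rule has_sum_of_real)
  let ?I = "\<lambda>c. complex_of_real (\<integral>x. (cmod (?h c x))\<^sup>2 \<partial>M)"
  have "((\<lambda>k. 4 * (fourier L f k * cnj (fourier L g k))) has_sum
      (?I 1 + - ?I (- 1) + \<i> * ?I \<i> + - (\<i> * ?I (- \<i>)))) \<Gamma>"
    unfolding pol
    using has_sum_add[OF has_sum_add[OF has_sum_add[OF hs[of 1] has_sum_uminusI[OF hs[of "- 1"]]]
          has_sum_cmult_right[OF hs[of \<i>], of \<i>]] has_sum_uminusI[OF has_sum_cmult_right[OF hs[of "- \<i>"], of \<i>]]]
    by simp
  moreover have "?I 1 + - ?I (- 1) + \<i> * ?I \<i> + - (\<i> * ?I (- \<i>)) = 4 * (\<integral>x. f x * cnj (g x) \<partial>M)"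
  proof -
    have int: "integrable M (\<lambda>x. complex_of_real ((cmod (?h c x))\<^sup>2))" for c
      using L2D(3)[OF h[of c]] by (simp del: of_real_power)
    have "4 * (\<integral>x. f x * cnj (g x) \<partial>M) = (\<integral>x. 4 * (f x * cnj (g x)) \<partial>M)" by simp
    also have "\<dots> = (\<integral>x. of_real ((cmod (?h 1 x))\<^sup>2) - of_real ((cmod (?h (- 1) x))\<^sup>2)
      + \<i> * of_real ((cmod (?h \<i> x))\<^sup>2) - \<i> * of_real ((cmod (?h (- \<i>) x))\<^sup>2) \<partial>M)"
      unfolding pol by simp
    also have "\<dots> = ?I 1 + - ?I (- 1) + \<i> * ?I \<i> + - (\<i> * ?I (- \<i>))"
      unfolding integral_complex_of_real[symmetric] using int[of 1] int[of "- 1"] int[of \<i>] int[of "- \<i>"]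
      by (simp del: of_real_power)
    finally show ?thesis by simp
  qed
  ultimately have "((\<lambda>k. 4 * (fourier L f k * cnj (fourier L g k))) has_sum 4 * (\<integral>x. f x * cnj (g x) \<partial>M)) \<Gamma>"
    by simp
  then show ?thesis by (subst (asm) has_sum_cmult_right_iff) auto
qed

section \<open>Fourier multipliers on real-valued functions\<close>

lemma fourier_real: "fourier L (cplx f) (- k) = cnj (fourier L (cplx f) k)"
  using fourier_cnj[of "cplx f" "- k"] by simp

lemma fourier_Re:
  assumes "integrable M g"
  shows "fourier L (\<lambda>x. of_real (Re (g x))) k = (fourier L g k + cnj (fourier L g (- k))) / 2"
proof -
  have "(\<lambda>x. complex_of_real (Re (g x))) = (\<lambda>x. (1 / 2) * (g x + cnj (g x)))"
    by (simp add: complex_add_cnj)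
  then show ?thesis
    using fourier_add[OF assms, of "\<lambda>x. cnj (g x)" k] assms by (simp only: fourier_cmult) (simp add: fourier_cnj)
qed

text \<open>Justifies the choice in \<open>fourier_mult\<close>. Riesz-Fischer gives a
  complex-valued function with the desired coefficients; as \<open>m\<close> is real and even and
  \<open>f\<close> is real, these are Hermitian symmetric, so the real part has the same
  coefficients.\<close>

lemma fourier_mult_spec:
  assumes "(\<lambda>k. (m k)\<^sup>2 * (cmod (fourier L (cplx f) k))\<^sup>2) summable_on \<Gamma>"
    and even: "\<And>k. m (- k) = m k"
  shows "fourier_mult L m f \<in> L2 L"
    "\<And>k. k \<in> \<Gamma> \<Longrightarrow> fourier L (cplx (fourier_mult L m f)) k = of_real (m k) * fourier L (cplx f) k"
proof -
  obtain g where g: "g \<in> L2 L" "\<And>k. k \<in> \<Gamma> \<Longrightarrow> fourier L g k = of_real (m k) * fourier L (cplx f) k"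
    by (rule riesz_fischer[of "\<lambda>k. of_real (m k) * fourier L (cplx f) k"])
      (use assms(1) in \<open>auto simp: norm_mult power_mult_distrib\<close>)
  define h where "h x = Re (g x)" for x
  have "h \<in> L2 L"
  proof (rule L2I)
    note [measurable] = L2D(2)[OF g(1)]
    show "periodic L h" using L2D(1)[OF g(1)] by (simp add: h_def periodic_def)
    show "h \<in> borel_measurable borel" unfolding h_def by measurable
    show "integrable M (\<lambda>x. (norm (h x))\<^sup>2)"
      by (rule Bochner_Integration.integrable_bound[OF L2D(3)[OF g(1)]])
        (auto simp: h_def abs_Re_le_cmod intro!: AE_I2 abs_le_square_iff[THEN iffD1])
  qed
  moreover have "fourier L (cplx h) k = of_real (m k) * fourier L (cplx f) k" if "k \<in> \<Gamma>" for k
    unfolding h_def using that by (simp add: fourier_Re[OF L2_integrable[OF g(1)]] g(2) even fourier_real)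
  ultimately have "\<exists>h. h \<in> L2 L \<and> (\<forall>k\<in>\<Gamma>. fourier L (cplx h) k = of_real (m k) * fourier L (cplx f) k)" by blast
  from someI_ex[OF this, folded fourier_mult_def]
  show "fourier_mult L m f \<in> L2 L"
    "\<And>k. k \<in> \<Gamma> \<Longrightarrow> fourier L (cplx (fourier_mult L m f)) k = of_real (m k) * fourier L (cplx f) k"
    by auto
qed

lemma L2_real_unique:
  assumes "f \<in> L2 L" "g \<in> L2 L" "\<And>k. k \<in> \<Gamma> \<Longrightarrow> fourier L (cplx f) k = fourier L (cplx g) k"
  shows "AE x in M. f x = g x"
proof -
  have "AE x in M. cplx f x = cplx g x"
    by (rule fourier_unique) (use assms in \<open>auto intro: L2_integrable\<close>)
  then show ?thesis by simp
qed

end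

section \<open>Lattice sums and products in Fourier space\<close>

lemma triple_lattice_inj:
  fixes a :: real
  assumes "a \<noteq> 0"
  shows "inj (\<lambda>(l :: int, m :: int, n :: int). \<chi> i :: 3. a * of_int (if i = 1 then l else if i = 2 then m else n))"
  using assms by (auto simp: inj_on_def vec_eq_iff forall_3)

text \<open>Balls for the maximum norm instead of the Euclidean one: they contain exactly
  \<open>(2 * N + 1) ^ 3\<close> points, which makes the shells between consecutive boxes easy to
  count.\<close>

definition lattice_box :: "real \<Rightarrow> nat \<Rightarrow> (real ^ 3) set" where
  "lattice_box a N = {k \<in> cubic_lattice a. \<forall>i. \<bar>k $ i\<bar> \<le> a * real N}"

lemma lattice_box_eq_image:
  assumes "0 < a"
  shows "lattice_box a N =
    (\<lambda>(l :: int, m :: int, n :: int). \<chi> i :: 3. a * of_int (if i = 1 then l else if i = 2 then m else n))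
      ` ({- int N..int N} \<times> {- int N..int N} \<times> {- int N..int N})" (is "_ = ?f ` ?B")
proof -
  have le: "\<bar>a * of_int l\<bar> \<le> a * real N \<longleftrightarrow> l \<in> {- int N..int N}" for l :: int
  proof -
    have "\<bar>a * of_int l\<bar> \<le> a * real N \<longleftrightarrow> \<bar>real_of_int l\<bar> \<le> real N"
      using assms by (simp add: abs_mult)
    also have "\<dots> \<longleftrightarrow> \<bar>l\<bar> \<le> int N" by linarith
    finally show ?thesis by auto
  qed
  have "?f (l, m, n) \<in> cubic_lattice a" for l m n
    unfolding cubic_lattice_eq_range by (rule rangeI)
  then have "?f (l, m, n) \<in> lattice_box a N \<longleftrightarrow> (l, m, n) \<in> ?B" for l m n
    using le[of l] le[of m] le[of n] by (auto simp: lattice_box_def forall_3)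
  moreover have "\<exists>l m n. k = ?f (l, m, n)" if "k \<in> lattice_box a N" for k
  proof -
    obtain t where "k = ?f t" using \<open>k \<in> lattice_box a N\<close> unfolding lattice_box_def cubic_lattice_eq_range by blast
    moreover obtain l m n where "t = (l, m, n)" by (cases t)
    ultimately show ?thesis by blast
  qed
  ultimately show ?thesis by blast
qed

lemma finite_lattice_box: "0 < a \<Longrightarrow> finite (lattice_box a N)"
  by (simp add: lattice_box_eq_image)

lemma card_lattice_box:
  assumes "0 < a" shows "card (lattice_box a N) = (2 * N + 1) ^ 3"
proof -
  have c: "card {- int N..int N} = 2 * N + 1" by simp
  have "inj_on (\<lambda>(l :: int, m :: int, n :: int). \<chi> i :: 3. a * of_int (if i = 1 then l else if i = 2 then m else n)) B" for B
    using triple_lattice_inj[of a] assms by (auto intro: inj_on_subset)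
  then show ?thesis
    unfolding lattice_box_eq_image[OF assms] by (subst card_image) (simp_all only: card_cartesian_product c power3_eq_cube mult.assoc)
qed

lemma lattice_box_mono: "0 < a \<Longrightarrow> M \<le> N \<Longrightarrow> lattice_box a M \<subseteq> lattice_box a N"
  unfolding lattice_box_def by (auto intro: order_trans mult_left_mono)

lemma lattice_box_0: "0 < a \<Longrightarrow> lattice_box a 0 = {0}"
  by (auto simp: lattice_box_eq_image vec_eq_iff)

text \<open>Outside the box some coordinate exceeds \<open>a * m\<close> in modulus; being an
  integer multiple of \<open>a\<close>, it is at least the next one.\<close>

lemma lattice_shell_norm:
  assumes a: "0 < a" and k: "k \<in> cubic_lattice a" "k \<notin> lattice_box a m"
  shows "a * real (Suc m) \<le> norm k"
proof -
  obtain i where i: "\<bar>k $ i\<bar> > a * real m" using k unfolding lattice_box_def by (auto simp: not_le)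
  obtain n :: int where n: "k $ i = a * of_int n" using k(1) unfolding cubic_lattice_def by blast
  have "real m < \<bar>of_int n\<bar>" using i a by (simp add: n abs_mult)
  then have "int m < \<bar>n\<bar>" by (metis of_int_abs of_int_less_iff of_int_of_nat_eq)
  then have "int (Suc m) \<le> \<bar>n\<bar>" by simp
  then have "real (Suc m) \<le> \<bar>of_int n\<bar>" by (metis of_int_abs of_int_le_iff of_int_of_nat_eq)
  then have "a * real (Suc m) \<le> \<bar>k $ i\<bar>" using a by (simp add: n abs_mult)
  also have "\<dots> \<le> norm k" by (rule component_le_norm_cart)
  finally show ?thesis .
qed

text \<open>Summation by shells, with \<open>W m\<close> dominating \<open>h\<close> on shell
  \<open>m\<close>. That shell has \<open>24 * m\<^sup>2 + 2\<close> points, at most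
  \<open>26 * m\<^sup>2\<close>; this is where the constant 26 comes from.\<close>

lemma lattice_box_sum_le:
  assumes a: "0 < a" and W: "\<And>m. 0 \<le> W m"
    and h: "\<And>m k. k \<in> cubic_lattice a \<Longrightarrow> a * real (Suc m) \<le> norm k \<Longrightarrow> h k \<le> W (Suc m)"
  shows "(\<Sum>k\<in>lattice_box a N - {0}. h k) \<le> (\<Sum>m=1..N. 26 * (real m)\<^sup>2 * W m)"
proof (induction N)
  case 0
  then show ?case by (simp add: lattice_box_0[OF a])
next
  case (Suc N)
  let ?S = "lattice_box a (Suc N) - lattice_box a N"
  have sub: "lattice_box a N \<subseteq> lattice_box a (Suc N)" by (rule lattice_box_mono[OF a]) simp
  have z: "0 \<in> lattice_box a N" using a by (simp add: lattice_box_def)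
  have "lattice_box a (Suc N) - {0} = (lattice_box a N - {0}) \<union> ?S" using sub z by auto
  then have "(\<Sum>k\<in>lattice_box a (Suc N) - {0}. h k) = (\<Sum>k\<in>lattice_box a N - {0}. h k) + (\<Sum>k\<in>?S. h k)"
    using finite_lattice_box[OF a] by (simp add: sum.union_disjoint Int_Diff)
      (subst sum.union_disjoint[symmetric], auto)
  also have "(\<Sum>k\<in>?S. h k) \<le> real (card ?S) * W (Suc N)"
    by (rule sum_bounded_above) (use lattice_shell_norm[OF a] h in \<open>auto simp: lattice_box_def\<close>)
  also have "real (card ?S) = 24 * (real (Suc N))\<^sup>2 + 2"
  proof -
    have "card ?S = (2 * Suc N + 1) ^ 3 - (2 * N + 1) ^ 3"
      using sub finite_lattice_box[OF a] by (simp add: card_Diff_subset card_lattice_box[OF a])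
    moreover have "(2 * N + 1) ^ 3 \<le> (2 * Suc N + 1) ^ 3" by (rule power_mono) auto
    ultimately have "real (card ?S) = real ((2 * Suc N + 1) ^ 3) - real ((2 * N + 1) ^ 3)" by (simp only: of_nat_diff)
    then show ?thesis by (simp add: power3_eq_cube power2_eq_square algebra_simps)
  qed
  also have "(24 * (real (Suc N))\<^sup>2 + 2) * W (Suc N) \<le> (26 * (real (Suc N))\<^sup>2) * W (Suc N)"
  proof (rule mult_right_mono[OF _ W])
    have "1 \<le> (real (Suc N))\<^sup>2" by (rule one_le_power) simp
    then show "24 * (real (Suc N))\<^sup>2 + 2 \<le> 26 * (real (Suc N))\<^sup>2" by linarith
  qed
  finally show ?case using Suc by (simp add: mult.assoc)
qed

lemma sum_inverse_squares_le: "(\<Sum>m=1..N. 1 / (real m)\<^sup>2) \<le> 2"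
proof -
  \<comment> \<open>The remainder \<open>1 / (N + 1)\<close> strengthens the claim so that the
    induction closes by telescoping.\<close>
  have "(\<Sum>m=1..Suc N. 1 / (real m)\<^sup>2) \<le> 2 - 1 / real (Suc N)" for N
  proof (induction N)
    case (Suc N)
    have "1 / (real (Suc (Suc N)))\<^sup>2 \<le> 1 / (real (Suc N) * real (Suc (Suc N)))"
      unfolding power2_eq_square by (intro divide_left_mono mult_right_mono) auto
    also have "\<dots> = 1 / real (Suc N) - 1 / real (Suc (Suc N))" by (simp add: field_simps)
    finally show ?case using Suc by simp
  qed simp
  from this[of "N - 1"] show ?thesis by (cases N) (auto intro: order_trans)
qed

section \<open>Lattice sums of negative powers of the norm\<close>

context
  fixes a :: real
  assumes a_pos: "0 < a"
begin

lemma ball_subset_box: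
  assumes F: "F \<subseteq> cubic_lattice a - {0}" "\<And>k. k \<in> F \<Longrightarrow> norm k \<le> R" and R: "0 \<le> R"
  shows "F \<subseteq> lattice_box a (nat \<lfloor>R / a\<rfloor>) - {0}"
proof
  fix k assume k: "k \<in> F"
  have "k \<in> lattice_box a (nat \<lfloor>R / a\<rfloor>)"
  proof (rule ccontr)
    assume "k \<notin> lattice_box a (nat \<lfloor>R / a\<rfloor>)"
    then have "a * real (Suc (nat \<lfloor>R / a\<rfloor>)) \<le> norm k"
      using lattice_shell_norm[OF a_pos] F(1) k by blast
    then have "a * real (Suc (nat \<lfloor>R / a\<rfloor>)) \<le> R" using F(2)[OF k] by linarith
    then have "real (Suc (nat \<lfloor>R / a\<rfloor>)) \<le> R / a" using a_pos by (simp add: pos_le_divide_eq mult.commute)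
    then show False by linarith
  qed
  then show "k \<in> lattice_box a (nat \<lfloor>R / a\<rfloor>) - {0}" using F(1) k by blast
qed

lemma box_radius: "0 \<le> R \<Longrightarrow> real (nat \<lfloor>R / a\<rfloor>) \<le> R / a"
  using a_pos divide_nonneg_pos[of R a] by linarith

lemma sum_ball_le:
  assumes F: "F \<subseteq> cubic_lattice a - {0}" "\<And>k. k \<in> F \<Longrightarrow> norm k \<le> R" and R: "0 \<le> R"
    and W: "\<And>m. 0 \<le> W m" and h0: "\<And>k. 0 \<le> h k"
    and h: "\<And>m k. k \<in> cubic_lattice a \<Longrightarrow> a * real (Suc m) \<le> norm k \<Longrightarrow> h k \<le> W (Suc m)"
  shows "(\<Sum>k\<in>F. h k) \<le> (\<Sum>m=1..nat \<lfloor>R / a\<rfloor>. 26 * (real m)\<^sup>2 * W m)"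
proof -
  have "(\<Sum>k\<in>F. h k) \<le> (\<Sum>k\<in>lattice_box a (nat \<lfloor>R / a\<rfloor>) - {0}. h k)"
    by (rule sum_mono2[OF _ ball_subset_box[OF F R]]) (use h0 finite_lattice_box[OF a_pos] in auto)
  also have "\<dots> \<le> (\<Sum>m=1..nat \<lfloor>R / a\<rfloor>. 26 * (real m)\<^sup>2 * W m)"
    by (rule lattice_box_sum_le[OF a_pos]) (use W h in auto)
  finally show ?thesis .
qed

text \<open>Lattice version of the integral of \<open>1 / norm k\<close> over a ball of radius
  \<open>R\<close>, of order \<open>R\<^sup>2\<close>; the factor \<open>1 / a ^ 3\<close> is the
  density of the lattice.\<close>

lemma inverse_norm_sum_le:
  assumes F: "F \<subseteq> cubic_lattice a - {0}" "\<And>k. k \<in> F \<Longrightarrow> norm k \<le> R" and R: "0 \<le> R"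
  shows "(\<Sum>k\<in>F. 1 / norm k) \<le> 26 * R\<^sup>2 / a ^ 3"
proof -
  let ?N = "nat \<lfloor>R / a\<rfloor>"
  have "(\<Sum>k\<in>F. 1 / norm k) \<le> (\<Sum>m=1..?N. 26 * (real m)\<^sup>2 * (1 / (a * real m)))"
  proof (rule sum_ball_le[OF F R])
    show "1 / norm k \<le> 1 / (a * real (Suc m))" if "a * real (Suc m) \<le> norm k" for k :: "real ^ 3" and m
      using that a_pos by (intro frac_le mult_pos_pos) auto
  qed (use a_pos in auto)
  also have "\<dots> = (\<Sum>m=1..?N. 26 / a * real m)"
    using a_pos by (intro sum.cong) (auto simp: power2_eq_square)
  also have "\<dots> \<le> (\<Sum>m=1..?N. 26 / a * real ?N)"
    using a_pos by (intro sum_mono mult_left_mono) auto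
  also have "\<dots> = 26 / a * (real ?N)\<^sup>2" by (simp add: power2_eq_square)
  also have "\<dots> \<le> 26 / a * (R / a)\<^sup>2"
    using a_pos box_radius[OF R] by (intro mult_left_mono power_mono) auto
  also have "\<dots> = 26 * R\<^sup>2 / a ^ 3" by (simp add: power_divide power2_eq_square power3_eq_cube)
  finally show ?thesis .
qed

text \<open>As for the first power, but here every shell contributes the same amount
  \<open>26 / a\<^sup>2\<close>, so the growth is only linear in \<open>R\<close>.\<close>

lemma inverse_norm_sq_sum_le:
  assumes F: "F \<subseteq> cubic_lattice a - {0}" "\<And>k. k \<in> F \<Longrightarrow> norm k \<le> R" and R: "0 \<le> R"
  shows "(\<Sum>k\<in>F. 1 / (norm k)\<^sup>2) \<le> 26 * R / a ^ 3"
proof -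
  let ?N = "nat \<lfloor>R / a\<rfloor>"
  have "(\<Sum>k\<in>F. 1 / (norm k)\<^sup>2) \<le> (\<Sum>m=1..?N. 26 * (real m)\<^sup>2 * (1 / (a * real m)\<^sup>2))"
  proof (rule sum_ball_le[OF F R])
    show "1 / (norm k)\<^sup>2 \<le> 1 / (a * real (Suc m))\<^sup>2" if "a * real (Suc m) \<le> norm k" for k :: "real ^ 3" and m
    proof -
      have "0 < a * real (Suc m)" using a_pos by (intro mult_pos_pos) auto
      then show ?thesis using that by (intro frac_le power_mono zero_less_power) simp_all
    qed
  qed (use a_pos in auto)
  also have "\<dots> = (\<Sum>m=1..?N. 26 / a\<^sup>2)"
    using a_pos by (intro sum.cong) (auto simp: power_mult_distrib)
  also have "\<dots> = 26 / a\<^sup>2 * real ?N" by simp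
  also have "\<dots> \<le> 26 / a\<^sup>2 * (R / a)"
    using a_pos box_radius[OF R] by (intro mult_left_mono) auto
  also have "\<dots> = 26 * R / a ^ 3" by (simp add: power2_eq_square power3_eq_cube)
  finally show ?thesis .
qed

text \<open>The exponent exceeds the dimension: shells of quadratic size weighted by fourth powers
  leave a convergent sum of inverse squares.\<close>

lemma lattice_summable_inverse_norm_4: "(\<lambda>k. 1 / (1 + norm k) ^ 4) summable_on cubic_lattice a"
proof (rule nonneg_bounded_partial_sums_imp_summable_on[where C = "1 + 52 / a ^ 4"])
  show "\<forall>\<^sub>F F in finite_subsets_at_top (cubic_lattice a). (\<Sum>k\<in>F. 1 / (1 + norm k) ^ 4) \<le> 1 + 52 / a ^ 4"
  proof (rule eventually_finite_subsets_at_top_weakI)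
    fix F assume F: "finite F" "F \<subseteq> cubic_lattice a"
    \<comment> \<open>A finite set lies in the ball given by its largest norm; 0 is inserted so that
      the maximum exists for empty \<open>F\<close>.\<close>
    define R where "R = Max (insert 0 (norm ` F))"
    have R: "0 \<le> R" "\<And>k. k \<in> F \<Longrightarrow> norm k \<le> R" using F(1) by (auto simp: R_def)
    let ?N = "nat \<lfloor>R / a\<rfloor>"
    have "(\<Sum>k\<in>F. 1 / (1 + norm k) ^ 4) \<le> (\<Sum>k\<in>insert 0 (F - {0}). 1 / (1 + norm k) ^ 4)"
      using F(1) by (intro sum_mono2) auto
    also have "\<dots> = 1 + (\<Sum>k\<in>F - {0}. 1 / (1 + norm k) ^ 4)" using F(1) by (subst sum.insert) auto
    also have "(\<Sum>k\<in>F - {0}. 1 / (1 + norm k) ^ 4) \<le> (\<Sum>m=1..?N. 26 * (real m)\<^sup>2 * (1 / (a * real m) ^ 4))"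
    proof (rule sum_ball_le[OF _ _ R(1)])
      show "1 / (1 + norm k) ^ 4 \<le> 1 / (a * real (Suc m)) ^ 4" if "a * real (Suc m) \<le> norm k" for k :: "real ^ 3" and m
      proof -
        have "0 < a * real (Suc m)" using a_pos by (intro mult_pos_pos) auto
        then show ?thesis using that by (intro frac_le power_mono zero_less_power) simp_all
      qed
    qed (use F R a_pos in auto)
    also have "\<dots> = (\<Sum>m=1..?N. 26 / a ^ 4 * (1 / (real m)\<^sup>2))"
      using a_pos by (intro sum.cong) (auto simp: power_mult_distrib power2_eq_square power4_eq_xxxx)
    also have "\<dots> = 26 / a ^ 4 * (\<Sum>m=1..?N. 1 / (real m)\<^sup>2)" by (simp only: sum_distrib_left)
    also have "\<dots> \<le> 26 / a ^ 4 * 2"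
      using a_pos by (intro mult_left_mono sum_inverse_squares_le) auto
    finally show "(\<Sum>k\<in>F. 1 / (1 + norm k) ^ 4) \<le> 1 + 52 / a ^ 4" by simp
  qed
qed auto

end

section \<open>Convolution of Fourier coefficients\<close>

context torus
begin

abbreviation "dual_spacing \<equiv> 2 * pi / L"

lemma dual_spacing_pos: "0 < dual_spacing" using L_pos by simp

lemmas dual_inverse_norm_sum_le = inverse_norm_sum_le[OF dual_spacing_pos]
lemmas dual_inverse_norm_sq_sum_le = inverse_norm_sq_sum_le[OF dual_spacing_pos]
lemmas summable_inverse_norm_4 = lattice_summable_inverse_norm_4[OF dual_spacing_pos]

lemma dual_norm_ge: "k \<in> \<Gamma> \<Longrightarrow> k \<noteq> 0 \<Longrightarrow> dual_spacing \<le> norm k"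
  using lattice_shell_norm[OF dual_spacing_pos, of k 0] lattice_box_0[OF dual_spacing_pos] by auto

text \<open>This is Parseval's identity for \<open>f\<close> and \<open>g\<close> times the plane
  wave of frequency \<open>k\<close>, which shifts the coefficients of \<open>g\<close> by
  \<open>k\<close>.\<close>

lemma convolution:
  assumes f: "f \<in> L2 L" and g: "g \<in> L2 L" and k: "k \<in> \<Gamma>"
  shows "((\<lambda>p. wave_const * (fourier L f p * cnj (fourier L g (p - k)))) has_sum fourier L (\<lambda>x. f x * cnj (g x)) k) \<Gamma>"
proof -
  have gk: "(\<lambda>x. g x * cis (k \<bullet> x)) \<in> L2 L"
  proof (rule L2I)
    note [measurable] = L2D(2)[OF g]
    show "periodic L (\<lambda>x. g x * cis (k \<bullet> x))" using L2D(1)[OF g] periodic_cis[OF k] by (simp add: periodic_def)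
    show "(\<lambda>x. g x * cis (k \<bullet> x)) \<in> borel_measurable borel" by measurable
    show "integrable M (\<lambda>x. (norm (g x * cis (k \<bullet> x)))\<^sup>2)" using L2D(3)[OF g] by (simp add: norm_mult)
  qed
  have "(\<integral>x. f x * cnj (g x * cis (k \<bullet> x)) \<partial>M) = (\<integral>x. f x * cnj (g x) * cis (- (k \<bullet> x)) \<partial>M)"
    by (intro Bochner_Integration.integral_cong) (simp_all add: cis_cnj)
  then have "((\<lambda>p. fourier L f p * cnj (fourier L g (p - k))) has_sum (\<integral>x. f x * cnj (g x) * cis (- (k \<bullet> x)) \<partial>M)) \<Gamma>"
    using parseval_inner[OF f gk] by (simp only: fourier_mult_cis)
  then show ?thesis unfolding fourier_def[of L "\<lambda>x. f x * cnj (g x)"] wave_const_def[symmetric] by (rule has_sum_cmult_right)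
qed

text \<open>Reduces estimates of convolutions to finitely many frequencies in both sums, where order
  of summation is no issue; the limit over \<open>P\<close> is harmless because \<open>K\<close> is
  finite.\<close>

lemma weighted_sum_le_from_finite:
  assumes hs: "\<And>k. k \<in> K \<Longrightarrow> ((t k) has_sum H k) \<Gamma>" and K: "finite K"
    and le: "\<And>P. finite P \<Longrightarrow> P \<subseteq> \<Gamma> \<Longrightarrow> (\<Sum>k\<in>K. v k * (cmod (\<Sum>p\<in>P. t k p))\<^sup>2) \<le> C"
  shows "(\<Sum>k\<in>K. v k * (cmod (H k))\<^sup>2) \<le> C"
proof (rule tendsto_upperbound)
  show "((\<lambda>P. \<Sum>k\<in>K. v k * (cmod (\<Sum>p\<in>P. t k p))\<^sup>2) \<longlongrightarrow> (\<Sum>k\<in>K. v k * (cmod (H k))\<^sup>2)) (finite_subsets_at_top \<Gamma>)"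
    using hs unfolding has_sum_def by (intro tendsto_intros) auto
  show "\<forall>\<^sub>F P in finite_subsets_at_top \<Gamma>. (\<Sum>k\<in>K. v k * (cmod (\<Sum>p\<in>P. t k p))\<^sup>2) \<le> C"
    using le by (intro eventually_finite_subsets_at_top_weakI) auto
qed simp

lemma cmod_sum_mult_sq_le:
  fixes f g :: "'i \<Rightarrow> complex" and u v :: "'i \<Rightarrow> real"
  assumes "\<And>p. p \<in> P \<Longrightarrow> cmod (f p) \<le> u p * v p"
  shows "(cmod (\<Sum>p\<in>P. f p))\<^sup>2 \<le> (\<Sum>p\<in>P. (u p)\<^sup>2) * (\<Sum>p\<in>P. (v p)\<^sup>2)"
proof -
  have "cmod (\<Sum>p\<in>P. f p) \<le> (\<Sum>p\<in>P. u p * v p)" using assms by (rule sum_norm_le)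
  then have "(cmod (\<Sum>p\<in>P. f p))\<^sup>2 \<le> (\<Sum>p\<in>P. u p * v p)\<^sup>2" by (rule power_mono) simp
  also have "\<dots> \<le> (\<Sum>p\<in>P. (u p)\<^sup>2) * (\<Sum>p\<in>P. (v p)\<^sup>2)" by (rule Cauchy_Schwarz_ineq_sum)
  finally show ?thesis .
qed

lemma cmod_wave_const_sq: "(cmod wave_const)\<^sup>2 = 1 / L ^ 3"
proof -
  have "(cmod wave_const)\<^sup>2 * L ^ 3 = 1"
    using wave_const_sq L_pos unfolding wave_const_def by (metis (no_types, lifting) norm_of_real abs_of_nonneg power2_eq_square
        powr_ge_zero of_real_mult of_real_eq_1_iff)
  then show ?thesis using L_pos by (simp add: field_simps)
qed

lemma shifted_sum_le:
  fixes h :: "real ^ 3 \<Rightarrow> real"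
  assumes h: "(h has_sum S) \<Gamma>" "\<And>k. 0 \<le> h k" and K: "finite K" "K \<subseteq> \<Gamma>" and p: "p \<in> \<Gamma>"
  shows "(\<Sum>k\<in>K. h (p - k)) \<le> S" "(\<Sum>k\<in>K. h (k - p)) \<le> S"
proof -
  have "(\<Sum>k\<in>K. h (p - k)) = (\<Sum>q\<in>(\<lambda>k. p - k) ` K. h q)" by (subst sum.reindex) (auto simp: inj_on_def)
  also have "\<dots> \<le> S"
    by (rule finite_sum_le_has_sum[OF h(1)]) (use h K p in \<open>auto intro: cubic_lattice_diff\<close>)
  finally show "(\<Sum>k\<in>K. h (p - k)) \<le> S" .
  have "(\<Sum>k\<in>K. h (k - p)) = (\<Sum>q\<in>(\<lambda>k. k - p) ` K. h q)" by (subst sum.reindex) (auto simp: inj_on_def)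
  also have "\<dots> \<le> S"
    by (rule finite_sum_le_has_sum[OF h(1)]) (use h K p in \<open>auto intro: cubic_lattice_diff\<close>)
  finally show "(\<Sum>k\<in>K. h (k - p)) \<le> S" .
qed

section \<open>Products of Sobolev functions\<close>

lemma H1D:
  assumes "f \<in> H1 L"
  shows "f \<in> L2 L" "((\<lambda>k. (norm k)\<^sup>2 * (cmod (fourier L f k))\<^sup>2) has_sum kinetic L f) \<Gamma>"
    "((\<lambda>k. (1 + (norm k)\<^sup>2) * (cmod (fourier L f k))\<^sup>2) has_sum (H1_norm L f)\<^sup>2) \<Gamma>"
    "0 \<le> kinetic L f"
proof -
  show L2: "f \<in> L2 L" and k: "((\<lambda>k. (norm k)\<^sup>2 * (cmod (fourier L f k))\<^sup>2) has_sum kinetic L f) \<Gamma>"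
    using assms unfolding H1_def kinetic_def by auto
  from k show "0 \<le> kinetic L f" by (rule has_sum_nonneg) simp
  then have "(H1_norm L f)\<^sup>2 = (L2_norm L f)\<^sup>2 + kinetic L f" by (simp add: H1_norm_def)
  then show "((\<lambda>k. (1 + (norm k)\<^sup>2) * (cmod (fourier L f k))\<^sup>2) has_sum (H1_norm L f)\<^sup>2) \<Gamma>"
    using has_sum_add[OF parseval[OF L2] k] by (simp add: distrib_right)
qed

text \<open>Takes the place of the embedding of \<open>H1\<close> into \<open>L4\<close>.
  Cauchy-Schwarz splits off the weights of \<open>p\<close> and \<open>p - k\<close>; the inequality
  of arithmetic and geometric means separates them into two convergent lattice sums. The factor 4
  comes from \<open>(1 + norm p)\<^sup>2 \<le> 2 * (1 + (norm p)\<^sup>2)\<close>, used for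
  \<open>f\<close> and for \<open>g\<close>.\<close>

lemma H1_product_bound:
  assumes f: "f \<in> H1 L" and g: "g \<in> H1 L" and K: "finite K" "K \<subseteq> \<Gamma>"
  shows "(\<Sum>k\<in>K. (cmod (fourier L (\<lambda>x. f x * cnj (g x)) k))\<^sup>2)
    \<le> 4 / L ^ 3 * (\<Sum>\<^sub>\<infinity>p\<in>\<Gamma>. 1 / (1 + norm p) ^ 4) * (H1_norm L f)\<^sup>2 * (H1_norm L g)\<^sup>2"
proof -
  define A where "A p = (1 + norm p) * cmod (fourier L f p)" for p
  define B where "B p = (1 + norm p) * cmod (fourier L g p)" for p
  let ?C4 = "\<Sum>\<^sub>\<infinity>p\<in>\<Gamma>. 1 / (1 + norm p) ^ 4"
  let ?F = "\<lambda>p. (1 + (norm p)\<^sup>2) * (cmod (fourier L f p))\<^sup>2"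
  let ?G = "\<lambda>p. (1 + (norm p)\<^sup>2) * (cmod (fourier L g p))\<^sup>2"
  have hs4: "((\<lambda>p. 1 / (1 + norm p) ^ 4) has_sum ?C4) \<Gamma>" using summable_inverse_norm_4 by simp
  have le2: "((1 + norm p) * c)\<^sup>2 \<le> 2 * ((1 + (norm p)\<^sup>2) * c\<^sup>2)" for p :: "real ^ 3" and c
  proof -
    have "0 \<le> (1 - norm p)\<^sup>2" by simp
    then have "(1 + norm p)\<^sup>2 \<le> 2 * (1 + (norm p)\<^sup>2)" by (simp add: power2_eq_square algebra_simps)
    then have "(1 + norm p)\<^sup>2 * c\<^sup>2 \<le> 2 * (1 + (norm p)\<^sup>2) * c\<^sup>2" by (rule mult_right_mono) simp
    then show ?thesis unfolding power_mult_distrib by (simp only: mult.assoc)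
  qed
  have C4: "0 \<le> ?C4" by (intro infsum_nonneg) simp
  have "(\<Sum>k\<in>K. 1 * (cmod (fourier L (\<lambda>x. f x * cnj (g x)) k))\<^sup>2)
      \<le> 4 / L ^ 3 * ?C4 * (H1_norm L f)\<^sup>2 * (H1_norm L g)\<^sup>2"
  proof (rule weighted_sum_le_from_finite[OF convolution[OF H1D(1)[OF f] H1D(1)[OF g]] K(1)])
    fix P assume P: "finite P" "P \<subseteq> \<Gamma>"
    have "(cmod (\<Sum>p\<in>P. wave_const * (fourier L f p * cnj (fourier L g (p - k)))))\<^sup>2
        \<le> 1 / L ^ 3 * ((\<Sum>p\<in>P. (A p * B (p - k))\<^sup>2) * ?C4)" if k: "k \<in> K" for k
    proof -
      have "(cmod (\<Sum>p\<in>P. fourier L f p * cnj (fourier L g (p - k))))\<^sup>2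
          \<le> (\<Sum>p\<in>P. (A p * B (p - k))\<^sup>2) * (\<Sum>p\<in>P. (1 / ((1 + norm p) * (1 + norm (p - k))))\<^sup>2)"
      proof (rule cmod_sum_mult_sq_le)
        fix p
        have "1 + norm p \<noteq> 0" "1 + norm (p - k) \<noteq> 0" by (smt (verit) norm_ge_zero)+
        then show "cmod (fourier L f p * cnj (fourier L g (p - k)))
            \<le> A p * B (p - k) * (1 / ((1 + norm p) * (1 + norm (p - k))))"
          by (simp add: A_def B_def norm_mult)
      qed
      also have "(\<Sum>p\<in>P. (1 / ((1 + norm p) * (1 + norm (p - k))))\<^sup>2)
          \<le> (\<Sum>p\<in>P. (1 / (1 + norm p) ^ 4 + 1 / (1 + norm (p - k)) ^ 4) / 2)"
      proof (rule sum_mono)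
        fix p
        have "0 \<le> ((1 / (1 + norm p))\<^sup>2 - (1 / (1 + norm (p - k)))\<^sup>2)\<^sup>2" by simp
        moreover have "(1 / y) ^ 4 = ((1 / y)\<^sup>2)\<^sup>2" for y :: real by simp
        ultimately show "(1 / ((1 + norm p) * (1 + norm (p - k))))\<^sup>2
            \<le> (1 / (1 + norm p) ^ 4 + 1 / (1 + norm (p - k)) ^ 4) / 2"
          by (simp add: power2_diff power_divide power_mult_distrib)
      qed
      also have "\<dots> = ((\<Sum>p\<in>P. 1 / (1 + norm p) ^ 4) + (\<Sum>p\<in>P. 1 / (1 + norm (p - k)) ^ 4)) / 2"
        by (simp add: sum.distrib sum_divide_distrib[symmetric])
      also have "\<dots> \<le> (?C4 + ?C4) / 2"
        using P K k by (intro divide_right_mono add_mono shifted_sum_le(2)[OF hs4] finite_sum_le_has_sum[OF hs4]) auto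
      finally have "(cmod (\<Sum>p\<in>P. fourier L f p * cnj (fourier L g (p - k))))\<^sup>2 \<le> (\<Sum>p\<in>P. (A p * B (p - k))\<^sup>2) * ?C4"
        by (simp add: mult_left_mono sum_nonneg)
      then have "1 / L ^ 3 * (cmod (\<Sum>p\<in>P. fourier L f p * cnj (fourier L g (p - k))))\<^sup>2
          \<le> 1 / L ^ 3 * ((\<Sum>p\<in>P. (A p * B (p - k))\<^sup>2) * ?C4)"
        using L_pos by (intro mult_left_mono) auto
      then show ?thesis by (simp only: sum_distrib_left[symmetric] norm_mult power_mult_distrib cmod_wave_const_sq)
    qed
    then have "(\<Sum>k\<in>K. 1 * (cmod (\<Sum>p\<in>P. wave_const * (fourier L f p * cnj (fourier L g (p - k)))))\<^sup>2)
        \<le> (\<Sum>k\<in>K. 1 / L ^ 3 * ((\<Sum>p\<in>P. (A p * B (p - k))\<^sup>2) * ?C4))"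
      by (intro sum_mono) simp
    also have "\<dots> = 1 / L ^ 3 * ?C4 * (\<Sum>k\<in>K. \<Sum>p\<in>P. (A p * B (p - k))\<^sup>2)"
    proof -
      have "(\<Sum>k\<in>K. x * (S k * c)) = x * c * (\<Sum>k\<in>K. S k)" for x c :: real and S
        by (simp add: sum_distrib_left mult_ac)
      then show ?thesis .
    qed
    finally have 1: "(\<Sum>k\<in>K. 1 * (cmod (\<Sum>p\<in>P. wave_const * (fourier L f p * cnj (fourier L g (p - k)))))\<^sup>2)
        \<le> 1 / L ^ 3 * ?C4 * (\<Sum>k\<in>K. \<Sum>p\<in>P. (A p * B (p - k))\<^sup>2)" .
    have "(\<Sum>k\<in>K. \<Sum>p\<in>P. (A p * B (p - k))\<^sup>2) = (\<Sum>p\<in>P. (A p)\<^sup>2 * (\<Sum>k\<in>K. (B (p - k))\<^sup>2))"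
      by (subst sum.swap) (simp add: sum_distrib_left power_mult_distrib)
    also have "\<dots> \<le> (\<Sum>p\<in>P. 2 * ?F p * (2 * (H1_norm L g)\<^sup>2))"
    proof (intro sum_mono mult_mono sum_nonneg)
      fix p assume "p \<in> P"
      show "(A p)\<^sup>2 \<le> 2 * ?F p" unfolding A_def by (rule le2)
      have "(\<Sum>k\<in>K. (B (p - k))\<^sup>2) \<le> (\<Sum>k\<in>K. 2 * ?G (p - k))"
        unfolding B_def by (intro sum_mono le2)
      also have "\<dots> = 2 * (\<Sum>k\<in>K. ?G (p - k))" by (simp add: sum_distrib_left)
      also have "\<dots> \<le> 2 * (H1_norm L g)\<^sup>2"
        using \<open>p \<in> P\<close> P K by (intro mult_left_mono shifted_sum_le(1)[OF H1D(3)[OF g]]) auto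
      finally show "(\<Sum>k\<in>K. (B (p - k))\<^sup>2) \<le> 2 * (H1_norm L g)\<^sup>2" .
    qed auto
    also have "\<dots> = 4 * (H1_norm L g)\<^sup>2 * (\<Sum>p\<in>P. ?F p)" by (simp add: sum_distrib_left sum_distrib_right mult_ac)
    also have "\<dots> \<le> 4 * (H1_norm L g)\<^sup>2 * (H1_norm L f)\<^sup>2"
      using P by (intro mult_left_mono finite_sum_le_has_sum[OF H1D(3)[OF f]]) auto
    finally have "1 / L ^ 3 * ?C4 * (\<Sum>k\<in>K. \<Sum>p\<in>P. (A p * B (p - k))\<^sup>2)
        \<le> 1 / L ^ 3 * ?C4 * (4 * (H1_norm L g)\<^sup>2 * (H1_norm L f)\<^sup>2)"
      using L_pos C4 by (intro mult_left_mono) auto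
    also have "\<dots> = 4 / L ^ 3 * ?C4 * (H1_norm L f)\<^sup>2 * (H1_norm L g)\<^sup>2" by (simp add: mult_ac)
    finally show "(\<Sum>k\<in>K. 1 * (cmod (\<Sum>p\<in>P. wave_const * (fourier L f p * cnj (fourier L g (p - k)))))\<^sup>2)
        \<le> 4 / L ^ 3 * ?C4 * (H1_norm L f)\<^sup>2 * (H1_norm L g)\<^sup>2"
      using 1 by linarith
  qed (use K in auto)
  then show ?thesis by simp
qed

text \<open>The product is a priori only integrable. Its coefficients are square summable, and by
  uniqueness it equals the \<open>L2\<close> function that Riesz-Fischer attaches to them.\<close>

lemma H1_product_L2:
  assumes f: "f \<in> H1 L" and g: "g \<in> H1 L"
  shows "(\<lambda>x. f x * cnj (g x)) \<in> L2 L"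
proof -
  let ?h = "\<lambda>x. f x * cnj (g x)"
  note fL = H1D(1)[OF f] and gL = L2_cnj[OF H1D(1)[OF g]]
  have "(\<lambda>k. (cmod (fourier L ?h k))\<^sup>2) summable_on \<Gamma>"
  proof (rule nonneg_bounded_partial_sums_imp_summable_on)
    show "\<forall>\<^sub>F K in finite_subsets_at_top \<Gamma>. (\<Sum>k\<in>K. (cmod (fourier L ?h k))\<^sup>2)
        \<le> 4 / L ^ 3 * (\<Sum>\<^sub>\<infinity>p\<in>\<Gamma>. 1 / (1 + norm p) ^ 4) * (H1_norm L f)\<^sup>2 * (H1_norm L g)\<^sup>2"
      by (intro eventually_finite_subsets_at_top_weakI H1_product_bound f g)
  qed simp
  then obtain u where u: "u \<in> L2 L" "\<And>k. k \<in> \<Gamma> \<Longrightarrow> fourier L u k = fourier L ?h k"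
    by (rule riesz_fischer) blast
  have "AE x in M. ?h x = u x"
    by (rule fourier_unique[OF L2_mult_integrable[OF fL gL] L2_integrable[OF u(1)]]) (simp add: u)
  note [measurable] = L2D(2)[OF fL] L2D(2)[OF gL] L2D(2)[OF u(1)]
  show ?thesis
  proof (rule L2I)
    show "periodic L ?h" using L2D(1)[OF fL] L2D(1)[OF gL] by (simp add: periodic_def)
    show "?h \<in> borel_measurable borel" by measurable
    have "AE x in M. (cmod (?h x))\<^sup>2 = (cmod (u x))\<^sup>2" using \<open>AE x in M. ?h x = u x\<close> by eventually_elim simp
    then show "integrable M (\<lambda>x. (cmod (?h x))\<^sup>2)"
      using L2D(3)[OF u(1)] by (subst integrable_cong_AE) auto
  qed
qed

text \<open>The convolution sum is split at \<open>norm p = norm k\<close>: for the low frequencies of \<open>f\<close> the sum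
  over \<open>p\<close> is controlled by \<open>\<Sum> 1 / (1 + (norm p)\<^sup>2)\<close>, for the high ones the sum over \<open>k\<close> is controlled
  by \<open>\<Sum> 1 / norm k\<close>. The volume factor \<open>1 / L ^ 3\<close> makes both bounds uniform in \<open>L\<close>.\<close>

lemma product_negative_order_bound:
  assumes f: "f \<in> H1 L" and g: "g \<in> L2 L" and K: "finite K" "K \<subseteq> \<Gamma> - {0}"
  shows "(\<Sum>k\<in>K. 1 / norm k * (cmod (fourier L (\<lambda>x. f x * cnj (g x)) k))\<^sup>2)
    \<le> (4 + 2 / L\<^sup>2) * (H1_norm L f)\<^sup>2 * (L2_norm L g)\<^sup>2"
proof (rule weighted_sum_le_from_finite[OF convolution[OF H1D(1)[OF f] g] K(1)])
  fix P assume P: "finite P" "P \<subseteq> \<Gamma>"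
  define b where "b = dual_spacing"
  have b_pos: "0 < b" unfolding b_def by (rule dual_spacing_pos)
  note inverse_norm_sum_le' = dual_inverse_norm_sum_le[folded b_def]
    and inverse_norm_sq_sum_le' = dual_inverse_norm_sq_sum_le[folded b_def]
  define F where "F p = sqrt (1 + (norm p)\<^sup>2) * cmod (fourier L f p)" for p
  define G where "G p = cmod (fourier L g p)" for p
  have F_sq: "(F p)\<^sup>2 = (1 + (norm p)\<^sup>2) * (cmod (fourier L f p))\<^sup>2" for p
    by (simp add: F_def power_mult_distrib)
  have F_hs: "((\<lambda>p. (F p)\<^sup>2) has_sum (H1_norm L f)\<^sup>2) \<Gamma>" using H1D(3)[OF f] by (simp only: F_sq)
  have G_hs: "((\<lambda>p. (G p)\<^sup>2) has_sum (L2_norm L g)\<^sup>2) \<Gamma>" unfolding G_def by (rule parseval[OF g])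
  have sq_pos: "0 < 1 + (norm p)\<^sup>2" for p :: "real ^ 3" by (simp add: add_pos_nonneg)
  let ?t = "\<lambda>k p. fourier L f p * cnj (fourier L g (p - k))"
  let ?PA = "\<lambda>k. {p \<in> P. norm k \<le> norm p}"
  let ?PB = "\<lambda>k. {p \<in> P. norm p < norm k}"
  \<comment> \<open>As \<open>b * L = 2 * pi\<close>, the density of the dual lattice cancels the
    volume, and 26 is below \<open>6 ^ 3\<close>.\<close>
  have aL: "26 / (b ^ 3 * L ^ 3) \<le> 1"
  proof -
    have "b ^ 3 * L ^ 3 = (2 * pi) ^ 3" using L_pos by (simp add: b_def power_divide)
    moreover have "(2 * 3) ^ 3 \<le> (2 * pi) ^ 3" using pi_gt3 by (intro power_mono) auto
    ultimately show ?thesis by simp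
  qed
  have B: "1 / norm k * (1 / L ^ 3 * (cmod (\<Sum>p\<in>?PB k. ?t k p))\<^sup>2) \<le> (1 + 1 / L\<^sup>2) * (\<Sum>p\<in>P. (F p * G (p - k))\<^sup>2)"
    if k: "k \<in> K" for k
  proof -
    have k0: "k \<noteq> 0" "k \<in> \<Gamma>" using k K by auto
    have "(cmod (\<Sum>p\<in>?PB k. ?t k p))\<^sup>2 \<le> (\<Sum>p\<in>?PB k. (F p * G (p - k))\<^sup>2) * (\<Sum>p\<in>?PB k. (1 / sqrt (1 + (norm p)\<^sup>2))\<^sup>2)"
    proof (rule cmod_sum_mult_sq_le)
      fix p show "cmod (?t k p) \<le> F p * G (p - k) * (1 / sqrt (1 + (norm p)\<^sup>2))"
        using sq_pos[of p] by (simp add: F_def G_def norm_mult)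
    qed
    also have "\<dots> \<le> (\<Sum>p\<in>P. (F p * G (p - k))\<^sup>2) * (1 + 26 * norm k / b ^ 3)"
    proof (intro mult_mono sum_mono2 sum_nonneg)
      have "(\<Sum>p\<in>?PB k. (1 / sqrt (1 + (norm p)\<^sup>2))\<^sup>2) = (\<Sum>p\<in>?PB k. 1 / (1 + (norm p)\<^sup>2))"
        using sq_pos by (intro sum.cong) (auto simp: power_divide less_imp_le)
      also have "\<dots> \<le> (\<Sum>p\<in>insert 0 (?PB k - {0}). 1 / (1 + (norm p)\<^sup>2))"
        using P by (intro sum_mono2) (auto simp: sq_pos less_imp_le)
      also have "\<dots> = 1 + (\<Sum>p\<in>?PB k - {0}. 1 / (1 + (norm p)\<^sup>2))" using P by (subst sum.insert) auto
      also have "(\<Sum>p\<in>?PB k - {0}. 1 / (1 + (norm p)\<^sup>2)) \<le> (\<Sum>p\<in>?PB k - {0}. 1 / (norm p)\<^sup>2)"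
        by (intro sum_mono divide_left_mono mult_pos_pos sq_pos) auto
      also have "\<dots> \<le> 26 * norm k / b ^ 3" by (rule inverse_norm_sq_sum_le') (use P in \<open>auto simp: b_def\<close>)
      finally show "(\<Sum>p\<in>?PB k. (1 / sqrt (1 + (norm p)\<^sup>2))\<^sup>2) \<le> 1 + 26 * norm k / b ^ 3" by simp
    qed (use P in auto)
    finally have "1 / norm k * (1 / L ^ 3 * (cmod (\<Sum>p\<in>?PB k. ?t k p))\<^sup>2)
        \<le> 1 / norm k * (1 / L ^ 3 * ((\<Sum>p\<in>P. (F p * G (p - k))\<^sup>2) * (1 + 26 * norm k / b ^ 3)))"
      using L_pos by (intro mult_left_mono) auto
    also have "\<dots> = (1 / (norm k * L ^ 3) + 26 / (b ^ 3 * L ^ 3)) * (\<Sum>p\<in>P. (F p * G (p - k))\<^sup>2)"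
    proof -
      have "1 / x * (1 / l * (s * (1 + 26 * x / c))) = (1 / (x * l) + 26 / (c * l)) * s" if "x \<noteq> 0" for x l s c :: real
        using that by (cases "c = 0"; cases "l = 0") (simp_all add: field_simps)
      then show ?thesis using k0 by simp
    qed
    also have "\<dots> \<le> (1 / L\<^sup>2 + 1) * (\<Sum>p\<in>P. (F p * G (p - k))\<^sup>2)"
    proof (intro mult_right_mono add_mono aL sum_nonneg)
      \<comment> \<open>The summand treated here stems from the frequency \<open>p = 0\<close>,
        which the lattice sums omit; the gap \<open>norm k \<ge> 2 * pi / L\<close> turns it into
        \<open>1 / L\<^sup>2\<close>.\<close>
      have "b * L ^ 3 \<le> norm k * L ^ 3" using dual_norm_ge[OF k0(2,1), folded b_def] L_pos by (intro mult_right_mono) auto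
      moreover have "b * L ^ 3 = 2 * pi * L\<^sup>2" using L_pos by (simp add: b_def power2_eq_square power3_eq_cube)
      moreover have "1 * L\<^sup>2 \<le> 2 * pi * L\<^sup>2" using pi_gt3 by (intro mult_right_mono) auto
      ultimately have "L\<^sup>2 \<le> norm k * L ^ 3" by linarith
      then show "1 / (norm k * L ^ 3) \<le> 1 / L\<^sup>2" using L_pos k0 by (intro divide_left_mono) auto
    qed auto
    finally show ?thesis by (simp add: add.commute)
  qed
  have A: "1 / norm k * (1 / L ^ 3 * (cmod (\<Sum>p\<in>?PA k. ?t k p))\<^sup>2)
      \<le> (L2_norm L g)\<^sup>2 / L ^ 3 * (\<Sum>p\<in>P. (F p)\<^sup>2 / (1 + (norm p)\<^sup>2) * (if norm k \<le> norm p then 1 / norm k else 0))"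
    if k: "k \<in> K" for k
  proof -
    have "(cmod (\<Sum>p\<in>?PA k. ?t k p))\<^sup>2 \<le> (\<Sum>p\<in>?PA k. (F p / sqrt (1 + (norm p)\<^sup>2))\<^sup>2) * (\<Sum>p\<in>?PA k. (G (p - k))\<^sup>2)"
    proof (rule cmod_sum_mult_sq_le)
      fix p show "cmod (?t k p) \<le> F p / sqrt (1 + (norm p)\<^sup>2) * G (p - k)"
        using sq_pos[of p] by (simp add: F_def G_def norm_mult)
    qed
    also have "\<dots> \<le> (\<Sum>p\<in>?PA k. (F p)\<^sup>2 / (1 + (norm p)\<^sup>2)) * (L2_norm L g)\<^sup>2"
    proof (intro mult_mono)
      show "(\<Sum>p\<in>?PA k. (F p / sqrt (1 + (norm p)\<^sup>2))\<^sup>2) \<le> (\<Sum>p\<in>?PA k. (F p)\<^sup>2 / (1 + (norm p)\<^sup>2))"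
        using sq_pos by (intro sum_mono) (auto simp: power_divide less_imp_le)
      show "(\<Sum>p\<in>?PA k. (G (p - k))\<^sup>2) \<le> (L2_norm L g)\<^sup>2"
        by (rule shifted_sum_le(2)[OF G_hs]) (use P K k in auto)
    qed (auto intro!: sum_nonneg divide_nonneg_nonneg simp: less_imp_le[OF sq_pos])
    finally have "1 / norm k * (1 / L ^ 3 * (cmod (\<Sum>p\<in>?PA k. ?t k p))\<^sup>2)
        \<le> 1 / norm k * (1 / L ^ 3 * ((\<Sum>p\<in>?PA k. (F p)\<^sup>2 / (1 + (norm p)\<^sup>2)) * (L2_norm L g)\<^sup>2))"
      using L_pos by (intro mult_left_mono) auto
    also have "\<dots> = (L2_norm L g)\<^sup>2 / L ^ 3 * (\<Sum>p\<in>?PA k. (F p)\<^sup>2 / (1 + (norm p)\<^sup>2) * (1 / norm k))"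
      by (simp add: sum_distrib_left sum_distrib_right mult_ac)
    \<comment> \<open>The restriction on \<open>p\<close> is moved into the summand, so that the
      sums over \<open>k\<close> and \<open>p\<close> can be exchanged and the one over
      \<open>k\<close> evaluated for fixed \<open>p\<close>.\<close>
    also have "(\<Sum>p\<in>?PA k. (F p)\<^sup>2 / (1 + (norm p)\<^sup>2) * (1 / norm k))
        = (\<Sum>p\<in>P. (F p)\<^sup>2 / (1 + (norm p)\<^sup>2) * (if norm k \<le> norm p then 1 / norm k else 0))"
      using P by (intro sum.mono_neutral_cong_left) auto
    finally show ?thesis .
  qed
  have "(\<Sum>k\<in>K. 1 / norm k * (cmod (\<Sum>p\<in>P. wave_const * ?t k p))\<^sup>2)
      \<le> (\<Sum>k\<in>K. 2 * ((1 + 1 / L\<^sup>2) * (\<Sum>p\<in>P. (F p * G (p - k))\<^sup>2))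
          + 2 * ((L2_norm L g)\<^sup>2 / L ^ 3 * (\<Sum>p\<in>P. (F p)\<^sup>2 / (1 + (norm p)\<^sup>2) * (if norm k \<le> norm p then 1 / norm k else 0))))"
  proof (rule sum_mono)
    fix k assume k: "k \<in> K"
    have "P = ?PB k \<union> ?PA k" by auto
    then have split: "(\<Sum>p\<in>P. ?t k p) = (\<Sum>p\<in>?PB k. ?t k p) + (\<Sum>p\<in>?PA k. ?t k p)"
      using P(1) by (metis (no_types, lifting) sum.union_disjoint[of "?PB k" "?PA k"] finite_Un disjoint_iff mem_Collect_eq not_le)
    have "(cmod (x + y))\<^sup>2 \<le> 2 * (cmod x)\<^sup>2 + 2 * (cmod y)\<^sup>2" for x y :: complex
    proof -
      have "(cmod (x + y))\<^sup>2 \<le> (cmod x + cmod y)\<^sup>2" by (simp add: norm_triangle_ineq power_mono)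
      moreover have "0 \<le> (cmod x - cmod y)\<^sup>2" by simp
      ultimately show ?thesis by (simp add: power2_eq_square algebra_simps)
    qed
    then have "(cmod (\<Sum>p\<in>P. ?t k p))\<^sup>2 \<le> 2 * (cmod (\<Sum>p\<in>?PB k. ?t k p))\<^sup>2 + 2 * (cmod (\<Sum>p\<in>?PA k. ?t k p))\<^sup>2"
      unfolding split .
    then have "1 / norm k * (1 / L ^ 3) * (cmod (\<Sum>p\<in>P. ?t k p))\<^sup>2
        \<le> 1 / norm k * (1 / L ^ 3) * (2 * (cmod (\<Sum>p\<in>?PB k. ?t k p))\<^sup>2 + 2 * (cmod (\<Sum>p\<in>?PA k. ?t k p))\<^sup>2)"
      using L_pos by (intro mult_left_mono) auto
    also have "\<dots> = 2 * (1 / norm k * (1 / L ^ 3 * (cmod (\<Sum>p\<in>?PB k. ?t k p))\<^sup>2))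
        + 2 * (1 / norm k * (1 / L ^ 3 * (cmod (\<Sum>p\<in>?PA k. ?t k p))\<^sup>2))"
      by (simp add: algebra_simps)
    finally have "1 / norm k * (1 / L ^ 3) * (cmod (\<Sum>p\<in>P. ?t k p))\<^sup>2
        \<le> 2 * ((1 + 1 / L\<^sup>2) * (\<Sum>p\<in>P. (F p * G (p - k))\<^sup>2))
          + 2 * ((L2_norm L g)\<^sup>2 / L ^ 3 * (\<Sum>p\<in>P. (F p)\<^sup>2 / (1 + (norm p)\<^sup>2) * (if norm k \<le> norm p then 1 / norm k else 0)))"
      using A[OF k] B[OF k] by linarith
    then show "1 / norm k * (cmod (\<Sum>p\<in>P. wave_const * ?t k p))\<^sup>2
        \<le> 2 * ((1 + 1 / L\<^sup>2) * (\<Sum>p\<in>P. (F p * G (p - k))\<^sup>2))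
          + 2 * ((L2_norm L g)\<^sup>2 / L ^ 3 * (\<Sum>p\<in>P. (F p)\<^sup>2 / (1 + (norm p)\<^sup>2) * (if norm k \<le> norm p then 1 / norm k else 0)))"
      by (simp only: sum_distrib_left[symmetric] norm_mult power_mult_distrib cmod_wave_const_sq mult.assoc)
  qed
  also have "\<dots> = 2 * ((1 + 1 / L\<^sup>2) * (\<Sum>p\<in>P. (F p)\<^sup>2 * (\<Sum>k\<in>K. (G (p - k))\<^sup>2)))
      + 2 * ((L2_norm L g)\<^sup>2 / L ^ 3 * (\<Sum>p\<in>P. (F p)\<^sup>2 / (1 + (norm p)\<^sup>2) * (\<Sum>k\<in>K. if norm k \<le> norm p then 1 / norm k else 0)))"
    unfolding sum.distrib sum_distrib_left[symmetric] power_mult_distrib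
    by (subst (1 2) sum.swap) (simp add: sum_distrib_left)
  finally have 1: "(\<Sum>k\<in>K. 1 / norm k * (cmod (\<Sum>p\<in>P. wave_const * ?t k p))\<^sup>2)
      \<le> 2 * ((1 + 1 / L\<^sup>2) * (\<Sum>p\<in>P. (F p)\<^sup>2 * (\<Sum>k\<in>K. (G (p - k))\<^sup>2)))
      + 2 * ((L2_norm L g)\<^sup>2 / L ^ 3 * (\<Sum>p\<in>P. (F p)\<^sup>2 / (1 + (norm p)\<^sup>2) * (\<Sum>k\<in>K. if norm k \<le> norm p then 1 / norm k else 0)))" .
  have 2: "(\<Sum>p\<in>P. (F p)\<^sup>2 * (\<Sum>k\<in>K. (G (p - k))\<^sup>2)) \<le> (\<Sum>p\<in>P. (F p)\<^sup>2 * (L2_norm L g)\<^sup>2)"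
    by (intro sum_mono mult_left_mono shifted_sum_le(1)[OF G_hs]) (use P K in auto)
  have 3: "(\<Sum>p\<in>P. (F p)\<^sup>2 / (1 + (norm p)\<^sup>2) * (\<Sum>k\<in>K. if norm k \<le> norm p then 1 / norm k else 0))
      \<le> (\<Sum>p\<in>P. (F p)\<^sup>2 * (26 / b ^ 3))"
  proof (rule sum_mono)
    fix p assume "p \<in> P"
    have "(\<Sum>k\<in>K. if norm k \<le> norm p then 1 / norm k else 0) = (\<Sum>k\<in>{k \<in> K. norm k \<le> norm p}. 1 / norm k)"
      using K by (intro sum.mono_neutral_cong_right) auto
    also have "\<dots> \<le> 26 * (norm p)\<^sup>2 / b ^ 3" by (rule inverse_norm_sum_le') (use K in \<open>auto simp: b_def\<close>)
    also have "\<dots> \<le> (1 + (norm p)\<^sup>2) * (26 / b ^ 3)" using b_pos by (simp add: divide_right_mono)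
    finally have "(F p)\<^sup>2 / (1 + (norm p)\<^sup>2) * (\<Sum>k\<in>K. if norm k \<le> norm p then 1 / norm k else 0)
        \<le> (F p)\<^sup>2 / (1 + (norm p)\<^sup>2) * ((1 + (norm p)\<^sup>2) * (26 / b ^ 3))"
      using sq_pos[of p] by (intro mult_left_mono) auto
    also have "\<dots> = (F p)\<^sup>2 * (26 / b ^ 3)" using sq_pos[of p] by (simp only: mult.assoc[symmetric]) simp
    finally show "(F p)\<^sup>2 / (1 + (norm p)\<^sup>2) * (\<Sum>k\<in>K. if norm k \<le> norm p then 1 / norm k else 0) \<le> (F p)\<^sup>2 * (26 / b ^ 3)" .
  qed
  note 1
  also have "2 * ((1 + 1 / L\<^sup>2) * (\<Sum>p\<in>P. (F p)\<^sup>2 * (\<Sum>k\<in>K. (G (p - k))\<^sup>2)))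
      + 2 * ((L2_norm L g)\<^sup>2 / L ^ 3 * (\<Sum>p\<in>P. (F p)\<^sup>2 / (1 + (norm p)\<^sup>2) * (\<Sum>k\<in>K. if norm k \<le> norm p then 1 / norm k else 0)))
      \<le> 2 * ((1 + 1 / L\<^sup>2) * (\<Sum>p\<in>P. (F p)\<^sup>2 * (L2_norm L g)\<^sup>2)) + 2 * ((L2_norm L g)\<^sup>2 / L ^ 3 * (\<Sum>p\<in>P. (F p)\<^sup>2 * (26 / b ^ 3)))"
    using L_pos by (intro add_mono mult_left_mono 2 3) auto
  also have "\<dots> = (2 + 2 / L\<^sup>2 + 2 * (26 / (b ^ 3 * L ^ 3))) * (L2_norm L g)\<^sup>2 * (\<Sum>p\<in>P. (F p)\<^sup>2)"
    unfolding sum_distrib_right[symmetric] by (simp add: algebra_simps)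
  also have "\<dots> \<le> (4 + 2 / L\<^sup>2) * (L2_norm L g)\<^sup>2 * (H1_norm L f)\<^sup>2"
  proof (intro mult_mono)
    show "2 + 2 / L\<^sup>2 + 2 * (26 / (b ^ 3 * L ^ 3)) \<le> 4 + 2 / L\<^sup>2" using aL by linarith
    show "(\<Sum>p\<in>P. (F p)\<^sup>2) \<le> (H1_norm L f)\<^sup>2" using P by (intro finite_sum_le_has_sum[OF F_hs]) auto
  qed (auto intro: sum_nonneg)
  finally show "(\<Sum>k\<in>K. 1 / norm k * (cmod (\<Sum>p\<in>P. wave_const * (fourier L f p * cnj (fourier L g (p - k)))))\<^sup>2)
      \<le> (4 + 2 / L\<^sup>2) * (H1_norm L f)\<^sup>2 * (L2_norm L g)\<^sup>2"
    by (simp add: mult_ac)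
qed (use K in auto)

end

section \<open>The Pekar functionals in terms of the generated field\<close>

context torus
begin

section \<open>The Sobolev space of order one\<close>

lemma H1I:
  assumes "f \<in> L2 L" "(\<lambda>k. (norm k)\<^sup>2 * (cmod (fourier L f k))\<^sup>2) summable_on \<Gamma>"
  shows "f \<in> H1 L"
  using assms unfolding H1_def by simp

lemma cmod_add_sq_le: "(cmod (x + y))\<^sup>2 \<le> 2 * (cmod x)\<^sup>2 + 2 * (cmod y)\<^sup>2"
proof -
  have "(cmod (x + y))\<^sup>2 \<le> (cmod x + cmod y)\<^sup>2" by (simp add: norm_triangle_ineq power_mono)
  moreover have "0 \<le> (cmod x - cmod y)\<^sup>2" by simp
  ultimately show ?thesis by (simp add: power2_eq_square algebra_simps)
qed

lemma H1_cmult: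
  assumes "f \<in> H1 L" shows "(\<lambda>x. c * f x) \<in> H1 L"
proof (rule H1I)
  show "(\<lambda>x. c * f x) \<in> L2 L" using assms H1D(1) by (intro L2_cmult) auto
  have "(\<lambda>k. (cmod c)\<^sup>2 * ((norm k)\<^sup>2 * (cmod (fourier L f k))\<^sup>2)) summable_on \<Gamma>"
    using H1D(2)[OF assms] by (intro summable_on_cmult_right) (auto simp: has_sum_iff)
  then show "(\<lambda>k. (norm k)\<^sup>2 * (cmod (fourier L (\<lambda>x. c * f x) k))\<^sup>2) summable_on \<Gamma>"
    by (simp add: fourier_cmult norm_mult power_mult_distrib mult_ac)
qed

lemma H1_add:
  assumes f: "f \<in> H1 L" and g: "g \<in> H1 L" shows "(\<lambda>x. f x + g x) \<in> H1 L"
proof (rule H1I)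
  show "(\<lambda>x. f x + g x) \<in> L2 L" using f g H1D(1) by (intro L2_add) auto
  have four: "fourier L (\<lambda>x. f x + g x) k = fourier L f k + fourier L g k" for k
    by (rule fourier_add) (use f g in \<open>auto intro: L2_integrable dest: H1D(1)\<close>)
  have "(\<lambda>k. 2 * ((norm k)\<^sup>2 * (cmod (fourier L f k))\<^sup>2) + 2 * ((norm k)\<^sup>2 * (cmod (fourier L g k))\<^sup>2)) summable_on \<Gamma>"
    using H1D(2)[OF f] H1D(2)[OF g] by (intro summable_on_add summable_on_cmult_right) (auto simp: has_sum_iff)
  then show "(\<lambda>k. (norm k)\<^sup>2 * (cmod (fourier L (\<lambda>x. f x + g x) k))\<^sup>2) summable_on \<Gamma>"
  proof (rule summable_on_comparison_test)
    fix k
    have "(norm k)\<^sup>2 * (cmod (fourier L f k + fourier L g k))\<^sup>2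
        \<le> (norm k)\<^sup>2 * (2 * (cmod (fourier L f k))\<^sup>2 + 2 * (cmod (fourier L g k))\<^sup>2)"
      by (intro mult_left_mono cmod_add_sq_le) simp
    then show "(norm k)\<^sup>2 * (cmod (fourier L (\<lambda>x. f x + g x) k))\<^sup>2
        \<le> 2 * ((norm k)\<^sup>2 * (cmod (fourier L f k))\<^sup>2) + 2 * ((norm k)\<^sup>2 * (cmod (fourier L g k))\<^sup>2)"
      unfolding four by (simp add: algebra_simps)
  qed simp
qed

lemma H1_diff:
  assumes f: "f \<in> H1 L" and g: "g \<in> H1 L" shows "(\<lambda>x. f x - g x) \<in> H1 L"
  using H1_add[OF f H1_cmult[OF g, of "- 1"]] by simp

lemma H1_norm_nonneg: "0 \<le> H1_norm L f"
  unfolding H1_norm_def by (intro real_sqrt_ge_zero add_nonneg_nonneg) (auto simp: kinetic_def intro: infsum_nonneg)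

lemma L2_norm_add_sq_le:
  fixes f g :: "real ^ 3 \<Rightarrow> complex"
  assumes "f \<in> L2 L" "g \<in> L2 L"
  shows "(L2_norm L (\<lambda>x. f x + g x))\<^sup>2 \<le> 2 * (L2_norm L f)\<^sup>2 + 2 * (L2_norm L g)\<^sup>2"
proof -
  have "(\<integral>x. (cmod (f x + g x))\<^sup>2 \<partial>M) \<le> (\<integral>x. 2 * (cmod (f x))\<^sup>2 + 2 * (cmod (g x))\<^sup>2 \<partial>M)"
    using L2D(3)[OF assms(1)] L2D(3)[OF assms(2)] L2D(3)[OF L2_add[OF assms]]
    by (intro integral_mono) (auto intro: cmod_add_sq_le)
  then show ?thesis using L2D(3)[OF assms(1)] L2D(3)[OF assms(2)] by (simp add: L2_norm_sq)
qed

text \<open>Makes \<open>lap_inv_half_L2\<close> and \<open>fourier_lap_inv_half\<close> applicable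
  to the density inside \<open>sigma_fun\<close>.\<close>

lemma density_L2: "\<psi> \<in> H1 L \<Longrightarrow> (\<lambda>x. (cmod (\<psi> x))\<^sup>2) \<in> L2 L"
  using H1_product_L2[of \<psi> \<psi>] L2_cplx_iff[of "\<lambda>x. (cmod (\<psi> x))\<^sup>2"]
  by (simp only: complex_norm_square[symmetric] of_real_power)

section \<open>The inverse square root of the Laplacian and the field of a state\<close>

lemma fourier_diff_real:
  assumes "f \<in> L2 L" "g \<in> L2 L"
  shows "fourier L (cplx (\<lambda>x. f x - g x)) k = fourier L (cplx f) k - fourier L (cplx g) k"
proof -
  have "integrable M (cplx f)" "integrable M (cplx g)"
    using L2_integrable[OF assms(1)] L2_integrable[OF assms(2)] by simp_all
  then show ?thesis unfolding of_real_diff by (rule fourier_diff)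
qed

definition inv_norm :: "real ^ 3 \<Rightarrow> real" where "inv_norm k = (if k = 0 then 0 else 1 / norm k)"

lemma inv_norm_minus [simp]: "inv_norm (- k) = inv_norm k" and inv_norm_zero [simp]: "inv_norm 0 = 0" and inv_norm_nonneg: "0 \<le> inv_norm k"
  by (simp_all add: inv_norm_def)

lemma lap_inv_half: "lap_inv_pow L (1 / 2) f = fourier_mult L inv_norm f"
proof -
  have "(\<lambda>k :: real ^ 3. if k = 0 then 0 else norm k powr (- 2 * (1 / 2))) = inv_norm"
    by (auto simp: inv_norm_def fun_eq_iff powr_minus_divide)
  then show ?thesis unfolding lap_inv_pow_def by simp
qed

lemma inv_norm_summable:
  assumes "(\<lambda>k. (cmod (c k))\<^sup>2) summable_on \<Gamma>"
  shows "(\<lambda>k. (inv_norm k)\<^sup>2 * (cmod (c k))\<^sup>2) summable_on \<Gamma>"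
proof (rule summable_on_comparison_test)
  show "(\<lambda>k. (1 / dual_spacing)\<^sup>2 * (cmod (c k))\<^sup>2) summable_on \<Gamma>" using assms by (rule summable_on_cmult_right)
  fix k assume k: "k \<in> \<Gamma>"
  have "inv_norm k \<le> 1 / dual_spacing"
    unfolding inv_norm_def using dual_norm_ge[OF k] L_pos dual_spacing_pos frac_le[of 1 1 dual_spacing "norm k"] by auto
  then show "(inv_norm k)\<^sup>2 * (cmod (c k))\<^sup>2 \<le> (1 / dual_spacing)\<^sup>2 * (cmod (c k))\<^sup>2"
    by (intro mult_right_mono power_mono inv_norm_nonneg) auto
qed simp

lemma lap_inv_half_L2: "f \<in> L2 L \<Longrightarrow> lap_inv_pow L (1 / 2) f \<in> L2 L"
  and fourier_lap_inv_half: "f \<in> L2 L \<Longrightarrow> k \<in> \<Gamma> \<Longrightarrow>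
    fourier L (cplx (lap_inv_pow L (1 / 2) f)) k = of_real (inv_norm k) * fourier L (cplx f) k"
  using fourier_mult_spec[of inv_norm f] inv_norm_summable[OF fourier_sq_summable[of "cplx f"]] by (auto simp: lap_inv_half)

lemma integral_real_parseval:
  assumes "f \<in> L2 L" "g \<in> L2 L"
  shows "((\<lambda>k. fourier L (cplx f) k * cnj (fourier L (cplx g) k)) has_sum of_real (\<integral>x. f x * g x \<partial>M)) \<Gamma>"
proof -
  have "(\<integral>x. cplx f x * cnj (cplx g x) \<partial>M) = of_real (\<integral>x. f x * g x \<partial>M)"
    by (simp flip: of_real_mult)
  then show ?thesis using parseval_inner[of "cplx f" "cplx g"] assms by simp
qed

text \<open>The symbol is real, so in Parseval's identity it may stand with either factor.\<close>

lemma lap_inv_half_symmetric: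
  assumes "f \<in> L2 L" "g \<in> L2 L"
  shows "(\<integral>x. lap_inv_pow L (1 / 2) f x * g x \<partial>M) = (\<integral>x. f x * lap_inv_pow L (1 / 2) g x \<partial>M)"
proof -
  have "((\<lambda>k. of_real (inv_norm k) * fourier L (cplx f) k * cnj (fourier L (cplx g) k)) has_sum
      of_real (\<integral>x. lap_inv_pow L (1 / 2) f x * g x \<partial>M)) \<Gamma>"
    using integral_real_parseval[OF lap_inv_half_L2[OF assms(1)] assms(2)]
    by (rule has_sum_cong[THEN iffD1, rotated]) (simp add: fourier_lap_inv_half assms)
  moreover have "((\<lambda>k. of_real (inv_norm k) * fourier L (cplx f) k * cnj (fourier L (cplx g) k)) has_sum
      of_real (\<integral>x. f x * lap_inv_pow L (1 / 2) g x \<partial>M)) \<Gamma>"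
    using integral_real_parseval[OF assms(1) lap_inv_half_L2[OF assms(2)]]
    by (rule has_sum_cong[THEN iffD1, rotated]) (simp add: fourier_lap_inv_half assms)
  ultimately show ?thesis using has_sum_unique of_real_eq_iff by blast
qed

lemma sigma_L2: "\<psi> \<in> H1 L \<Longrightarrow> sigma_fun L \<psi> \<in> L2 L"
  unfolding sigma_fun_def by (intro lap_inv_half_L2 density_L2)

lemma fourier_sigma: "\<psi> \<in> H1 L \<Longrightarrow> k \<in> \<Gamma> \<Longrightarrow>
    fourier L (cplx (sigma_fun L \<psi>)) k = of_real (inv_norm k) * fourier L (\<lambda>x. of_real ((cmod (\<psi> x))\<^sup>2)) k"
  unfolding sigma_fun_def by (intro fourier_lap_inv_half density_L2)

text \<open>Self-adjointness moves the operator from the field to the density; the energy becomes a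
  quadratic polynomial in \<open>\<phi>\<close> whose linear part is the pairing with
  \<open>sigma_fun\<close>.\<close>

lemma potential_term:
  assumes "\<phi> \<in> L2 L" "\<psi> \<in> H1 L"
  shows "(\<integral>x. V_pot L \<phi> x * (cmod (\<psi> x))\<^sup>2 \<partial>M) = - 2 * (\<integral>x. \<phi> x * sigma_fun L \<psi> x \<partial>M)"
proof -
  have "(\<integral>x. V_pot L \<phi> x * (cmod (\<psi> x))\<^sup>2 \<partial>M) = - 2 * (\<integral>x. lap_inv_pow L (1 / 2) \<phi> x * (cmod (\<psi> x))\<^sup>2 \<partial>M)"
    unfolding V_pot_def by (simp add: mult.assoc)
  then show ?thesis
    using lap_inv_half_symmetric[OF assms(1) density_L2[OF assms(2)]] by (simp add: sigma_fun_def)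
qed

section \<open>Elimination of the field by completing the square\<close>

lemma L2_norm_diff_sq:
  fixes f g :: "real ^ 3 \<Rightarrow> real"
  assumes "f \<in> L2 L" "g \<in> L2 L"
  shows "(L2_norm L (\<lambda>x. f x - g x))\<^sup>2 = (L2_norm L f)\<^sup>2 - 2 * (\<integral>x. f x * g x \<partial>M) + (L2_norm L g)\<^sup>2"
proof -
  have "(\<integral>x. (norm (f x - g x))\<^sup>2 \<partial>M) = (\<integral>x. (norm (f x))\<^sup>2 - 2 * (f x * g x) + (norm (g x))\<^sup>2 \<partial>M)"
    by (intro Bochner_Integration.integral_cong) (simp_all add: power2_diff)
  also have "\<dots> = (\<integral>x. (norm (f x))\<^sup>2 \<partial>M) - 2 * (\<integral>x. f x * g x \<partial>M) + (\<integral>x. (norm (g x))\<^sup>2 \<partial>M)"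
    using L2D(3)[OF assms(1)] L2D(3)[OF assms(2)] L2_mult_integrable[OF assms]
    by (simp del: real_norm_def power2_abs)
  finally show ?thesis by (simp only: L2_norm_sq)
qed

text \<open>The Pekar functional in closed form; \<open>E_fun_eq\<close> identifies it with the
  infimum \<open>E_fun\<close>, attained at the field \<open>sigma_fun L \<psi>\<close>.\<close>

definition E_explicit :: "(real ^ 3 \<Rightarrow> complex) \<Rightarrow> real" where
  "E_explicit \<psi> = kinetic L \<psi> - (L2_norm L (sigma_fun L \<psi>))\<^sup>2"

lemma G_fun_eq:
  assumes "\<phi> \<in> L2 L" "\<psi> \<in> H1 L"
  shows "G_fun L \<psi> \<phi> = E_explicit \<psi> + (L2_norm L (\<lambda>x. \<phi> x - sigma_fun L \<psi> x))\<^sup>2"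
  unfolding G_fun_def h_form_def potential_term[OF assms] L2_norm_diff_sq[OF assms(1) sigma_L2[OF assms(2)]] E_explicit_def
  by simp

lemma L2_norm_zero [simp]: "L2_norm L (\<lambda>x. 0 :: 'b :: real_normed_vector) = 0"
  by (simp add: L2_norm_def)

lemma E_fun_eq:
  assumes "\<psi> \<in> H1 L" shows "E_fun L \<psi> = E_explicit \<psi>"
proof (rule antisym)
  have "G_fun L \<psi> (sigma_fun L \<psi>) = E_explicit \<psi>" using G_fun_eq[OF sigma_L2[OF assms] assms] by simp
  moreover have "bdd_below ((\<lambda>\<phi>. G_fun L \<psi> \<phi>) ` L2 L)"
    by (rule bdd_belowI2[where m = "E_explicit \<psi>"]) (simp add: G_fun_eq assms)
  ultimately show "E_fun L \<psi> \<le> E_explicit \<psi>"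
    unfolding E_fun_def using cINF_lower[OF _ sigma_L2[OF assms], of "\<lambda>\<phi>. G_fun L \<psi> \<phi>"] by simp
  show "E_explicit \<psi> \<le> E_fun L \<psi>"
    unfolding E_fun_def by (rule cINF_greatest) (use L2_zero in \<open>auto simp: G_fun_eq assms\<close>)
qed

section \<open>The resolvent form in Fourier space\<close>

lemma has_sum_le_finite_sums_real:
  fixes f :: "'i \<Rightarrow> real"
  assumes "\<And>x. x \<in> A \<Longrightarrow> 0 \<le> f x" "\<And>F. finite F \<Longrightarrow> F \<subseteq> A \<Longrightarrow> sum f F \<le> C"
  shows "f summable_on A" "infsum f A \<le> C"
proof -
  show s: "f summable_on A"
    by (rule nonneg_bounded_partial_sums_imp_summable_on[where C = C])
      (use assms in \<open>auto intro: eventually_finite_subsets_at_top_weakI\<close>)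
  show "infsum f A \<le> C" by (rule infsum_le_finite_sums[OF s]) (use assms(2) in auto)
qed

lemma sqrt_lap_resolvent_spec:
  assumes "u \<in> L2 L" "0 < \<kappa>"
  shows "sqrt_lap_resolvent L \<kappa> u \<in> L2 L"
    "k \<in> \<Gamma> \<Longrightarrow> fourier L (cplx (sqrt_lap_resolvent L \<kappa> u)) k = of_real (inverse (1 + \<kappa> * norm k)) * fourier L (cplx u) k"
proof -
  have "(\<lambda>k. (inverse (1 + \<kappa> * norm k))\<^sup>2 * (cmod (fourier L (cplx u) k))\<^sup>2) summable_on \<Gamma>"
  proof (rule summable_on_comparison_test)
    show "(\<lambda>k. (cmod (fourier L (cplx u) k))\<^sup>2) summable_on \<Gamma>"
      using assms by (intro fourier_sq_summable) simp
    fix k :: "real ^ 3"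
    have "inverse (1 + \<kappa> * norm k) \<le> 1" "0 \<le> inverse (1 + \<kappa> * norm k)"
      using assms(2) by (auto intro: inverse_le_1_iff[THEN iffD2])
    then have "(inverse (1 + \<kappa> * norm k))\<^sup>2 \<le> 1" by (simp add: power_le_one)
    then show "(inverse (1 + \<kappa> * norm k))\<^sup>2 * (cmod (fourier L (cplx u) k))\<^sup>2 \<le> (cmod (fourier L (cplx u) k))\<^sup>2"
      by (intro mult_left_le_one_le) auto
  qed simp
  from fourier_mult_spec[OF this]
  show "sqrt_lap_resolvent L \<kappa> u \<in> L2 L"
    "k \<in> \<Gamma> \<Longrightarrow> fourier L (cplx (sqrt_lap_resolvent L \<kappa> u)) k = of_real (inverse (1 + \<kappa> * norm k)) * fourier L (cplx u) k"
    by (simp_all add: sqrt_lap_resolvent_def)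
qed

lemma resolvent_form_has_sum:
  assumes u: "u \<in> L2 L" and \<kappa>: "0 < \<kappa>"
  shows "((\<lambda>k. \<kappa> * norm k / (1 + \<kappa> * norm k) * (cmod (fourier L (cplx u) k))\<^sup>2) has_sum resolvent_form L \<kappa> u) \<Gamma>"
proof -
  let ?v = "\<lambda>x. u x - sqrt_lap_resolvent L \<kappa> u x"
  note R = sqrt_lap_resolvent_spec[OF u \<kappa>]
  have v: "?v \<in> L2 L" by (intro L2_diff u R)
  have "((\<lambda>k. fourier L (cplx u) k * cnj (fourier L (cplx ?v) k)) has_sum of_real (resolvent_form L \<kappa> u)) \<Gamma>"
    unfolding resolvent_form_def L2_inner_def by (rule integral_real_parseval[OF u v])
  moreover have "fourier L (cplx u) k * cnj (fourier L (cplx ?v) k)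
      = of_real (\<kappa> * norm k / (1 + \<kappa> * norm k) * (cmod (fourier L (cplx u) k))\<^sup>2)" if k: "k \<in> \<Gamma>" for k
  proof -
    have pos: "1 + \<kappa> * norm k > 0" using \<kappa> by (simp add: add_pos_nonneg)
    have "fourier L (cplx ?v) k = fourier L (cplx u) k - of_real (inverse (1 + \<kappa> * norm k)) * fourier L (cplx u) k"
      using fourier_diff_real[OF u R(1)] R(2)[OF k] by (simp only:)
    also have "\<dots> = of_real (1 - inverse (1 + \<kappa> * norm k)) * fourier L (cplx u) k" by (simp add: algebra_simps)
    also have "1 - inverse (1 + \<kappa> * norm k) = \<kappa> * norm k / (1 + \<kappa> * norm k)" using pos by (simp add: field_simps)
    finally have v: "fourier L (cplx ?v) k = of_real (\<kappa> * norm k / (1 + \<kappa> * norm k)) * fourier L (cplx u) k" .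
    have "z * cnj (of_real t * z) = of_real (t * (cmod z)\<^sup>2)" for z t
      using complex_norm_square[of z] by (simp add: mult_ac)
    then show ?thesis unfolding v .
  qed
  ultimately have "((\<lambda>k. complex_of_real (\<kappa> * norm k / (1 + \<kappa> * norm k) * (cmod (fourier L (cplx u) k))\<^sup>2)) has_sum of_real (resolvent_form L \<kappa> u)) \<Gamma>"
    by (simp cong: has_sum_cong)
  then show ?thesis by (simp only: has_sum_of_real_iff)
qed

text \<open>Joint symbol of the two terms in the lower bound: the resolvent form does not see
  \<open>k = 0\<close>, where the squared mean contributes with factor 1.\<close>

definition weight :: "real \<Rightarrow> real ^ 3 \<Rightarrow> real" where
  "weight \<kappa> k = (if k = 0 then 1 else \<kappa> * norm k / (1 + \<kappa> * norm k))"

lemma weight_nonneg: "0 < \<kappa> \<Longrightarrow> 0 \<le> weight \<kappa> k"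
  by (simp add: weight_def)

lemma fourier_0: "fourier L (cplx u) 0 = of_real (L powr (- 3 / 2) * (\<integral>x. u x \<partial>M))"
  by (simp add: fourier_def)

lemma weight_form_has_sum:
  assumes u: "u \<in> L2 L" and \<kappa>: "0 < \<kappa>"
  shows "((\<lambda>k. weight \<kappa> k * (cmod (fourier L (cplx u) k))\<^sup>2) has_sum
     (resolvent_form L \<kappa> u + \<bar>L powr (- 3 / 2) * (\<integral>x. u x \<partial>M)\<bar>\<^sup>2)) \<Gamma>"
proof -
  have "((\<lambda>k. if k = 0 then (cmod (fourier L (cplx u) 0))\<^sup>2 else 0) has_sum (cmod (fourier L (cplx u) 0))\<^sup>2) \<Gamma>"
    by (rule has_sum_finite_neutralI[of "{0}"]) auto
  from has_sum_add[OF resolvent_form_has_sum[OF u \<kappa>] this]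
  have "((\<lambda>k. \<kappa> * norm k / (1 + \<kappa> * norm k) * (cmod (fourier L (cplx u) k))\<^sup>2
      + (if k = 0 then (cmod (fourier L (cplx u) 0))\<^sup>2 else 0)) has_sum
     (resolvent_form L \<kappa> u + \<bar>L powr (- 3 / 2) * (\<integral>x. u x \<partial>M)\<bar>\<^sup>2)) \<Gamma>"
    by (simp add: fourier_0 norm_mult abs_mult power_mult_distrib)
  then show ?thesis
    by (rule has_sum_cong[THEN iffD1, rotated]) (simp add: weight_def)
qed

text \<open>With \<open>a = cmod (u - d)\<close> and \<open>b = cmod d\<close>, the difference
  between \<open>1 + t\<close> times the right side and \<open>t * (a + b)\<^sup>2\<close> is the
  square of \<open>a - t * b\<close>. The factor \<open>t / (1 + t)\<close> is thus the exact
  minimum over \<open>d\<close>, and it becomes the resolvent symbol for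
  \<open>t = \<kappa> * norm k\<close>.\<close>

lemma weighted_split:
  assumes t: "0 < t"
  shows "t / (1 + t) * (cmod u)\<^sup>2 \<le> (cmod (u - d))\<^sup>2 + t * (cmod d)\<^sup>2"
proof -
  have "cmod u \<le> cmod (u - d) + cmod d" by (metis diff_add_cancel norm_triangle_ineq)
  then have "(cmod u)\<^sup>2 \<le> (cmod (u - d) + cmod d)\<^sup>2" by (intro power_mono) auto
  then have "t * (cmod u)\<^sup>2 \<le> t * (cmod (u - d) + cmod d)\<^sup>2" using t by simp
  also have "\<dots> \<le> (1 + t) * ((cmod (u - d))\<^sup>2 + t * (cmod d)\<^sup>2)"
  proof -
    have "0 \<le> (cmod (u - d) - t * cmod d)\<^sup>2" by simp
    then show ?thesis by (simp add: power2_eq_square algebra_simps)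
  qed
  finally show ?thesis using t by (simp add: pos_divide_le_eq mult.commute)
qed

text \<open>The difference of the densities is only the real part of \<open>?h\<close>, so its
  coefficient at \<open>k\<close> mixes those of \<open>?h\<close> at \<open>k\<close> and
  \<open>- k\<close>; the bound is applied to \<open>K\<close> and to its reflection. The leading 4
  bounds the squared norm of \<open>\<psi> + \<eta>\<close> for normalized states.\<close>

lemma density_diff_bound:
  assumes \<psi>: "\<psi> \<in> states L" and \<eta>: "\<eta> \<in> states L" and K: "finite K" "K \<subseteq> \<Gamma> - {0}"
  shows "(\<Sum>k\<in>K. norm k * (cmod (fourier L (cplx (sigma_fun L \<psi>)) k - fourier L (cplx (sigma_fun L \<eta>)) k))\<^sup>2)
    \<le> 4 * (4 + 2 / L\<^sup>2) * (H1_norm L (\<lambda>x. \<psi> x - \<eta> x))\<^sup>2"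
proof -
  let ?C = "4 * (4 + 2 / L\<^sup>2) * (H1_norm L (\<lambda>x. \<psi> x - \<eta> x))\<^sup>2"
  have H: "\<psi> \<in> H1 L" "\<eta> \<in> H1 L" and n1: "L2_norm L \<psi> = 1" "L2_norm L \<eta> = 1"
    using \<psi> \<eta> by (auto simp: states_def)
  note L2 = H1D(1)[OF H(1)] H1D(1)[OF H(2)]
  let ?h = "\<lambda>x. (\<psi> x - \<eta> x) * cnj (\<psi> x + \<eta> x)"
  have int: "integrable M ?h"
    by (rule L2_mult_integrable[OF L2_diff[OF L2] L2_cnj[OF L2_add[OF L2]]])
  have "(cmod (\<psi> x))\<^sup>2 - (cmod (\<eta> x))\<^sup>2 = Re (?h x)" for x
    unfolding cmod_power2 by (simp add: power2_eq_square algebra_simps)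
  then have eq: "(\<lambda>x. complex_of_real ((cmod (\<psi> x))\<^sup>2) - of_real ((cmod (\<eta> x))\<^sup>2)) = (\<lambda>x. of_real (Re (?h x)))"
    by (metis of_real_diff)
  have four: "fourier L (\<lambda>x. of_real ((cmod (\<psi> x))\<^sup>2)) k - fourier L (\<lambda>x. of_real ((cmod (\<eta> x))\<^sup>2)) k
      = (fourier L ?h k + cnj (fourier L ?h (- k))) / 2" for k
    unfolding fourier_Re[OF int, symmetric] eq[symmetric]
    by (rule fourier_diff[symmetric]) (use density_L2[OF H(1)] density_L2[OF H(2)] in \<open>auto intro!: L2_integrable simp del: of_real_power\<close>)
  have bound: "(\<Sum>k\<in>K. 1 / norm k * (cmod (fourier L ?h k))\<^sup>2) \<le> ?C" if K: "finite K" "K \<subseteq> \<Gamma> - {0}" for K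
  proof -
    have "(\<Sum>k\<in>K. 1 / norm k * (cmod (fourier L ?h k))\<^sup>2)
        \<le> (4 + 2 / L\<^sup>2) * (H1_norm L (\<lambda>x. \<psi> x - \<eta> x))\<^sup>2 * (L2_norm L (\<lambda>x. \<psi> x + \<eta> x))\<^sup>2"
      by (rule product_negative_order_bound[OF H1_diff[OF H] L2_add[OF L2] K])
    also have "\<dots> \<le> (4 + 2 / L\<^sup>2) * (H1_norm L (\<lambda>x. \<psi> x - \<eta> x))\<^sup>2 * 4"
      using L2_norm_add_sq_le[OF L2] n1 by (intro mult_left_mono) auto
    also have "\<dots> = ?C" by (simp add: algebra_simps)
    finally show ?thesis .
  qed
  have "(\<Sum>k\<in>K. norm k * (cmod (fourier L (cplx (sigma_fun L \<psi>)) k - fourier L (cplx (sigma_fun L \<eta>)) k))\<^sup>2)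
      \<le> (\<Sum>k\<in>K. 1 / norm k * (cmod (fourier L ?h k))\<^sup>2 / 2 + 1 / norm (- k) * (cmod (fourier L ?h (- k)))\<^sup>2 / 2)"
  proof (rule sum_mono)
    fix k assume "k \<in> K"
    then have k: "k \<in> \<Gamma>" "k \<noteq> 0" using K by auto
    have "fourier L (cplx (sigma_fun L \<psi>)) k - fourier L (cplx (sigma_fun L \<eta>)) k
        = of_real (1 / norm k) * ((fourier L ?h k + cnj (fourier L ?h (- k))) / 2)"
      unfolding fourier_sigma[OF H(1) k(1)] fourier_sigma[OF H(2) k(1)] four[symmetric] right_diff_distrib
      using k by (simp add: inv_norm_def)
    then have "norm k * (cmod (fourier L (cplx (sigma_fun L \<psi>)) k - fourier L (cplx (sigma_fun L \<eta>)) k))\<^sup>2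
        = 1 / norm k * ((cmod (fourier L ?h k + cnj (fourier L ?h (- k))))\<^sup>2 / 4)"
      using k by (simp add: norm_mult norm_divide power_divide power2_eq_square)
    also have "\<dots> \<le> 1 / norm k * ((2 * (cmod (fourier L ?h k))\<^sup>2 + 2 * (cmod (cnj (fourier L ?h (- k))))\<^sup>2) / 4)"
      by (intro mult_left_mono divide_right_mono cmod_add_sq_le) auto
    also have "\<dots> = 1 / norm k * (cmod (fourier L ?h k))\<^sup>2 / 2 + 1 / norm (- k) * (cmod (fourier L ?h (- k)))\<^sup>2 / 2"
      unfolding norm_minus_cancel complex_mod_cnj by (simp add: add_divide_distrib distrib_left)
    finally show "norm k * (cmod (fourier L (cplx (sigma_fun L \<psi>)) k - fourier L (cplx (sigma_fun L \<eta>)) k))\<^sup>2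
      \<le> 1 / norm k * (cmod (fourier L ?h k))\<^sup>2 / 2 + 1 / norm (- k) * (cmod (fourier L ?h (- k)))\<^sup>2 / 2" .
  qed
  also have "\<dots> = (\<Sum>k\<in>K. 1 / norm k * (cmod (fourier L ?h k))\<^sup>2) / 2
      + (\<Sum>k\<in>uminus ` K. 1 / norm k * (cmod (fourier L ?h k))\<^sup>2) / 2"
    by (simp add: sum.reindex sum.distrib sum_divide_distrib)
  also have "\<dots> \<le> ?C / 2 + ?C / 2"
    using K by (intro add_mono divide_right_mono bound) auto
  also have "\<dots> = ?C" by (rule field_sum_of_halves)
  finally show ?thesis .
qed

text \<open>\<open>weighted_split\<close> in every nonzero mode, with \<open>u\<close> the
  difference between \<open>f\<close> and the field of \<open>\<eta>\<close> and \<open>d\<close>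
  the difference between the fields of \<open>\<psi>\<close> and \<open>\<eta>\<close>. The terms
  \<open>u - d\<close> add up to the squared distance of \<open>f\<close> from the field of
  \<open>\<psi>\<close>, the terms in \<open>d\<close> are controlled by
  \<open>density_diff_bound\<close>.\<close>

lemma weighted_form_bound:
  assumes \<psi>: "\<psi> \<in> states L" and \<eta>: "\<eta> \<in> states L" and f: "f \<in> L2 L"
    and \<kappa>: "0 < \<kappa>" "4 * (4 + 2 / L\<^sup>2) * \<kappa> \<le> \<kappa>\<^sub>1"
  shows "(\<Sum>\<^sub>\<infinity>k\<in>\<Gamma>. weight \<kappa> k * (cmod (fourier L (cplx f) k - fourier L (cplx (sigma_fun L \<eta>)) k))\<^sup>2)
    \<le> (L2_norm L (\<lambda>x. f x - sigma_fun L \<psi> x))\<^sup>2 + \<kappa>\<^sub>1 * (H1_norm L (\<lambda>x. \<psi> x - \<eta> x))\<^sup>2"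
proof (rule has_sum_le_finite_sums_real(2))
  have H: "\<psi> \<in> H1 L" "\<eta> \<in> H1 L" using \<psi> \<eta> by (auto simp: states_def)
  fix K assume K: "finite K" "K \<subseteq> \<Gamma>"
  let ?u = "\<lambda>k. fourier L (cplx f) k - fourier L (cplx (sigma_fun L \<eta>)) k"
  let ?d = "\<lambda>k. fourier L (cplx (sigma_fun L \<psi>)) k - fourier L (cplx (sigma_fun L \<eta>)) k"
  have ud: "?u k - ?d k = fourier L (cplx (\<lambda>x. f x - sigma_fun L \<psi> x)) k" for k
    using fourier_diff_real[OF f sigma_L2[OF H(1)]] by simp
  have "(\<Sum>k\<in>K. weight \<kappa> k * (cmod (?u k))\<^sup>2) \<le> (\<Sum>k\<in>K. (cmod (?u k - ?d k))\<^sup>2 + \<kappa> * (norm k * (cmod (?d k))\<^sup>2))"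
  proof (rule sum_mono)
    fix k assume k: "k \<in> K"
    show "weight \<kappa> k * (cmod (?u k))\<^sup>2 \<le> (cmod (?u k - ?d k))\<^sup>2 + \<kappa> * (norm k * (cmod (?d k))\<^sup>2)"
    proof (cases "k = 0")
      case True
      \<comment> \<open>Both fields have mean zero, so nothing is lost at \<open>k = 0\<close> and
        the full weight 1 is available.\<close>
      then have "?d k = 0" using fourier_sigma[OF H(1), of 0] fourier_sigma[OF H(2), of 0] by simp
      then show ?thesis using True by (simp add: weight_def)
    next
      case False
      then show ?thesis using weighted_split[of "\<kappa> * norm k" "?u k" "?d k"] \<kappa> by (simp add: weight_def mult.assoc)
    qed
  qed
  also have "\<dots> = (\<Sum>k\<in>K. (cmod (?u k - ?d k))\<^sup>2) + \<kappa> * (\<Sum>k\<in>K - {0}. norm k * (cmod (?d k))\<^sup>2)"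
    using K by (simp add: sum.distrib sum_distrib_left sum_diff1)
  also have "\<dots> \<le> (L2_norm L (\<lambda>x. f x - sigma_fun L \<psi> x))\<^sup>2 + \<kappa> * (4 * (4 + 2 / L\<^sup>2) * (H1_norm L (\<lambda>x. \<psi> x - \<eta> x))\<^sup>2)"
  proof (intro add_mono mult_left_mono density_diff_bound \<psi> \<eta>)
    have "cplx (\<lambda>x. f x - sigma_fun L \<psi> x) \<in> L2 L" unfolding L2_cplx_iff by (intro L2_diff f sigma_L2 H)
    from bessel[OF this K(2,1)]
    show "(\<Sum>k\<in>K. (cmod (?u k - ?d k))\<^sup>2) \<le> (L2_norm L (\<lambda>x. f x - sigma_fun L \<psi> x))\<^sup>2"
      unfolding ud L2_norm_cplx by simp
  qed (use K \<kappa> in auto)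
  also have "\<dots> \<le> (L2_norm L (\<lambda>x. f x - sigma_fun L \<psi> x))\<^sup>2 + \<kappa>\<^sub>1 * (H1_norm L (\<lambda>x. \<psi> x - \<eta> x))\<^sup>2"
    using mult_right_mono[OF \<kappa>(2), of "(H1_norm L (\<lambda>x. \<psi> x - \<eta> x))\<^sup>2"] by (simp add: mult_ac)
  finally show "(\<Sum>k\<in>K. weight \<kappa> k * (cmod (?u k))\<^sup>2)
    \<le> (L2_norm L (\<lambda>x. f x - sigma_fun L \<psi> x))\<^sup>2 + \<kappa>\<^sub>1 * (H1_norm L (\<lambda>x. \<psi> x - \<eta> x))\<^sup>2" .
qed (use weight_nonneg[OF \<kappa>(1)] in auto)

section \<open>Attainment of the minimum over translations\<close>

lemma continuous_periodic_attains_inf: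
  fixes q :: "real ^ 3 \<Rightarrow> real"
  assumes "continuous_on UNIV q" "periodic L q"
  obtains y where "\<And>z. q y \<le> q z"
proof -
  let ?B = "cbox (\<chi> i. - L / 2) (\<chi> i. L / 2) :: (real ^ 3) set"
  have "?B \<noteq> {}" using wrap_in_box by blast
  then obtain y where "\<And>z. z \<in> ?B \<Longrightarrow> q y \<le> q z"
    using continuous_attains_inf[OF compact_cbox, of _ _ q] assms(1) continuous_on_subset by blast
  then have "q y \<le> q z" for z using wrap_in_box[of z] periodic_wrap[OF assms(2), of z] by metis
  then show thesis using that by blast
qed

lemma fourier_diff_translate:
  assumes "f \<in> L2 L" "\<phi> \<in> L2 L" "k \<in> \<Gamma>"
  shows "fourier L (cplx (\<lambda>x. f x - translate y \<phi> x)) k = fourier L (cplx f) k - cis (- (k \<bullet> y)) * fourier L (cplx \<phi>) k"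
proof -
  have eq: "cplx (translate y \<phi>) = translate y (cplx \<phi>)" by (simp add: translate_def)
  have "cplx \<phi> \<in> L2 L" using assms(2) by simp
  then have "fourier L (cplx (translate y \<phi>)) k = cis (- (k \<bullet> y)) * fourier L (cplx \<phi>) k"
    unfolding eq by (intro fourier_translate L2D assms(3))
  moreover have "fourier L (cplx (\<lambda>x. f x - translate y \<phi> x)) k = fourier L (cplx f) k - fourier L (cplx (translate y \<phi>)) k"
    using fourier_diff_real[OF assms(1) L2_translate[OF assms(2)]] by simp
  ultimately show ?thesis by simp
qed

text \<open>As a function of the translation the form is periodic and continuous: its Fourier series
  has a summable majorant that does not depend on \<open>y\<close>. Compactness of the box yields
  the minimum.\<close>

lemma resolvent_form_attains_min:
  assumes f: "f \<in> L2 L" and \<phi>: "\<phi> \<in> L2 L" and \<kappa>: "0 < \<kappa>"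
  obtains y where "\<And>z. resolvent_form L \<kappa> (\<lambda>x. f x - translate y \<phi> x) \<le> resolvent_form L \<kappa> (\<lambda>x. f x - translate z \<phi> x)"
proof (rule continuous_periodic_attains_inf)
  let ?q = "\<lambda>y. resolvent_form L \<kappa> (\<lambda>x. f x - translate y \<phi> x)"
  show "periodic L ?q"
  proof (rule periodicI)
    fix y z assume "z \<in> cubic_lattice L"
    then have "\<phi> (x - (y + z)) = \<phi> (x - y)" for x
      using periodic_lattice[OF L2D(1)[OF \<phi>] cubic_lattice_minus, of z "x - y"] by (simp add: algebra_simps)
    then show "?q (y + z) = ?q y" by (simp add: translate_def)
  qed
  let ?t = "\<lambda>k y. \<kappa> * norm k / (1 + \<kappa> * norm k) * (cmod (fourier L (cplx f) k - cis (- (k \<bullet> y)) * fourier L (cplx \<phi>) k))\<^sup>2"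
  have "((\<lambda>k. ?t k y) has_sum ?q y) \<Gamma>" for y
    using resolvent_form_has_sum[OF L2_diff[OF f L2_translate[OF \<phi>]] \<kappa>, of y]
    by (rule has_sum_cong[THEN iffD1, rotated]) (simp only: fourier_diff_translate[OF f \<phi>])
  then have "uniform_limit UNIV (\<lambda>K y. \<Sum>k\<in>K. ?t k y) ?q (finite_subsets_at_top \<Gamma>)"
  proof (rule Weierstrass_m_test_general'[rotated])
    show "(\<lambda>k. 2 * (cmod (fourier L (cplx f) k))\<^sup>2 + 2 * (cmod (fourier L (cplx \<phi>) k))\<^sup>2) summable_on \<Gamma>"
      using f \<phi> by (intro summable_on_add summable_on_cmult_right fourier_sq_summable) simp_all
    fix k y :: "real ^ 3"
    have "0 \<le> \<kappa> * norm k / (1 + \<kappa> * norm k)" "\<kappa> * norm k / (1 + \<kappa> * norm k) \<le> 1"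
      using \<kappa> by (auto simp: divide_le_eq_1 add_pos_nonneg)
    moreover have "norm (t * s\<^sup>2) \<le> s\<^sup>2" if "0 \<le> t" "t \<le> 1" for t s :: real
      using that by (simp add: abs_mult mult_left_le_one_le)
    ultimately have "norm (?t k y) \<le> (cmod (fourier L (cplx f) k - cis (- (k \<bullet> y)) * fourier L (cplx \<phi>) k))\<^sup>2"
      by blast
    also have "\<dots> \<le> 2 * (cmod (fourier L (cplx f) k))\<^sup>2 + 2 * (cmod (fourier L (cplx \<phi>) k))\<^sup>2"
      using cmod_add_sq_le[of "fourier L (cplx f) k" "- (cis (- (k \<bullet> y)) * fourier L (cplx \<phi>) k)"] by (simp add: norm_mult)
    finally show "norm (?t k y) \<le> 2 * (cmod (fourier L (cplx f) k))\<^sup>2 + 2 * (cmod (fourier L (cplx \<phi>) k))\<^sup>2" .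
  qed
  then show "continuous_on UNIV ?q"
  proof (rule uniform_limit_theorem[rotated])
    have "1 + \<kappa> * norm k \<noteq> 0" for k :: "real ^ 3"
      using \<kappa> by (smt (verit) mult_nonneg_nonneg norm_ge_zero)
    then show "\<forall>\<^sub>F K in finite_subsets_at_top \<Gamma>. continuous_on UNIV (\<lambda>y. \<Sum>k\<in>K. ?t k y)"
      by (intro always_eventually allI continuous_intros) auto
  qed simp
qed (use that in blast)

end

section \<open>Smooth functions and rapidly decaying Fourier coefficients\<close>

context torus
begin

section \<open>Decay of the Fourier coefficients of smooth functions\<close>

lemma continuous_periodic_bounded:
  fixes f :: "real ^ 3 \<Rightarrow> 'b :: real_normed_vector"
  assumes "continuous_on UNIV f" "periodic L f"
  obtains B where "0 \<le> B" "\<And>x. norm (f x) \<le> B"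
proof -
  let ?B = "cbox (\<chi> i. - L / 2) (\<chi> i. L / 2) :: (real ^ 3) set"
  have "bounded (f ` ?B)"
    using assms(1) by (intro compact_imp_bounded compact_continuous_image compact_cbox) (auto intro: continuous_on_subset)
  then obtain B where B: "\<And>x. x \<in> ?B \<Longrightarrow> norm (f x) \<le> B" unfolding bounded_iff by blast
  have le: "norm (f x) \<le> B" for x
    using B[OF wrap_in_box[of x]] periodic_wrap[OF assms(2), of x] by simp
  then show thesis using that[of B] order_trans[OF norm_ge_zero le] by blast
qed

lemma continuous_periodic_L2:
  fixes f :: "real ^ 3 \<Rightarrow> 'b :: {banach, second_countable_topology}"
  assumes "continuous_on UNIV f" "periodic L f"
  shows "f \<in> L2 L"
proof -
  obtain B where "\<And>x. norm (f x) \<le> B" using continuous_periodic_bounded[OF assms] by blast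
  then show ?thesis using assms by (intro L2_bounded borel_measurable_continuous_onI)
qed

definition partial :: "3 \<Rightarrow> (real ^ 3 \<Rightarrow> real) \<Rightarrow> real ^ 3 \<Rightarrow> real" where
  "partial i f x = frechet_derivative f (at x) (axis i 1)"

lemma smooth_torusD:
  assumes "smooth_torus L f"
  shows "periodic L f" "\<And>x. f differentiable (at x)" "continuous_on UNIV f" "smooth_torus L (partial i f)"
proof -
  show p: "periodic L f" using assms by (simp add: smooth_torus_def)
  have "Ck 1 f" "Ck 0 f" using assms unfolding smooth_torus_def by blast+
  then show d: "f differentiable (at x)" for x
    by (auto simp: differentiable_on_def)
  show "continuous_on UNIV f" using \<open>Ck 0 f\<close> by simp
  have "Ck n (partial i f)" for n
  proof -
    have "Ck (Suc n) f" using assms unfolding smooth_torus_def by blast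
    then show ?thesis unfolding partial_def[abs_def] by simp
  qed
  moreover have "periodic L (partial i f)"
    unfolding periodic_def
  proof (intro allI)
    fix x :: "real ^ 3" and j :: 3
    let ?v = "L *\<^sub>R axis j 1 :: real ^ 3"
    have "(f has_derivative frechet_derivative f (at (x + ?v))) (at (x + ?v))"
      using d frechet_derivative_works by blast
    then have "((\<lambda>y. f (y + ?v)) has_derivative frechet_derivative f (at (x + ?v))) (at x)"
      by (intro has_derivative_compose[of "\<lambda>y. y + ?v" "\<lambda>h. h" x UNIV f, simplified] derivative_eq_intros) auto
    then have "(f has_derivative frechet_derivative f (at (x + ?v))) (at x)"
      using p by (simp add: periodic_def)
    then have "frechet_derivative f (at (x + ?v)) = frechet_derivative f (at x)"
      by (rule frechet_derivative_at)
    then show "partial i f (x + ?v) = partial i f x" by (simp add: partial_def)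
  qed
  ultimately show "smooth_torus L (partial i f)" by (simp add: smooth_torus_def)
qed

lemma has_real_derivative_line:
  assumes "f differentiable (at (x + s *\<^sub>R axis i 1))"
  shows "((\<lambda>s. f (x + s *\<^sub>R axis i 1)) has_real_derivative partial i f (x + s *\<^sub>R axis i 1)) (at s)"
proof -
  let ?D = "frechet_derivative f (at (x + s *\<^sub>R axis i 1))"
  have D: "(f has_derivative ?D) (at (x + s *\<^sub>R axis i 1))" using assms frechet_derivative_works by blast
  have "((\<lambda>s. x + s *\<^sub>R axis i 1) has_derivative (\<lambda>h. h *\<^sub>R axis i 1)) (at s)"
    by (auto intro!: derivative_eq_intros)
  from has_derivative_compose[OF this D]
  have "((\<lambda>s. f (x + s *\<^sub>R axis i 1)) has_derivative (\<lambda>h. ?D (h *\<^sub>R axis i 1))) (at s)" .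
  moreover have "?D (h *\<^sub>R axis i 1) = partial i f (x + s *\<^sub>R axis i 1) * h" for h
    using linear_scale[OF has_derivative_linear[OF D]] by (simp add: partial_def)
  ultimately show ?thesis by (simp add: has_field_derivative_def)
qed

text \<open>Passing to the limit in the Fourier coefficients of difference quotients.\<close>

lemma fourier_partial:
  assumes f: "smooth_torus L f" and k: "k \<in> \<Gamma>"
  shows "fourier L (cplx (partial i f)) k = \<i> * of_real (k $ i) * fourier L (cplx f) k"
proof -
  note f' = smooth_torusD[OF f] and partial' = smooth_torusD[OF smooth_torusD(4)[OF f, of i]]
  obtain B where B: "\<And>x. norm (partial i f x) \<le> B"
    using continuous_periodic_bounded[OF partial'(3,1)] by blast
  define t where "t n = 1 / real (Suc n)" for n
  have t: "0 < t n" for n by (simp add: t_def)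
  have t0: "t \<longlonglongrightarrow> 0" unfolding t_def by (rule LIMSEQ_Suc[OF lim_1_over_n])
  define e where "e = (axis i 1 :: real ^ 3)"
  define D where "D n x = (f (x + t n *\<^sub>R e) - f x) / t n" for n x
  \<comment> \<open>The mean value theorem bounds all difference quotients by the supremum of the
    partial derivative, which serves as the dominating constant.\<close>
  have D_bound: "\<bar>D n x\<bar> \<le> B" for n x
  proof -
    have "\<exists>z>0. z < t n \<and> f (x + t n *\<^sub>R e) - f (x + 0 *\<^sub>R e) = (t n - 0) * partial i f (x + z *\<^sub>R e)"
      unfolding e_def by (rule MVT2[OF t]) (rule has_real_derivative_line[OF f'(2)])
    then obtain z where "f (x + t n *\<^sub>R e) - f x = t n * partial i f (x + z *\<^sub>R e)" by auto
    then show ?thesis using t[of n] B[of "x + z *\<^sub>R e"] by (simp add: D_def)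
  qed
  have D_lim: "(\<lambda>n. D n x) \<longlonglongrightarrow> partial i f x" for x
  proof -
    have "((\<lambda>s. f (x + s *\<^sub>R e)) has_real_derivative partial i f (x + 0 *\<^sub>R e)) (at 0)"
      unfolding e_def by (rule has_real_derivative_line[OF f'(2)])
    then have "(\<lambda>h. (f (x + h *\<^sub>R e) - f x) / h) \<midarrow>0\<rightarrow> partial i f x" by (simp add: DERIV_def)
    moreover have "filterlim t (at 0) sequentially"
      using t0 t by (auto simp: filterlim_at less_le intro!: always_eventually)
    ultimately show ?thesis unfolding D_def by (rule filterlim_compose)
  qed
  have [measurable]: "f \<in> borel_measurable borel" "partial i f \<in> borel_measurable borel"
    using f'(3) partial'(3) by (auto intro: borel_measurable_continuous_onI)
  have fL2: "f \<in> L2 L" by (rule continuous_periodic_L2[OF f'(3,1)])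
  have "(\<lambda>n. fourier L (cplx (D n)) k) \<longlonglongrightarrow> fourier L (cplx (partial i f)) k"
    unfolding fourier_def
  proof (intro tendsto_mult tendsto_const, rule integral_dominated_convergence[where w = "\<lambda>_. B"])
    show "AE x in M. (\<lambda>n. cplx (D n) x * cis (- (k \<bullet> x))) \<longlonglongrightarrow> cplx (partial i f) x * cis (- (k \<bullet> x))"
      by (intro AE_I2 tendsto_mult tendsto_of_real D_lim tendsto_const)
    show "AE x in M. norm (cplx (D n) x * cis (- (k \<bullet> x))) \<le> B" for n
      using D_bound by (simp add: norm_mult)
    show "(\<lambda>x. cplx (D n) x * cis (- (k \<bullet> x))) \<in> borel_measurable M" for n
      unfolding D_def by measurable
    show "(\<lambda>x. cplx (partial i f) x * cis (- (k \<bullet> x))) \<in> borel_measurable M" by measurable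
  qed simp
  \<comment> \<open>A translation multiplies the coefficient by a phase, so the quotient of
    \<open>f\<close> turns into the difference quotient of
    \<open>s \<mapsto> cis (k $ i * s)\<close> at 0.\<close>
  moreover have "fourier L (cplx (D n)) k = (cis (k $ i * t n) - 1) / of_real (t n) * fourier L (cplx f) k" for n
  proof -
    have "cplx (D n) = (\<lambda>x. (1 / of_real (t n)) * (translate (- t n *\<^sub>R e) (cplx f) x - cplx f x))"
      by (simp add: D_def translate_def fun_eq_iff)
    moreover have "cplx f \<in> L2 L" using fL2 by simp
    moreover from this have "fourier L (translate (- t n *\<^sub>R e) (cplx f)) k = cis (k $ i * t n) * fourier L (cplx f) k"
      using fourier_translate[OF L2D(2,1) k, of "cplx f" "- t n *\<^sub>R e"] by (simp add: e_def inner_axis mult.commute)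
    ultimately have "fourier L (cplx (D n)) k = (1 / of_real (t n)) * (cis (k $ i * t n) * fourier L (cplx f) k - fourier L (cplx f) k)"
      by (simp only: fourier_cmult fourier_diff[OF L2_integrable[OF L2_translate] L2_integrable])
    then show ?thesis by (simp add: algebra_simps diff_divide_distrib)
  qed
  moreover have "(\<lambda>n. (cis (k $ i * t n) - 1) / of_real (t n) * fourier L (cplx f) k)
      \<longlonglongrightarrow> (\<i> * of_real (k $ i)) * fourier L (cplx f) k"
  proof (intro tendsto_mult tendsto_const)
    have "((\<lambda>z. exp (\<i> * of_real (k $ i) * z)) has_field_derivative (\<i> * of_real (k $ i))) (at 0)"
      by (auto intro!: derivative_eq_intros)
    then have "(\<lambda>h. (exp (\<i> * of_real (k $ i) * h) - 1) / h) \<midarrow>0\<rightarrow> \<i> * of_real (k $ i)"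
      by (simp add: DERIV_def)
    moreover have "filterlim (\<lambda>n. complex_of_real (t n)) (at 0) sequentially"
      using tendsto_of_real[OF t0, where 'a = complex] less_imp_neq[OF t]
      by (auto simp: filterlim_at intro!: always_eventually)
    ultimately have "(\<lambda>n. (exp (\<i> * of_real (k $ i) * of_real (t n)) - 1) / of_real (t n)) \<longlonglongrightarrow> \<i> * of_real (k $ i)"
      by (rule filterlim_compose)
    then show "(\<lambda>n. (cis (k $ i * t n) - 1) / of_real (t n)) \<longlonglongrightarrow> \<i> * of_real (k $ i)"
      by (simp add: cis_conv_exp mult.assoc)
  qed
  ultimately have "(\<lambda>n. fourier L (cplx (D n)) k) \<longlonglongrightarrow> (\<i> * of_real (k $ i)) * fourier L (cplx f) k"
    by (simp only:)
  with \<open>(\<lambda>n. fourier L (cplx (D n)) k) \<longlonglongrightarrow> fourier L (cplx (partial i f)) k\<close>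
  show ?thesis by (rule LIMSEQ_unique)
qed

text \<open>Each partial derivative multiplies the coefficients by \<open>k $ i\<close> up to a
  phase and is again square integrable.\<close>

lemma smooth_fourier_component_summable:
  assumes "smooth_torus L f"
  shows "(\<lambda>k. \<bar>k $ i\<bar> ^ (2 * n) * (cmod (fourier L (cplx f) k))\<^sup>2) summable_on \<Gamma>"
  using assms
proof (induction n arbitrary: f)
  case 0
  have "cplx f \<in> L2 L" using smooth_torusD[OF 0] by (simp add: continuous_periodic_L2)
  then show ?case using fourier_sq_summable by simp
next
  case (Suc n)
  have "(\<lambda>k. \<bar>k $ i\<bar> ^ (2 * n) * (cmod (fourier L (cplx (partial i f)) k))\<^sup>2) summable_on \<Gamma>"
    by (rule Suc.IH[OF smooth_torusD(4)[OF Suc.prems]])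
  then show ?case
    by (rule summable_on_cong[THEN iffD1, rotated])
      (simp add: fourier_partial[OF Suc.prems] norm_mult power_mult_distrib power2_eq_square)
qed

lemma smooth_fourier_summable:
  assumes "smooth_torus L f"
  shows "(\<lambda>k. ((1 + norm k) ^ n * cmod (fourier L (cplx f) k))\<^sup>2) summable_on \<Gamma>"
proof (rule summable_on_comparison_test)
  let ?c = "\<lambda>k. (cmod (fourier L (cplx f) k))\<^sup>2"
  have "cplx f \<in> L2 L" using smooth_torusD[OF assms] by (simp add: continuous_periodic_L2)
  then show "(\<lambda>k. 4 ^ (2 * n) * (?c k + (\<bar>k $ 1\<bar> ^ (2 * n) * ?c k + \<bar>k $ 2\<bar> ^ (2 * n) * ?c k + \<bar>k $ 3\<bar> ^ (2 * n) * ?c k))) summable_on \<Gamma>"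
    using smooth_fourier_component_summable[OF assms]
    by (intro summable_on_cmult_right summable_on_add fourier_sq_summable)
  fix k :: "real ^ 3"
  \<comment> \<open>The largest of 1 and the three coordinate moduli; four such terms bound
    \<open>1 + norm k\<close>, which explains the powers of 4.\<close>
  define s where "s = Max {1, \<bar>k $ 1\<bar>, \<bar>k $ 2\<bar>, \<bar>k $ 3\<bar>}"
  have "norm k \<le> \<bar>k $ 1\<bar> + \<bar>k $ 2\<bar> + \<bar>k $ 3\<bar>" using norm_le_l1_cart[of k] by (simp add: sum_3)
  moreover have "1 \<le> s" "\<bar>k $ 1\<bar> \<le> s" "\<bar>k $ 2\<bar> \<le> s" "\<bar>k $ 3\<bar> \<le> s" by (simp_all add: s_def le_max_iff_disj)
  ultimately have "1 + norm k \<le> 4 * s" by linarith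
  then have "(1 + norm k) ^ (2 * n) \<le> (4 * s) ^ (2 * n)" by (intro power_mono) auto
  also have "\<dots> = 4 ^ (2 * n) * s ^ (2 * n)" by (rule power_mult_distrib)
  also have "s ^ (2 * n) \<le> 1 + (\<bar>k $ 1\<bar> ^ (2 * n) + \<bar>k $ 2\<bar> ^ (2 * n) + \<bar>k $ 3\<bar> ^ (2 * n))"
  proof -
    have "s \<in> {1, \<bar>k $ 1\<bar>, \<bar>k $ 2\<bar>, \<bar>k $ 3\<bar>}" unfolding s_def by (rule Max_in) auto
    then consider "s = 1" | "s = \<bar>k $ 1\<bar>" | "s = \<bar>k $ 2\<bar>" | "s = \<bar>k $ 3\<bar>" by blast
    then have "s ^ (2 * n) = 1 \<or> s ^ (2 * n) = \<bar>k $ 1\<bar> ^ (2 * n) \<or> s ^ (2 * n) = \<bar>k $ 2\<bar> ^ (2 * n) \<or> s ^ (2 * n) = \<bar>k $ 3\<bar> ^ (2 * n)"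
      by cases simp_all
    moreover have nn: "0 \<le> \<bar>k $ i\<bar> ^ (2 * n)" for i by simp
    ultimately show ?thesis using nn[of 1] nn[of 2] nn[of 3] by linarith
  qed
  finally have "(1 + norm k) ^ (2 * n) * ?c k
      \<le> 4 ^ (2 * n) * (1 + (\<bar>k $ 1\<bar> ^ (2 * n) + \<bar>k $ 2\<bar> ^ (2 * n) + \<bar>k $ 3\<bar> ^ (2 * n))) * ?c k"
    by (intro mult_right_mono) auto
  then show "((1 + norm k) ^ n * cmod (fourier L (cplx f) k))\<^sup>2
      \<le> 4 ^ (2 * n) * (?c k + (\<bar>k $ 1\<bar> ^ (2 * n) * ?c k + \<bar>k $ 2\<bar> ^ (2 * n) * ?c k + \<bar>k $ 3\<bar> ^ (2 * n) * ?c k))"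
    unfolding power_mult_distrib power_even_eq[symmetric]
    by (simp only: distrib_left distrib_right mult_1 mult_1_right mult.assoc)
qed simp

text \<open>A bound for each power is convenient: symbols of linear growth cost one power, and four
  powers already give absolute summability.\<close>

definition rapid :: "(real ^ 3 \<Rightarrow> complex) \<Rightarrow> bool" where
  "rapid c \<longleftrightarrow> (\<forall>n. \<exists>C. \<forall>k\<in>\<Gamma>. (1 + norm k) ^ n * cmod (c k) \<le> C)"

text \<open>No Leibniz rule is needed: \<open>1 + norm k\<close> is at most the product of the
  weights at \<open>p\<close> and \<open>p - k\<close>, so the power \<open>n\<close> distributes
  over the convolution and Cauchy-Schwarz bounds each coefficient. The singleton index set brings
  this into the form of \<open>weighted_sum_le_from_finite\<close>.\<close>

lemma rapid_density:
  assumes f: "smooth_torus L f"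
  shows "rapid (fourier L (\<lambda>x. of_real ((cmod (cplx f x))\<^sup>2)))"
  unfolding rapid_def
proof
  fix n
  have fL2: "cplx f \<in> L2 L" using smooth_torusD[OF f] by (simp add: continuous_periodic_L2)
  let ?A = "\<lambda>p. ((1 + norm p) ^ n * cmod (fourier L (cplx f) p))\<^sup>2"
  obtain S where S: "(?A has_sum S) \<Gamma>" using smooth_fourier_summable[OF f, of n] unfolding summable_on_def by blast
  have S0: "0 \<le> S" by (rule has_sum_nonneg[OF S]) simp
  have "(1 + norm k) ^ n * cmod (fourier L (\<lambda>x. of_real ((cmod (cplx f x))\<^sup>2)) k) \<le> sqrt (1 / L ^ 3 * (S * S))"
    if k: "k \<in> \<Gamma>" for k
  proof -
    have "(\<Sum>k\<in>{k}. ((1 + norm k) ^ n)\<^sup>2 * (cmod (fourier L (\<lambda>x. cplx f x * cnj (cplx f x)) k))\<^sup>2) \<le> 1 / L ^ 3 * (S * S)"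
    proof (rule weighted_sum_le_from_finite[OF convolution[OF fL2 fL2]])
      fix P assume P: "finite P" "P \<subseteq> \<Gamma>"
      let ?s = "\<Sum>p\<in>P. fourier L (cplx f) p * cnj (fourier L (cplx f) (p - k))"
      have "(cmod (\<Sum>p\<in>P. of_real ((1 + norm k) ^ n) * (fourier L (cplx f) p * cnj (fourier L (cplx f) (p - k)))))\<^sup>2
          \<le> (\<Sum>p\<in>P. ?A p) * (\<Sum>p\<in>P. ?A (p - k))"
      proof (rule cmod_sum_mult_sq_le)
        fix p
        have "norm k \<le> norm p + norm (p - k)" using norm_triangle_ineq4[of p "p - k"] by simp
        moreover have "0 \<le> norm p * norm (p - k)" by simp
        ultimately have "1 + norm k \<le> (1 + norm p) * (1 + norm (p - k))" unfolding distrib_left distrib_right by linarith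
        then have "(1 + norm k) ^ n \<le> ((1 + norm p) * (1 + norm (p - k))) ^ n" by (intro power_mono) auto
        then have "(1 + norm k) ^ n * (cmod (fourier L (cplx f) p) * cmod (fourier L (cplx f) (p - k)))
            \<le> ((1 + norm p) * (1 + norm (p - k))) ^ n * (cmod (fourier L (cplx f) p) * cmod (fourier L (cplx f) (p - k)))"
          by (intro mult_right_mono) auto
        moreover have "cmod (of_real ((1 + norm k) ^ n)) = (1 + norm k) ^ n"
          unfolding norm_of_real by simp
        ultimately show "cmod (of_real ((1 + norm k) ^ n) * (fourier L (cplx f) p * cnj (fourier L (cplx f) (p - k))))
            \<le> (1 + norm p) ^ n * cmod (fourier L (cplx f) p) * ((1 + norm (p - k)) ^ n * cmod (fourier L (cplx f) (p - k)))"
          by (simp only: norm_mult complex_mod_cnj power_mult_distrib mult_ac)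
      qed
      also have "\<dots> \<le> S * S"
        using P k S0 by (intro mult_mono finite_sum_le_has_sum[OF S] shifted_sum_le(2)[OF S] sum_nonneg) auto
      finally have "1 / L ^ 3 * (cmod (of_real ((1 + norm k) ^ n) * ?s))\<^sup>2 \<le> 1 / L ^ 3 * (S * S)"
        using L_pos unfolding sum_distrib_left[symmetric] by (intro mult_left_mono) auto
      moreover have "cmod (of_real ((1 + norm k) ^ n)) = (1 + norm k) ^ n"
        unfolding norm_of_real by simp
      ultimately show "(\<Sum>k\<in>{k}. ((1 + norm k) ^ n)\<^sup>2 * (cmod (\<Sum>p\<in>P. wave_const * (fourier L (cplx f) p * cnj (fourier L (cplx f) (p - k)))))\<^sup>2) \<le> 1 / L ^ 3 * (S * S)"
        by (simp only: sum.insert sum.empty finite.emptyI empty_iff not_False_eq_True add_0_right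
            sum_distrib_left[symmetric] norm_mult power_mult_distrib cmod_wave_const_sq mult_ac)
    qed (use k in auto)
    then have "((1 + norm k) ^ n * cmod (fourier L (\<lambda>x. of_real ((cmod (cplx f x))\<^sup>2)) k))\<^sup>2 \<le> 1 / L ^ 3 * (S * S)"
      unfolding complex_norm_square[symmetric] of_real_power by (simp add: power_mult_distrib)
    then show ?thesis by (rule real_le_rsqrt)
  qed
  then show "\<exists>C. \<forall>k\<in>\<Gamma>. (1 + norm k) ^ n * cmod (fourier L (\<lambda>x. of_real ((cmod (cplx f x))\<^sup>2)) k) \<le> C" by blast
qed

text \<open>The growth of \<open>d\<close> is absorbed by using the bound for the power
  \<open>n + 1\<close>. It serves both the bounded symbol \<open>inv_norm\<close> and
  differentiation.\<close>

lemma rapid_mult: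
  assumes "rapid c" "\<And>k. k \<in> \<Gamma> \<Longrightarrow> cmod (d k) \<le> D * (1 + norm k)" "0 \<le> D"
  shows "rapid (\<lambda>k. d k * c k)"
  unfolding rapid_def
proof
  fix n
  obtain C where C: "\<And>k. k \<in> \<Gamma> \<Longrightarrow> (1 + norm k) ^ Suc n * cmod (c k) \<le> C" using assms(1) unfolding rapid_def by blast
  have "(1 + norm k) ^ n * cmod (d k * c k) \<le> D * C" if k: "k \<in> \<Gamma>" for k
  proof -
    have "(1 + norm k) ^ n * cmod (d k * c k) = ((1 + norm k) ^ n * cmod (c k)) * cmod (d k)" by (simp add: norm_mult mult_ac)
    also have "\<dots> \<le> ((1 + norm k) ^ n * cmod (c k)) * (D * (1 + norm k))"
      using assms(2)[OF k] by (intro mult_left_mono) auto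
    also have "\<dots> = D * ((1 + norm k) ^ Suc n * cmod (c k))" by (simp add: mult_ac)
    also have "\<dots> \<le> D * C" using C[OF k] assms(3) by (rule mult_left_mono)
    finally show ?thesis .
  qed
  then show "\<exists>C. \<forall>k\<in>\<Gamma>. (1 + norm k) ^ n * cmod (d k * c k) \<le> C" by blast
qed

section \<open>Smoothness of rapidly convergent Fourier series\<close>

definition lattice_enum :: "nat \<Rightarrow> real ^ 3" where "lattice_enum = from_nat_into \<Gamma>"

lemma lattice_enum_bij: "bij_betw lattice_enum UNIV \<Gamma>"
  unfolding lattice_enum_def using L_pos by (intro bij_betw_from_nat_into countable_cubic_lattice infinite_cubic_lattice) auto

lemma lattice_enum_in [simp]: "lattice_enum n \<in> \<Gamma>"
  using lattice_enum_bij by (auto simp: bij_betw_def)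

lemma rapid_summable:
  assumes "rapid c" shows "summable (\<lambda>n. cmod (c (lattice_enum n)))"
proof -
  obtain C where C: "\<And>k. k \<in> \<Gamma> \<Longrightarrow> (1 + norm k) ^ 4 * cmod (c k) \<le> C" using assms unfolding rapid_def by blast
  have "(\<lambda>k. C * (1 / (1 + norm k) ^ 4)) summable_on \<Gamma>" by (intro summable_on_cmult_right summable_inverse_norm_4)
  then have "(\<lambda>k. cmod (c k)) summable_on \<Gamma>"
  proof (rule summable_on_comparison_test)
    fix k assume k: "k \<in> \<Gamma>"
    have "0 < (1 + norm k) ^ 4" by (intro zero_less_power) (simp add: add_pos_nonneg)
    then show "cmod (c k) \<le> C * (1 / (1 + norm k) ^ 4)"
      using C[OF k] by (simp add: pos_le_divide_eq mult.commute)
  qed simp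
  then have "(\<lambda>n. cmod (c (lattice_enum n))) summable_on UNIV"
    using summable_on_reindex_bij_betw[OF lattice_enum_bij, of "\<lambda>k. cmod (c k)"] by simp
  then show ?thesis by (rule summable_on_imp_summable)
qed

text \<open>The Fourier series along a fixed enumeration, so that theorems on series of functions
  apply. Real parts are taken term by term; for Hermitian symmetric coefficients this does not
  change the sum.\<close>

definition real_series :: "(real ^ 3 \<Rightarrow> complex) \<Rightarrow> real ^ 3 \<Rightarrow> real" where
  "real_series c x = (\<Sum>n. Re (c (lattice_enum n) * wave_const * cis (lattice_enum n \<bullet> x)))"

lemma real_series_periodic: "periodic L (real_series c)"
  using periodic_cis[OF lattice_enum_in] unfolding periodic_def real_series_def by simp

lemma real_series_summable:
  assumes "rapid c" shows "summable (\<lambda>n. \<bar>Re (c (lattice_enum n) * wave_const * cis (lattice_enum n \<bullet> x))\<bar>)"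
proof (rule summable_comparison_test'[OF summable_mult[OF rapid_summable[OF assms], of "cmod wave_const"]])
  show "norm \<bar>Re (c (lattice_enum n) * wave_const * cis (lattice_enum n \<bullet> x))\<bar> \<le> cmod wave_const * cmod (c (lattice_enum n))" for n
    using abs_Re_le_cmod[of "c (lattice_enum n) * wave_const * cis (lattice_enum n \<bullet> x)"] by (simp add: norm_mult mult.commute)
qed

text \<open>Differentiation term by term: \<open>norm k * cmod (c k)\<close> is summable, hence the
  tails of the differentiated series are small relative to \<open>norm h\<close>, uniformly in
  \<open>x\<close>.\<close>

lemma real_series_has_derivative:
  assumes "rapid c"
  shows "(real_series c has_derivative (\<lambda>h. \<Sum>n. Re ((\<i> * of_real (lattice_enum n \<bullet> h) * c (lattice_enum n)) * wave_const * cis (lattice_enum n \<bullet> x)))) (at x)"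
proof -
  let ?f = "\<lambda>n x. Re (c (lattice_enum n) * wave_const * cis (lattice_enum n \<bullet> x))"
  let ?f' = "\<lambda>n x h. Re ((\<i> * of_real (lattice_enum n \<bullet> h) * c (lattice_enum n)) * wave_const * cis (lattice_enum n \<bullet> x))"
  let ?b = "\<lambda>n. cmod (of_real (norm (lattice_enum n)) * c (lattice_enum n)) * cmod wave_const"
  have "rapid (\<lambda>k. of_real (norm k) * c k)" by (rule rapid_mult[OF assms, of _ 1]) auto
  then have b: "summable ?b" using rapid_summable[of "\<lambda>k. of_real (norm k) * c k"] by (intro summable_mult2)
  have f'b: "\<bar>?f' n x h\<bar> \<le> ?b n * norm h" for n x h
  proof -
    have "\<bar>?f' n x h\<bar> \<le> cmod ((\<i> * of_real (lattice_enum n \<bullet> h) * c (lattice_enum n)) * wave_const * cis (lattice_enum n \<bullet> x))" by (rule abs_Re_le_cmod)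
    also have "\<dots> = \<bar>lattice_enum n \<bullet> h\<bar> * (cmod (c (lattice_enum n)) * cmod wave_const)" by (simp add: norm_mult)
    also have "\<dots> \<le> (norm (lattice_enum n) * norm h) * (cmod (c (lattice_enum n)) * cmod wave_const)"
      by (intro mult_right_mono Cauchy_Schwarz_ineq2) auto
    finally show ?thesis by (simp add: norm_mult mult_ac)
  qed
  have f's: "summable (\<lambda>n. \<bar>?f' n x h\<bar>)" for x h
    by (rule summable_comparison_test'[OF summable_mult2[OF b, of "norm h"]]) (use f'b in simp)
  have "\<exists>g. \<forall>x\<in>UNIV. (\<lambda>n. ?f n x) sums g x \<and> (g has_derivative (\<lambda>h. \<Sum>n. ?f' n x h)) (at x within UNIV)"
  proof (rule has_derivative_series[of UNIV ?f ?f' _ 0])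
    show "(?f n has_derivative ?f' n x) (at x within UNIV)" for n x
    proof -
      have "((\<lambda>x. cis (lattice_enum n \<bullet> x)) has_derivative (\<lambda>h. (lattice_enum n \<bullet> h) *\<^sub>R (\<i> * cis (lattice_enum n \<bullet> x)))) (at x)"
        by (intro has_derivative_cis derivative_intros)
      then have "(?f n has_derivative (\<lambda>h. Re (c (lattice_enum n) * wave_const * ((lattice_enum n \<bullet> h) *\<^sub>R (\<i> * cis (lattice_enum n \<bullet> x)))))) (at x)"
        by (intro has_derivative_Re has_derivative_mult_right)
      then show ?thesis by (rule has_derivative_eq_rhs) (simp add: fun_eq_iff scaleR_conv_of_real mult_ac)
    qed
    show "\<forall>\<^sub>F N in sequentially. \<forall>x\<in>UNIV. \<forall>h. norm ((\<Sum>n<N. ?f' n x h) - (\<Sum>n. ?f' n x h)) \<le> e * norm h"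
      if "e > 0" for e
    proof -
      obtain N where N: "\<And>n. n \<ge> N \<Longrightarrow> norm (\<Sum>i. ?b (i + n)) < e"
        using suminf_exist_split[OF \<open>e > 0\<close> b] by blast
      have "norm ((\<Sum>i<n. ?f' i x h) - (\<Sum>i. ?f' i x h)) \<le> e * norm h" if "n \<ge> N" for n x h
      proof -
        have "(\<Sum>i. ?f' i x h) = (\<Sum>i. ?f' (i + n) x h) + (\<Sum>i<n. ?f' i x h)"
          by (rule suminf_split_initial_segment[OF summable_rabs_cancel[OF f's]])
        then have "norm ((\<Sum>i<n. ?f' i x h) - (\<Sum>i. ?f' i x h)) = \<bar>\<Sum>i. ?f' (i + n) x h\<bar>" by simp
        also have "\<dots> \<le> (\<Sum>i. \<bar>?f' (i + n) x h\<bar>)"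
          using summable_ignore_initial_segment[OF f's] by (rule summable_rabs)
        also have "\<dots> \<le> (\<Sum>i. ?b (i + n) * norm h)"
          by (rule suminf_le[OF f'b summable_ignore_initial_segment[OF f's] summable_mult2[OF summable_ignore_initial_segment[OF b]]])
        also have "\<dots> = (\<Sum>i. ?b (i + n)) * norm h"
          by (rule suminf_mult2[symmetric, OF summable_ignore_initial_segment[OF b]])
        also have "\<dots> \<le> e * norm h" using N[OF that] by (intro mult_right_mono) auto
        finally show ?thesis .
      qed
      then show ?thesis unfolding eventually_sequentially by blast
    qed
    show "(\<lambda>n. ?f n 0) sums (\<Sum>n. ?f n 0)"
      using summable_rabs_cancel[OF real_series_summable[OF assms]] by (rule summable_sums)
  qed auto
  then obtain g where g: "\<And>x. (\<lambda>n. ?f n x) sums g x" "\<And>x. (g has_derivative (\<lambda>h. \<Sum>n. ?f' n x h)) (at x)" by auto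
  have "g = real_series c" using g(1) by (auto simp: real_series_def sums_iff)
  then show ?thesis using g(2) by blast
qed

lemma rapid_derivative: "rapid c \<Longrightarrow> rapid (\<lambda>k. \<i> * of_real (k $ i) * c k)"
  by (rule rapid_mult[where D = 1]) (auto simp: norm_mult intro: order_trans[OF component_le_norm_cart])

text \<open>A partial derivative of the series is a series of the same kind with coefficients
  \<open>\<i> * k $ i * c k\<close>, again rapidly decaying, so the induction runs over all
  \<open>c\<close>.\<close>

lemma Ck_real_series: "rapid c \<Longrightarrow> Ck n (real_series c)"
proof (induction n arbitrary: c)
  case 0
  have "continuous (at x) (real_series c)" for x
    by (rule has_derivative_continuous[OF real_series_has_derivative[OF 0]])
  then show ?case by (simp add: continuous_at_imp_continuous_on)
next
  case (Suc n)
  note D = real_series_has_derivative[OF Suc.prems]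
  have "(\<lambda>x. frechet_derivative (real_series c) (at x) (axis i 1)) = real_series (\<lambda>k. \<i> * of_real (k $ i) * c k)" for i
    using frechet_derivative_at[OF D, symmetric] by (simp add: fun_eq_iff real_series_def inner_axis)
  moreover have "real_series c differentiable_on UNIV"
    unfolding differentiable_on_def differentiable_def using D by blast
  ultimately show ?case using Suc.IH[OF rapid_derivative[OF Suc.prems]] by simp
qed

lemma smooth_real_series: "rapid c \<Longrightarrow> smooth_torus L (real_series c)"
  unfolding smooth_torus_def using real_series_periodic Ck_real_series by blast

text \<open>The real part of a plane wave has half its coefficient at \<open>k\<close> and the
  conjugate half at \<open>- k\<close>. Hermitian symmetry reunites the halves coming from the two
  terms, which are one and the same term for \<open>k = 0\<close>.\<close>

lemma fourier_real_series:
  assumes c: "rapid c" and sym: "\<And>k. k \<in> \<Gamma> \<Longrightarrow> c (- k) = cnj (c k)" and k: "k \<in> \<Gamma>"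
  shows "fourier L (cplx (real_series c)) k = c k"
proof -
  let ?f = "\<lambda>n x. complex_of_real (Re (c (lattice_enum n) * wave_const * cis (lattice_enum n \<bullet> x)))"
  let ?t = "\<lambda>n x. ?f n x * cis (- (k \<bullet> x))"
  have pw: "(\<lambda>x. c (lattice_enum n) * wave_const * cis (lattice_enum n \<bullet> x)) \<in> L2 L" for n by (rule L2_plane_wave) simp
  have fint: "integrable M (?f n)" for n by (rule integrable_of_real[OF integrable_Re[OF L2_integrable[OF pw]]])
  have bd: "norm (?t n x) \<le> cmod (c (lattice_enum n)) * cmod wave_const" for n x
  proof -
    have "norm (complex_of_real (Re z) * cis s) \<le> cmod z" for z s
      using abs_Re_le_cmod[of z] by (simp add: norm_mult)
    from this[of "c (lattice_enum n) * wave_const * cis (lattice_enum n \<bullet> x)"] show ?thesis by (simp only: norm_mult norm_cis mult_1_right)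
  qed
  have "(\<lambda>n. \<integral>x. ?t n x \<partial>M) sums (\<integral>x. (\<Sum>n. ?t n x) \<partial>M)"
  proof (rule sums_integral)
    show tint: "integrable M (?t n)" for n by (rule integrable_mult_cis_minus[OF fint])
    show "AE x in M. summable (\<lambda>n. norm (?t n x))"
      using real_series_summable[OF c] unfolding norm_mult[of "complex_of_real _"] norm_of_real norm_cis mult_1_right
      by (intro AE_I2)
    show "summable (\<lambda>n. \<integral>x. norm (?t n x) \<partial>M)"
    proof (rule summable_comparison_test'[OF summable_mult[OF summable_mult2[OF rapid_summable[OF c], of "cmod wave_const"], of "L ^ 3"]])
      fix n
      have "(\<integral>x. norm (?t n x) \<partial>M) \<le> (\<integral>x. cmod (c (lattice_enum n)) * cmod wave_const \<partial>M)"
        using integrable_norm[OF tint] bd by (intro integral_mono) auto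
      also have "\<dots> = L ^ 3 * (cmod (c (lattice_enum n)) * cmod wave_const)" using measure_M_space by simp
      finally show "norm (\<integral>x. norm (?t n x) \<partial>M) \<le> L ^ 3 * (cmod (c (lattice_enum n)) * cmod wave_const)"
        by simp
    qed
  qed
  moreover have "(\<Sum>n. ?t n x) = cplx (real_series c) x * cis (- (k \<bullet> x))" for x
  proof -
    have s: "summable (\<lambda>n. Re (c (lattice_enum n) * wave_const * cis (lattice_enum n \<bullet> x)))" by (rule summable_rabs_cancel[OF real_series_summable[OF c]])
    have "(\<lambda>n. ?f n x) sums cplx (real_series c) x"
      unfolding real_series_def by (rule sums_of_real[OF summable_sums[OF s]])
    then have "(\<lambda>n. ?t n x) sums (cplx (real_series c) x * cis (- (k \<bullet> x)))" by (rule sums_mult2)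
    then show ?thesis by (simp add: sums_iff)
  qed
  ultimately have "(\<lambda>n. \<integral>x. ?t n x \<partial>M) sums (\<integral>x. cplx (real_series c) x * cis (- (k \<bullet> x)) \<partial>M)" by simp
  then have "(\<lambda>n. fourier L (?f n) k) sums fourier L (cplx (real_series c)) k"
    unfolding fourier_def by (rule sums_mult)
  moreover have "fourier L (?f n) k = (if lattice_enum n = k then c k / 2 else 0) + (if lattice_enum n = - k then cnj (c (- k)) / 2 else 0)" for n
  proof -
    have "fourier L (\<lambda>x. c (lattice_enum n) * wave_const * cis (lattice_enum n \<bullet> x)) q = (if q = lattice_enum n then c q else 0)" if "q \<in> \<Gamma>" for q
      using fourier_plane_wave[OF that lattice_enum_in[of n]] by (simp add: fourier_cmult mult.assoc)
    then show ?thesis using k unfolding fourier_Re[OF L2_integrable[OF pw]] by auto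
  qed
  moreover have single: "(\<lambda>n. if lattice_enum n = q then z else 0) sums z" if q: "q \<in> \<Gamma>" for q and z :: complex
  proof -
    obtain N where N: "lattice_enum N = q" using q lattice_enum_bij by (metis bij_betw_imp_surj_on rangeE)
    have "lattice_enum n = q \<longleftrightarrow> n = N" for n using lattice_enum_bij N by (auto simp: bij_betw_def inj_def)
    then show ?thesis using sums_single[of N "\<lambda>_. z"] by simp
  qed
  ultimately have "(\<lambda>n. fourier L (?f n) k) sums fourier L (cplx (real_series c)) k"
    "(\<lambda>n. fourier L (?f n) k) sums (c k / 2 + cnj (c (- k)) / 2)"
    using sums_add[OF single[OF k, of "c k / 2"] single[of "- k" "cnj (c (- k)) / 2"]] k by simp_all
  then have "fourier L (cplx (real_series c)) k = c k / 2 + cnj (c (- k)) / 2" by (rule sums_unique2)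
  then show ?thesis using sym[OF k] by simp
qed

text \<open>\<open>sigma_fun\<close> is an arbitrary representative and need not be continuous; a
  smooth function with the same coefficients is supplied instead.\<close>

lemma smooth_sigma:
  assumes f: "smooth_torus L f"
  obtains \<phi> where "smooth_torus L \<phi>"
    "\<And>k. k \<in> \<Gamma> \<Longrightarrow> fourier L (cplx \<phi>) k = of_real (inv_norm k) * fourier L (\<lambda>x. of_real ((cmod (cplx f x))\<^sup>2)) k"
proof -
  let ?c = "\<lambda>k. of_real (inv_norm k) * fourier L (\<lambda>x. of_real ((cmod (cplx f x))\<^sup>2)) k"
  have r: "rapid ?c"
  proof (rule rapid_mult[OF rapid_density[OF f], of _ "1 / dual_spacing"])
    fix k assume k: "k \<in> \<Gamma>"
    have "inv_norm k \<le> 1 / dual_spacing"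
      unfolding inv_norm_def using dual_norm_ge[OF k] L_pos dual_spacing_pos frac_le[of 1 1 dual_spacing "norm k"] by auto
    also have "\<dots> \<le> 1 / dual_spacing * (1 + norm k)" using L_pos mult_left_mono[of 1 "1 + norm k" "1 / dual_spacing"] by simp
    finally show "cmod (of_real (inv_norm k)) \<le> 1 / dual_spacing * (1 + norm k)" using inv_norm_nonneg[of k] by simp
  qed (use L_pos in simp)
  show thesis
  proof (rule that[OF smooth_real_series[OF r]])
    have "?c (- k) = cnj (?c k)" for k
      using fourier_real[of "\<lambda>x. (cmod (cplx f x))\<^sup>2" k] by simp
    then show "k \<in> \<Gamma> \<Longrightarrow> fourier L (cplx (real_series ?c)) k = ?c k" for k
      by (intro fourier_real_series[OF r])
  qed
qed

end

section \<open>Minimizers\<close>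

text \<open>One fixed side length. The field is specified by smoothness and by its coefficients,
  which keeps its construction apart from its use and avoids the chosen representative
  \<open>sigma_fun\<close>.\<close>

locale pekar = torus +
  fixes \<psi>\<^sub>0 \<phi> :: "real ^ 3 \<Rightarrow> real" and \<kappa>\<^sub>1 :: real
  assumes kappa1_pos: "0 < \<kappa>\<^sub>1"
    and psi_pos: "\<And>x. 0 < \<psi>\<^sub>0 x"
    and psi_smooth: "smooth_torus L \<psi>\<^sub>0"
    and M_E_eq: "M_E L = Theta L (cplx \<psi>\<^sub>0)"
    and coercive: "\<And>f. f \<in> states L \<Longrightarrow> E_fun L f - e_min L \<ge> \<kappa>\<^sub>1 * (dist_H1 L (M_E L) f)\<^sup>2"
    and phi_smooth: "smooth_torus L \<phi>"
    and fourier_phi: "\<And>k. k \<in> dual_lattice L \<Longrightarrow>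
      fourier L (cplx \<phi>) k = of_real (inv_norm k) * fourier L (\<lambda>x. of_real ((cmod (cplx \<psi>\<^sub>0 x))\<^sup>2)) k"
begin

section \<open>Minimizing states and their fields\<close>

lemma psi_L2: "cplx \<psi>\<^sub>0 \<in> L2 L"
  using smooth_torusD[OF psi_smooth] by (simp add: continuous_periodic_L2)

lemma phi_L2: "\<phi> \<in> L2 L"
  using smooth_torusD[OF phi_smooth] by (simp add: continuous_periodic_L2)

lemma psi_translate_M_E: "translate y (cplx \<psi>\<^sub>0) \<in> M_E L"
proof -
  have "(0 :: real) \<in> {0..<2 * pi}" by simp
  moreover have "AE x in M. translate y (cplx \<psi>\<^sub>0) x = cis 0 * translate y (cplx \<psi>\<^sub>0) x" by simp
  ultimately show ?thesis unfolding M_E_eq Theta_def using L2_translate[OF psi_L2] by blast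
qed

lemma psi_M_E: "cplx \<psi>\<^sub>0 \<in> M_E L"
  using psi_translate_M_E[of 0] by (simp add: translate_def)

lemma M_E_D:
  assumes "\<eta> \<in> M_E L"
  shows "\<eta> \<in> states L" "\<eta> \<in> H1 L" "L2_norm L \<eta> = 1" "E_explicit \<eta> = e_min L"
  using assms E_fun_eq by (auto simp: M_E_def states_def)

text \<open>Read off from coercivity, whose right-hand side is nonnegative; this replaces a proof
  that the energy is bounded below over all pairs.\<close>

lemma e_min_le: "\<psi> \<in> states L \<Longrightarrow> e_min L \<le> E_explicit \<psi>"
  using coercive[of \<psi>] E_fun_eq[of \<psi>] kappa1_pos
  by (smt (verit) mem_Collect_eq states_def mult_nonneg_nonneg zero_le_power2)

text \<open>The phase drops out of the density, so the field of every minimizer is a translate of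
  \<open>\<phi>\<close>.\<close>

lemma M_E_density:
  assumes "\<eta> \<in> M_E L"
  obtains \<theta> y where "AE x in M. \<eta> x = cis \<theta> * translate y (cplx \<psi>\<^sub>0) x"
    "\<And>k. k \<in> \<Gamma> \<Longrightarrow> fourier L (\<lambda>x. of_real ((cmod (\<eta> x))\<^sup>2)) k
        = cis (- (k \<bullet> y)) * fourier L (\<lambda>x. of_real ((cmod (cplx \<psi>\<^sub>0 x))\<^sup>2)) k"
    "\<And>k. k \<in> \<Gamma> \<Longrightarrow> fourier L (cplx (sigma_fun L \<eta>)) k = cis (- (k \<bullet> y)) * fourier L (cplx \<phi>) k"
proof -
  obtain \<theta> y where AE: "AE x in M. \<eta> x = cis \<theta> * translate y (cplx \<psi>\<^sub>0) x"
    using assms unfolding M_E_eq Theta_def by blast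
  let ?\<rho> = "\<lambda>x. complex_of_real ((cmod (cplx \<psi>\<^sub>0 x))\<^sup>2)"
  have "(\<lambda>x. (cmod (cplx \<psi>\<^sub>0 x))\<^sup>2) \<in> L2 L" by (rule density_L2[OF M_E_D(2)[OF psi_M_E]])
  then have \<rho>: "?\<rho> \<in> L2 L" by (simp only: L2_cplx_iff)
  have \<eta>: "(\<lambda>x. complex_of_real ((cmod (\<eta> x))\<^sup>2)) \<in> L2 L"
    using density_L2[OF M_E_D(2)[OF assms]] by (simp only: L2_cplx_iff)
  have "AE x in M. complex_of_real ((cmod (\<eta> x))\<^sup>2) = translate y ?\<rho> x"
    using AE by eventually_elim (simp add: translate_def norm_mult)
  then have four: "fourier L (\<lambda>x. of_real ((cmod (\<eta> x))\<^sup>2)) k = cis (- (k \<bullet> y)) * fourier L ?\<rho> k" if "k \<in> \<Gamma>" for k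
    using fourier_cong_AE[OF L2D(2)[OF \<eta>] L2D(2)[OF L2_translate[OF \<rho>]]]
      fourier_translate[OF L2D(2,1)[OF \<rho>] that, of y] by simp
  have "fourier L (cplx (sigma_fun L \<eta>)) k = cis (- (k \<bullet> y)) * fourier L (cplx \<phi>) k" if "k \<in> \<Gamma>" for k
    using fourier_sigma[OF M_E_D(2)[OF assms] that] four[OF that] fourier_phi[OF that] by simp
  then show thesis using that AE four by blast
qed

lemma phi_sigma: "AE x in M. \<phi> x = sigma_fun L (cplx \<psi>\<^sub>0) x"
  by (rule L2_real_unique[OF phi_L2 sigma_L2[OF M_E_D(2)[OF psi_M_E]]])
    (simp only: fourier_phi fourier_sigma[OF M_E_D(2)[OF psi_M_E]])

section \<open>The lower bound for \<open>F_fun\<close> and its minimizers\<close>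

lemma F_fun_ge:
  assumes "f \<in> L2 L" "\<And>\<psi>. \<psi> \<in> states L \<Longrightarrow> c \<le> E_explicit \<psi> + (L2_norm L (\<lambda>x. f x - sigma_fun L \<psi> x))\<^sup>2"
  shows "c \<le> F_fun L f"
  unfolding F_fun_def
proof (rule cINF_greatest)
  show "states L \<noteq> {}" using M_E_D(1)[OF psi_M_E] by blast
  show "c \<le> G_fun L \<psi> f" if "\<psi> \<in> states L" for \<psi>
    using assms(2)[OF that] G_fun_eq[OF assms(1), of \<psi>] that by (simp add: states_def)
qed

lemma F_fun_le:
  assumes "f \<in> L2 L" "\<psi> \<in> states L"
  shows "F_fun L f \<le> E_explicit \<psi> + (L2_norm L (\<lambda>x. f x - sigma_fun L \<psi> x))\<^sup>2"
proof -
  have eq: "G_fun L \<eta> f = E_explicit \<eta> + (L2_norm L (\<lambda>x. f x - sigma_fun L \<eta> x))\<^sup>2" if "\<eta> \<in> states L" for \<eta>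
    using G_fun_eq[OF assms(1), of \<eta>] that by (simp add: states_def)
  have "bdd_below ((\<lambda>\<eta>. G_fun L \<eta> f) ` states L)"
    by (rule bdd_belowI2[where m = "e_min L"]) (use eq e_min_le in \<open>auto intro: add_increasing2\<close>)
  from cINF_lower[OF this assms(2)] show ?thesis using eq[OF assms(2)] by (simp add: F_fun_def)
qed

text \<open>Allows coercivity to be used through estimates valid for every minimizer, although the
  distance is an infimum not known to be attained. Roots are taken because it is an infimum of
  norms, not of squares, hence the separate case of nonpositive \<open>B\<close>.\<close>

lemma le_dist_H1_sq:
  assumes "\<And>\<eta>. \<eta> \<in> M_E L \<Longrightarrow> B \<le> \<kappa>\<^sub>1 * (H1_norm L (\<lambda>x. \<psi> x - \<eta> x))\<^sup>2"
  shows "B \<le> \<kappa>\<^sub>1 * (dist_H1 L (M_E L) \<psi>)\<^sup>2"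
proof (cases "B \<le> 0")
  case True
  then show ?thesis using kappa1_pos by (smt (verit) mult_nonneg_nonneg zero_le_power2)
next
  case False
  have "sqrt (B / \<kappa>\<^sub>1) \<le> dist_H1 L (M_E L) \<psi>"
    unfolding dist_H1_def
  proof (rule cINF_greatest)
    show "M_E L \<noteq> {}" using psi_M_E by blast
    fix \<eta> assume "\<eta> \<in> M_E L"
    then have "B / \<kappa>\<^sub>1 \<le> (H1_norm L (\<lambda>x. \<psi> x - \<eta> x))\<^sup>2"
      using assms kappa1_pos by (simp add: pos_divide_le_eq mult.commute)
    then show "sqrt (B / \<kappa>\<^sub>1) \<le> H1_norm L (\<lambda>x. \<psi> x - \<eta> x)"
      using H1_norm_nonneg by (simp add: real_le_lsqrt)
  qed
  then have "(sqrt (B / \<kappa>\<^sub>1))\<^sup>2 \<le> (dist_H1 L (M_E L) \<psi>)\<^sup>2"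
    using False kappa1_pos by (intro power_mono) auto
  then have "B / \<kappa>\<^sub>1 \<le> (dist_H1 L (M_E L) \<psi>)\<^sup>2" using False kappa1_pos by simp
  then show ?thesis using kappa1_pos by (simp add: pos_divide_le_eq mult.commute)
qed

text \<open>The coefficient of \<open>\<phi>\<close> at 0 vanishes, since
  \<open>inv_norm 0 = 0\<close>.\<close>

lemma mean_diff_translate:
  assumes "f \<in> L2 L"
  shows "(\<integral>x. f x - translate y \<phi> x \<partial>M) = (\<integral>x. f x \<partial>M)"
proof -
  have "fourier L (cplx (\<lambda>x. f x - translate y \<phi> x)) 0 = fourier L (cplx f) 0"
    using fourier_diff_translate[OF assms phi_L2, of 0 y] fourier_phi[of 0] by simp
  moreover have "L powr (- 3 / 2) \<noteq> 0" using L_pos by simp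
  ultimately show ?thesis unfolding fourier_0 by (metis mult_left_cancel of_real_eq_iff)
qed

text \<open>The optimal \<open>y\<close> is chosen before \<open>\<psi>\<close>. The field of any
  minimizer \<open>\<eta>\<close> is a translate of \<open>\<phi>\<close> by some \<open>z\<close>,
  and the form at \<open>y\<close> does not exceed the form at \<open>z\<close>; so one
  \<open>y\<close> serves all \<open>\<psi>\<close> in the infimum that defines
  \<open>F_fun\<close>.\<close>

lemma lower_bound:
  assumes f: "f \<in> L2 L" and \<kappa>: "0 < \<kappa>" "4 * (4 + 2 / L\<^sup>2) * \<kappa> \<le> \<kappa>\<^sub>1"
  obtains y where
    "\<And>z. resolvent_form L \<kappa> (\<lambda>x. f x - translate y \<phi> x) \<le> resolvent_form L \<kappa> (\<lambda>x. f x - translate z \<phi> x)"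
    "F_fun L f - e_min L \<ge> resolvent_form L \<kappa> (\<lambda>x. f x - translate y \<phi> x)
      + \<bar>L powr (- 3 / 2) * (\<integral>x. f x \<partial>M)\<bar>\<^sup>2"
proof -
  obtain y where y: "\<And>z. resolvent_form L \<kappa> (\<lambda>x. f x - translate y \<phi> x) \<le> resolvent_form L \<kappa> (\<lambda>x. f x - translate z \<phi> x)"
    by (rule resolvent_form_attains_min[OF f phi_L2 \<kappa>(1)]) blast
  let ?m = "resolvent_form L \<kappa> (\<lambda>x. f x - translate y \<phi> x) + \<bar>L powr (- 3 / 2) * (\<integral>x. f x \<partial>M)\<bar>\<^sup>2"
  have "e_min L + ?m \<le> F_fun L f"
  proof (rule F_fun_ge[OF f])
    fix \<psi> assume \<psi>: "\<psi> \<in> states L"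
    have "?m - (L2_norm L (\<lambda>x. f x - sigma_fun L \<psi> x))\<^sup>2 \<le> \<kappa>\<^sub>1 * (dist_H1 L (M_E L) \<psi>)\<^sup>2"
    proof (rule le_dist_H1_sq)
      fix \<eta> assume \<eta>: "\<eta> \<in> M_E L"
      obtain z where z: "\<And>k. k \<in> \<Gamma> \<Longrightarrow> fourier L (cplx (sigma_fun L \<eta>)) k = cis (- (k \<bullet> z)) * fourier L (cplx \<phi>) k"
        by (rule M_E_density[OF \<eta>]) blast
      have "?m \<le> resolvent_form L \<kappa> (\<lambda>x. f x - translate z \<phi> x) + \<bar>L powr (- 3 / 2) * (\<integral>x. f x - translate z \<phi> x \<partial>M)\<bar>\<^sup>2"
        using y[of z] by (simp add: mean_diff_translate[OF f])
      also have "\<dots> = (\<Sum>\<^sub>\<infinity>k\<in>\<Gamma>. weight \<kappa> k * (cmod (fourier L (cplx (\<lambda>x. f x - translate z \<phi> x)) k))\<^sup>2)"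
        by (rule infsumI[symmetric, OF weight_form_has_sum[OF L2_diff[OF f L2_translate[OF phi_L2]] \<kappa>(1)]])
      also have "\<dots> = (\<Sum>\<^sub>\<infinity>k\<in>\<Gamma>. weight \<kappa> k * (cmod (fourier L (cplx f) k - fourier L (cplx (sigma_fun L \<eta>)) k))\<^sup>2)"
        by (rule infsum_cong) (simp only: fourier_diff_translate[OF f phi_L2] z)
      also have "\<dots> \<le> (L2_norm L (\<lambda>x. f x - sigma_fun L \<psi> x))\<^sup>2 + \<kappa>\<^sub>1 * (H1_norm L (\<lambda>x. \<psi> x - \<eta> x))\<^sup>2"
        by (rule weighted_form_bound[OF \<psi> M_E_D(1)[OF \<eta>] f \<kappa>])
      finally show "?m - (L2_norm L (\<lambda>x. f x - sigma_fun L \<psi> x))\<^sup>2 \<le> \<kappa>\<^sub>1 * (H1_norm L (\<lambda>x. \<psi> x - \<eta> x))\<^sup>2"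
        by linarith
    qed
    moreover have "E_fun L \<psi> = E_explicit \<psi>" using \<psi> by (simp add: E_fun_eq states_def)
    ultimately show "e_min L + ?m \<le> E_explicit \<psi> + (L2_norm L (\<lambda>x. f x - sigma_fun L \<psi> x))\<^sup>2"
      using coercive[OF \<psi>] by linarith
  qed
  then show thesis using that[OF y] by linarith
qed

lemma exists_admissible_kappa: obtains \<kappa> where "0 < \<kappa>" "4 * (4 + 2 / L\<^sup>2) * \<kappa> \<le> \<kappa>\<^sub>1"
proof (rule that)
  have pos: "0 < 4 * (4 + 2 / L\<^sup>2)" by (simp add: add_pos_nonneg)
  show "0 < \<kappa>\<^sub>1 / (4 * (4 + 2 / L\<^sup>2))" using pos kappa1_pos by simp
  show "4 * (4 + 2 / L\<^sup>2) * (\<kappa>\<^sub>1 / (4 * (4 + 2 / L\<^sup>2))) \<le> \<kappa>\<^sub>1" using pos by simp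
qed

text \<open>The weight is positive in every mode, so a vanishing lower bound forces \<open>f\<close>
  to be a translate of \<open>\<phi>\<close>. Conversely such a translate is the field of the
  translated minimizer, which as a trial state gives the value \<open>e_min L\<close>.\<close>

lemma M_F_eq: "M_F L = Omega L \<phi>"
proof (intro equalityI subsetI)
  fix f assume "f \<in> M_F L"
  then have f: "f \<in> L2 L" "F_fun L f = e_min L" by (auto simp: M_F_def)
  obtain \<kappa> where \<kappa>: "0 < \<kappa>" "4 * (4 + 2 / L\<^sup>2) * \<kappa> \<le> \<kappa>\<^sub>1" by (rule exists_admissible_kappa)
  obtain y where y: "F_fun L f - e_min L \<ge> resolvent_form L \<kappa> (\<lambda>x. f x - translate y \<phi> x)
      + \<bar>L powr (- 3 / 2) * (\<integral>x. f x \<partial>M)\<bar>\<^sup>2"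
    by (rule lower_bound[OF f(1) \<kappa>]) blast
  let ?u = "\<lambda>x. f x - translate y \<phi> x"
  have hs: "((\<lambda>k. weight \<kappa> k * (cmod (fourier L (cplx ?u) k))\<^sup>2) has_sum
     (resolvent_form L \<kappa> ?u + \<bar>L powr (- 3 / 2) * (\<integral>x. f x \<partial>M)\<bar>\<^sup>2)) \<Gamma>"
    using weight_form_has_sum[OF L2_diff[OF f(1) L2_translate[OF phi_L2]] \<kappa>(1), of y] by (simp only: mean_diff_translate[OF f(1)])
  have zero: "weight \<kappa> k * (cmod (fourier L (cplx ?u) k))\<^sup>2 = 0" if "k \<in> \<Gamma>" for k
    using nonneg_has_sum_le_0D[OF hs] y f(2) that weight_nonneg[OF \<kappa>(1)] by simp
  have "fourier L (cplx ?u) k = 0" if "k \<in> \<Gamma>" for k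
  proof -
    have "weight \<kappa> k \<noteq> 0" using \<kappa>(1) by (simp add: weight_def add_nonneg_eq_0_iff)
    then show ?thesis using zero[OF that] by simp
  qed
  then have "fourier L (cplx f) k = fourier L (cplx (translate y \<phi>)) k" if "k \<in> \<Gamma>" for k
    using that fourier_diff_real[OF f(1) L2_translate[OF phi_L2]] by simp
  then have "AE x in M. f x = translate y \<phi> x"
    by (rule L2_real_unique[OF f(1) L2_translate[OF phi_L2]])
  then show "f \<in> Omega L \<phi>" using f(1) by (auto simp: Omega_def)
next
  fix f assume "f \<in> Omega L \<phi>"
  then obtain y where f: "f \<in> L2 L" and AE: "AE x in M. f x = translate y \<phi> x" by (auto simp: Omega_def)
  let ?\<eta> = "translate y (cplx \<psi>\<^sub>0)"
  note \<eta> = M_E_D[OF psi_translate_M_E[of y]]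
  have eq: "cplx (translate y g) = translate y (cplx g)" for g :: "real ^ 3 \<Rightarrow> real" by (simp add: translate_def)
  have \<rho>: "(\<lambda>x. complex_of_real ((cmod (cplx \<psi>\<^sub>0 x))\<^sup>2)) \<in> L2 L"
    using density_L2[OF M_E_D(2)[OF psi_M_E]] by (simp only: L2_cplx_iff)
  have phic: "cplx \<phi> \<in> L2 L" using phi_L2 by simp
  have "AE x in M. translate y \<phi> x = sigma_fun L ?\<eta> x"
  proof (rule L2_real_unique[OF L2_translate[OF phi_L2] sigma_L2[OF \<eta>(2)]])
    fix k assume k: "k \<in> \<Gamma>"
    have "(\<lambda>x. complex_of_real ((cmod (?\<eta> x))\<^sup>2)) = translate y (\<lambda>x. of_real ((cmod (cplx \<psi>\<^sub>0 x))\<^sup>2))"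
      by (simp add: translate_def)
    then show "fourier L (cplx (translate y \<phi>)) k = fourier L (cplx (sigma_fun L ?\<eta>)) k"
      unfolding eq fourier_translate[OF L2D(2,1)[OF phic] k] fourier_sigma[OF \<eta>(2) k]
      using fourier_translate[OF L2D(2,1)[OF \<rho>] k, of y] fourier_phi[OF k] by simp
  qed
  with AE have "AE x in M. f x - sigma_fun L ?\<eta> x = 0" by eventually_elim simp
  then have "AE x in M. (norm (f x - sigma_fun L ?\<eta> x))\<^sup>2 = 0" by eventually_elim simp
  then have "(L2_norm L (\<lambda>x. f x - sigma_fun L ?\<eta> x))\<^sup>2 = 0"
    unfolding L2_norm_sq by (rule integral_eq_zero_AE)
  then have "F_fun L f \<le> e_min L" using F_fun_le[OF f \<eta>(1)] \<eta>(4) by simp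
  moreover have "e_min L \<le> F_fun L f"
    by (rule F_fun_ge[OF f]) (use e_min_le in \<open>auto intro: add_increasing2\<close>)
  ultimately show "f \<in> M_F L" using f by (simp add: M_F_def)
qed

text \<open>Comparison of symbols: with \<open>t = \<kappa>' * (2 * pi / L)\<^sup>2\<close> the
  assumption on \<open>\<kappa>'\<close> and the spectral gap give
  \<open>t \<le> \<kappa> * norm k\<close>, and \<open>t / (1 + t)\<close> is increasing and below
  the weight 1 of the zero mode.\<close>

lemma dist_bound:
  assumes f: "f \<in> L2 L" and \<kappa>: "0 < \<kappa>" "4 * (4 + 2 / L\<^sup>2) * \<kappa> \<le> \<kappa>\<^sub>1"
    and \<kappa>': "0 < \<kappa>'" "\<kappa>' * dual_spacing \<le> \<kappa>"
  shows "F_fun L f - e_min L \<ge> tau L \<kappa>' * (dist_L2 L (M_F L) f)\<^sup>2"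
proof -
  obtain y where y: "F_fun L f - e_min L \<ge> resolvent_form L \<kappa> (\<lambda>x. f x - translate y \<phi> x)
      + \<bar>L powr (- 3 / 2) * (\<integral>x. f x \<partial>M)\<bar>\<^sup>2"
    by (rule lower_bound[OF f \<kappa>]) blast
  let ?u = "\<lambda>x. f x - translate y \<phi> x"
  have u: "?u \<in> L2 L" by (intro L2_diff f L2_translate phi_L2)
  define t where "t = \<kappa>' * dual_spacing\<^sup>2"
  have t: "0 < t" using \<kappa>'(1) dual_spacing_pos by (simp only: t_def zero_less_power mult_pos_pos)
  have tau: "tau L \<kappa>' = t / (1 + t)" by (simp add: tau_def t_def)
  have mono: "t / (1 + t) \<le> s / (1 + s)" if "t \<le> s" for s
    using t that by (simp add: field_simps)
  have tau_le: "tau L \<kappa>' \<le> weight \<kappa> k" if k: "k \<in> \<Gamma>" for k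
  proof (cases "k = 0")
    case True
    then show ?thesis using t by (simp add: tau weight_def)
  next
    case False
    have "t = (\<kappa>' * dual_spacing) * dual_spacing" by (simp add: t_def power2_eq_square)
    also have "\<dots> \<le> \<kappa> * norm k"
      using \<kappa>' \<kappa> dual_norm_ge[OF k False] less_imp_le[OF dual_spacing_pos] by (intro mult_mono) auto
    finally show ?thesis using mono False by (simp add: tau weight_def)
  qed
  have "cplx ?u \<in> L2 L" using u by (simp only: L2_cplx_iff)
  from has_sum_cmult_right[OF parseval[OF this], of "tau L \<kappa>'"] have hs1: "((\<lambda>k. tau L \<kappa>' * (cmod (fourier L (cplx ?u) k))\<^sup>2) has_sum tau L \<kappa>' * (L2_norm L ?u)\<^sup>2) \<Gamma>"
    by (simp only: L2_norm_cplx)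
  have "tau L \<kappa>' * (L2_norm L ?u)\<^sup>2 \<le> resolvent_form L \<kappa> ?u + \<bar>L powr (- 3 / 2) * (\<integral>x. ?u x \<partial>M)\<bar>\<^sup>2"
    by (rule has_sum_mono[OF hs1 weight_form_has_sum[OF u \<kappa>(1)]]) (use tau_le in \<open>auto intro: mult_right_mono\<close>)
  then have le: "tau L \<kappa>' * (L2_norm L ?u)\<^sup>2 \<le> F_fun L f - e_min L"
    using y by (simp only: mean_diff_translate[OF f])
  have mem: "translate y \<phi> \<in> M_F L"
    unfolding M_F_eq Omega_def using L2_translate[OF phi_L2] by blast
  have "dist_L2 L (M_F L) f \<le> L2_norm L ?u"
    unfolding dist_L2_def by (rule cINF_lower[OF bdd_belowI2[where m = 0] mem]) simp
  moreover have "0 \<le> dist_L2 L (M_F L) f"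
    unfolding dist_L2_def by (rule cINF_greatest) (use mem in auto)
  ultimately have "(dist_L2 L (M_F L) f)\<^sup>2 \<le> (L2_norm L ?u)\<^sup>2" by (intro power_mono)
  then have "tau L \<kappa>' * (dist_L2 L (M_F L) f)\<^sup>2 \<le> tau L \<kappa>' * (L2_norm L ?u)\<^sup>2"
    using t by (intro mult_left_mono) (auto simp: tau)
  then show ?thesis using le by linarith
qed

section \<open>Ground states of the operator with the field \<open>\<phi>\<close>\<close>

abbreviation "V \<equiv> V_pot L \<phi>"

text \<open>The lowest eigenvalue: at the minimizing pair the total energy is
  \<open>e_min L\<close>, of which the field carries its squared norm.\<close>

definition ground_energy :: real where "ground_energy = e_min L - (L2_norm L \<phi>)\<^sup>2"

text \<open>The operator gains one derivative; consequently \<open>V\<close> times an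
  \<open>H1\<close> function is square integrable by \<open>H1_product_L2\<close>.\<close>

lemma V_H1: "cplx V \<in> H1 L"
proof (rule H1I)
  have "(\<lambda>x. (- 2) * lap_inv_pow L (1 / 2) \<phi> x) \<in> L2 L" by (intro L2_cmult lap_inv_half_L2 phi_L2)
  then show V: "cplx V \<in> L2 L" unfolding L2_cplx_iff by (simp add: V_pot_def)
  have "cplx \<phi> \<in> L2 L" using phi_L2 by simp
  then have "(\<lambda>k. 4 * (cmod (fourier L (cplx \<phi>) k))\<^sup>2) summable_on \<Gamma>"
    by (intro summable_on_cmult_right fourier_sq_summable)
  then show "(\<lambda>k. (norm k)\<^sup>2 * (cmod (fourier L (cplx V) k))\<^sup>2) summable_on \<Gamma>"
  proof (rule summable_on_comparison_test)
    fix k assume k: "k \<in> \<Gamma>"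
    have "cplx V = (\<lambda>x. (- 2) * cplx (lap_inv_pow L (1 / 2) \<phi>) x)" by (simp add: V_pot_def)
    then have "fourier L (cplx V) k = (- 2) * (of_real (inv_norm k) * fourier L (cplx \<phi>) k)"
      by (simp only: fourier_cmult fourier_lap_inv_half[OF phi_L2 k])
    then have "cmod (fourier L (cplx V) k) = 2 * (inv_norm k * cmod (fourier L (cplx \<phi>) k))"
      using inv_norm_nonneg[of k] by (simp add: norm_mult)
    then show "(norm k)\<^sup>2 * (cmod (fourier L (cplx V) k))\<^sup>2 \<le> 4 * (cmod (fourier L (cplx \<phi>) k))\<^sup>2"
      by (simp add: inv_norm_def power_mult_distrib power_divide)
  qed simp
qed

lemma V_mult_L2: "\<eta> \<in> H1 L \<Longrightarrow> (\<lambda>x. of_real (V x) * \<eta> x) \<in> L2 L"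
  using H1_product_L2[OF _ V_H1, of \<eta>] by (simp add: mult.commute)

lemma V_L2: "V \<in> L2 L"
  using H1D(1)[OF V_H1] by simp

lemma potential_integral:
  assumes "\<eta> \<in> H1 L"
  shows "(\<integral>x. of_real (V x) * \<eta> x * cnj (\<eta> x) \<partial>M) = of_real (\<integral>x. V x * (cmod (\<eta> x))\<^sup>2 \<partial>M)"
proof -
  have "of_real (V x) * \<eta> x * cnj (\<eta> x) = of_real (V x * (cmod (\<eta> x))\<^sup>2)" for x
    using complex_norm_square[of "\<eta> x"] by (simp add: mult.assoc)
  then show ?thesis by (simp del: of_real_mult)
qed

text \<open>Tests the equation with \<open>\<eta>\<close> itself: multiply by the conjugate
  coefficients and sum, using Parseval for the potential term.\<close>

lemma h_form_eigen:
  assumes "h_eigenfunction L \<phi> E \<eta>"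
  shows "h_form L \<phi> \<eta> = E * (L2_norm L \<eta>)\<^sup>2"
proof -
  have \<eta>: "\<eta> \<in> H1 L" and eq: "\<And>k. k \<in> \<Gamma> \<Longrightarrow> of_real ((norm k)\<^sup>2) * fourier L \<eta> k
      + fourier L (\<lambda>x. of_real (V x) * \<eta> x) k = of_real E * fourier L \<eta> k"
    using assms unfolding h_eigenfunction_def by auto
  have term_eq: "of_real ((norm k)\<^sup>2 * (cmod (fourier L \<eta> k))\<^sup>2) + fourier L (\<lambda>x. of_real (V x) * \<eta> x) k * cnj (fourier L \<eta> k)
      = complex_of_real (E * (cmod (fourier L \<eta> k))\<^sup>2)" if k: "k \<in> \<Gamma>" for k
  proof -
    have "of_real ((norm k)\<^sup>2 * (cmod (fourier L \<eta> k))\<^sup>2) + fourier L (\<lambda>x. of_real (V x) * \<eta> x) k * cnj (fourier L \<eta> k)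
        = (of_real ((norm k)\<^sup>2) * fourier L \<eta> k + fourier L (\<lambda>x. of_real (V x) * \<eta> x) k) * cnj (fourier L \<eta> k)"
      using complex_norm_square[of "fourier L \<eta> k"] by (simp add: algebra_simps)
    also have "\<dots> = of_real (E * (cmod (fourier L \<eta> k))\<^sup>2)"
      unfolding eq[OF k] using complex_norm_square[of "fourier L \<eta> k"] by (simp add: algebra_simps)
    finally show "of_real ((norm k)\<^sup>2 * (cmod (fourier L \<eta> k))\<^sup>2) + fourier L (\<lambda>x. of_real (V x) * \<eta> x) k * cnj (fourier L \<eta> k)
        = complex_of_real (E * (cmod (fourier L \<eta> k))\<^sup>2)" .
  qed
  have "((\<lambda>k. of_real ((norm k)\<^sup>2 * (cmod (fourier L \<eta> k))\<^sup>2)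
      + fourier L (\<lambda>x. of_real (V x) * \<eta> x) k * cnj (fourier L \<eta> k)) has_sum
      (of_real (kinetic L \<eta>) + of_real (\<integral>x. V x * (cmod (\<eta> x))\<^sup>2 \<partial>M))) \<Gamma>"
    unfolding potential_integral[OF \<eta>, symmetric]
    by (intro has_sum_add has_sum_of_real H1D(2)[OF \<eta>] parseval_inner[OF V_mult_L2[OF \<eta>] H1D(1)[OF \<eta>]])
  then have "((\<lambda>k. complex_of_real (E * (cmod (fourier L \<eta> k))\<^sup>2)) has_sum of_real (h_form L \<phi> \<eta>)) \<Gamma>"
    unfolding h_form_def of_real_add by (rule has_sum_cong[THEN iffD1, rotated]) (simp only: term_eq)
  then have "((\<lambda>k. E * (cmod (fourier L \<eta> k))\<^sup>2) has_sum h_form L \<phi> \<eta>) \<Gamma>" by (simp only: has_sum_of_real_iff)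
  moreover have "((\<lambda>k. E * (cmod (fourier L \<eta> k))\<^sup>2) has_sum E * (L2_norm L \<eta>)\<^sup>2) \<Gamma>"
    by (rule has_sum_cmult_right[OF parseval[OF H1D(1)[OF \<eta>]]])
  ultimately show ?thesis by (rule has_sum_unique)
qed

lemma h_form_eq:
  assumes "\<eta> \<in> H1 L"
  shows "h_form L \<phi> \<eta> = E_explicit \<eta> + (L2_norm L (\<lambda>x. \<phi> x - sigma_fun L \<eta> x))\<^sup>2 - (L2_norm L \<phi>)\<^sup>2"
  using G_fun_eq[OF phi_L2 assms] by (simp add: G_fun_def)

lemma h_form_psi: "h_form L \<phi> (cplx \<psi>\<^sub>0) = ground_energy"
proof -
  have "AE x in M. (norm (\<phi> x - sigma_fun L (cplx \<psi>\<^sub>0) x))\<^sup>2 = 0" using phi_sigma by eventually_elim simp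
  then have "(L2_norm L (\<lambda>x. \<phi> x - sigma_fun L (cplx \<psi>\<^sub>0) x))\<^sup>2 = 0"
    unfolding L2_norm_sq by (rule integral_eq_zero_AE)
  then show ?thesis using h_form_eq[OF M_E_D(2)[OF psi_M_E]] M_E_D(4)[OF psi_M_E] by (simp add: ground_energy_def)
qed

lemma kinetic_cmult: "kinetic L (\<lambda>x. c * f x) = (cmod c)\<^sup>2 * kinetic L f"
  unfolding kinetic_def fourier_cmult infsum_cmult_right'[symmetric]
  by (intro infsum_cong) (simp add: norm_mult power_mult_distrib mult_ac)

lemma h_form_cmult: "h_form L \<phi> (\<lambda>x. c * f x) = (cmod c)\<^sup>2 * h_form L \<phi> f"
proof -
  have "(\<integral>x. V x * (cmod (c * f x))\<^sup>2 \<partial>M) = (\<integral>x. (cmod c)\<^sup>2 * (V x * (cmod (f x))\<^sup>2) \<partial>M)"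
    by (intro Bochner_Integration.integral_cong) (simp_all add: norm_mult power_mult_distrib)
  then show ?thesis by (simp add: h_form_def kinetic_cmult distrib_left)
qed

text \<open>For a normalized state, adding the squared norm of \<open>\<phi>\<close> to the form
  gives a value of \<open>G_fun\<close>, hence at least \<open>e_min L\<close>; the rest is scaling.
  Functions of norm zero cannot be normalized and are treated apart.\<close>

lemma h_form_ge:
  assumes "\<eta> \<in> H1 L" shows "ground_energy * (L2_norm L \<eta>)\<^sup>2 \<le> h_form L \<phi> \<eta>"
proof (cases "L2_norm L \<eta> = 0")
  case True
  note L2 = H1D(1)[OF assms]
  have "(\<integral>x. (cmod (\<eta> x))\<^sup>2 \<partial>M) = 0" using True L2_norm_sq[of \<eta>] by simp
  then have "AE x in M. (cmod (\<eta> x))\<^sup>2 = 0"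
    using integral_nonneg_eq_0_iff_AE[OF L2D(3)[OF L2]] by simp
  then have "AE x in M. V x * (cmod (\<eta> x))\<^sup>2 = 0" by eventually_elim simp
  then have "(\<integral>x. V x * (cmod (\<eta> x))\<^sup>2 \<partial>M) = 0" by (rule integral_eq_zero_AE)
  then show ?thesis using H1D(4)[OF assms] True by (simp add: h_form_def)
next
  case False
  define n where "n = L2_norm L \<eta>"
  have n: "0 < n" using False L2_norm_nonneg[of \<eta>] unfolding n_def by linarith
  let ?\<xi> = "\<lambda>x. of_real (1 / n) * \<eta> x"
  have \<xi>: "?\<xi> \<in> H1 L" by (rule H1_cmult[OF assms])
  have "(L2_norm L ?\<xi>)\<^sup>2 = (1 / n)\<^sup>2 * (L2_norm L \<eta>)\<^sup>2"
    unfolding L2_norm_sq using n by (simp add: norm_mult norm_divide power_mult_distrib power_divide)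
  then have "(L2_norm L ?\<xi>)\<^sup>2 = 1" using n by (simp add: n_def[symmetric] power_divide)
  then have "L2_norm L ?\<xi> = 1" using L2_norm_nonneg[of ?\<xi>] unfolding power2_eq_1_iff by linarith
  then have "?\<xi> \<in> states L" using \<xi> by (simp add: states_def)
  then have "ground_energy \<le> h_form L \<phi> ?\<xi>"
    using e_min_le[of ?\<xi>] h_form_eq[OF \<xi>] by (simp add: ground_energy_def add_increasing2)
  also have "\<dots> = (1 / n)\<^sup>2 * h_form L \<phi> \<eta>" unfolding h_form_cmult using n by (simp add: norm_divide)
  finally show ?thesis using n by (simp add: n_def[symmetric] power_divide pos_le_divide_eq)
qed

text \<open>Perturb \<open>\<psi>\<^sub>0\<close> by \<open>z\<close> times one plane wave. The form
  minus \<open>ground_energy\<close> times the squared norm is a nonnegative quadratic polynomial in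
  \<open>z\<close> that vanishes at 0, so its linear coefficient \<open>X\<close> is zero;
  \<open>D\<close> is the quadratic one.\<close>

lemma euler_lagrange:
  assumes l: "l \<in> \<Gamma>"
  shows "of_real ((norm l)\<^sup>2) * fourier L (cplx \<psi>\<^sub>0) l + fourier L (\<lambda>x. of_real (V x) * cplx \<psi>\<^sub>0 x) l
    = of_real ground_energy * fourier L (cplx \<psi>\<^sub>0) l" (is "_ = _ * ?p")
proof -
  note H = M_E_D(2)[OF psi_M_E] and L2 = psi_L2
  let ?U = "fourier L (\<lambda>x. of_real (V x) * cplx \<psi>\<^sub>0 x) l"
  define X where "X = of_real ((norm l)\<^sup>2) * ?p + ?U - of_real ground_energy * ?p"
  define D where "D = (norm l)\<^sup>2 + (\<integral>x. V x * (cmod wave_const)\<^sup>2 \<partial>M) - ground_energy"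
  have key: "0 \<le> 2 * Re (X * cnj z) + (cmod z)\<^sup>2 * D" for z
  proof -
    let ?e = "\<lambda>x. z * (wave_const * cis (l \<bullet> x))"
    let ?\<eta> = "\<lambda>x. cplx \<psi>\<^sub>0 x + ?e x"
    have wL2: "(\<lambda>x. wave_const * cis (l \<bullet> x)) \<in> L2 L" by (rule L2_plane_wave[OF l])
    have eL2: "?e \<in> L2 L" by (rule L2_cmult[OF wL2])
    have e_four: "fourier L ?e k = (if k = l then z else 0)" if "k \<in> \<Gamma>" for k
      unfolding fourier_cmult[of z] fourier_plane_wave[OF that l] by simp
    have \<eta>_four: "fourier L ?\<eta> k = fourier L (cplx \<psi>\<^sub>0) k + (if k = l then z else 0)" if "k \<in> \<Gamma>" for k
      using fourier_add[OF L2_integrable[OF L2] L2_integrable[OF eL2], of k] e_four[OF that] by (simp only:)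
    have eH: "?e \<in> H1 L"
    proof (rule H1I[OF eL2])
      show "(\<lambda>k. (norm k)\<^sup>2 * (cmod (fourier L ?e k))\<^sup>2) summable_on \<Gamma>"
        by (rule has_sum_imp_summable[OF has_sum_finite_neutralI[of "{l}" _ _ "(norm l)\<^sup>2 * (cmod (fourier L ?e l))\<^sup>2"]])
          (use l in \<open>auto simp: e_four\<close>)
    qed
    have \<eta>H: "?\<eta> \<in> H1 L" by (rule H1_add[OF H eH])
    define s where "s = 2 * Re (?p * cnj z) + (cmod z)\<^sup>2"
    have sq: "(cmod (fourier L ?\<eta> k))\<^sup>2 = (cmod (fourier L (cplx \<psi>\<^sub>0) k))\<^sup>2 + (if k = l then s else 0)" if "k \<in> \<Gamma>" for k
      unfolding \<eta>_four[OF that] by (simp only: s_def cmod_add_sq) simp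
    have single: "((\<lambda>k. if k = l then c else 0) has_sum c) \<Gamma>" for c :: real
      by (rule has_sum_finite_neutralI[of "{l}"]) (use l in auto)
    have norm: "(L2_norm L ?\<eta>)\<^sup>2 = 1 + s"
    proof (rule has_sum_unique[OF parseval[OF H1D(1)[OF \<eta>H]]])
      show "((\<lambda>k. (cmod (fourier L ?\<eta> k))\<^sup>2) has_sum (1 + s)) \<Gamma>"
        using has_sum_add[OF parseval[OF L2] single[of s]] unfolding M_E_D(3)[OF psi_M_E] power_one
        by (rule has_sum_cong[THEN iffD1, rotated]) (simp only: sq)
    qed
    have kin: "kinetic L ?\<eta> = kinetic L (cplx \<psi>\<^sub>0) + (norm l)\<^sup>2 * s"
    proof (rule has_sum_unique[OF H1D(2)[OF \<eta>H]])
      have "((\<lambda>k. (norm k)\<^sup>2 * (cmod (fourier L (cplx \<psi>\<^sub>0) k))\<^sup>2 + (if k = l then (norm l)\<^sup>2 * s else 0)) has_sum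
          (kinetic L (cplx \<psi>\<^sub>0) + (norm l)\<^sup>2 * s)) \<Gamma>"
        by (rule has_sum_add[OF H1D(2)[OF H] single])
      then show "((\<lambda>k. (norm k)\<^sup>2 * (cmod (fourier L ?\<eta> k))\<^sup>2) has_sum (kinetic L (cplx \<psi>\<^sub>0) + (norm l)\<^sup>2 * s)) \<Gamma>"
        by (rule has_sum_cong[THEN iffD1, rotated]) (simp add: sq distrib_left)
    qed
    have pot: "(\<integral>x. V x * (cmod (?\<eta> x))\<^sup>2 \<partial>M) = (\<integral>x. V x * (cmod (cplx \<psi>\<^sub>0 x))\<^sup>2 \<partial>M)
        + 2 * Re (?U * cnj z) + (cmod z)\<^sup>2 * (\<integral>x. V x * (cmod wave_const)\<^sup>2 \<partial>M)"
    proof -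
      let ?v = "\<lambda>x. of_real (V x) * cplx \<psi>\<^sub>0 x"
      have i1: "integrable M (\<lambda>x. V x * (cmod (cplx \<psi>\<^sub>0 x))\<^sup>2)"
        by (rule L2_mult_integrable[OF V_L2 density_L2[OF H]])
      have i2: "integrable M (\<lambda>x. ?v x * cnj (?e x))"
        by (rule L2_mult_integrable[OF V_mult_L2[OF H] L2_cnj[OF eL2]])
      have i3: "integrable M (\<lambda>x. V x * (cmod wave_const)\<^sup>2)" using L2_integrable[OF V_L2] by simp
      have pw: "V x * (cmod (?\<eta> x))\<^sup>2 = V x * (cmod (cplx \<psi>\<^sub>0 x))\<^sup>2 + 2 * Re (?v x * cnj (?e x)) + (cmod z)\<^sup>2 * (V x * (cmod wave_const)\<^sup>2)" for x
      proof -
        have "(cmod (?e x))\<^sup>2 = (cmod z)\<^sup>2 * (cmod wave_const)\<^sup>2" by (simp add: norm_mult power_mult_distrib)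
        moreover have "Re (?v x * cnj (?e x)) = V x * Re (cplx \<psi>\<^sub>0 x * cnj (?e x))" by (simp add: mult.assoc)
        ultimately show ?thesis unfolding cmod_add_sq by (simp only: distrib_left mult_ac)
      qed
      have lin: "(\<integral>x. p x + 2 * q x + c * r x \<partial>M) = (\<integral>x. p x \<partial>M) + 2 * (\<integral>x. q x \<partial>M) + c * (\<integral>x. r x \<partial>M)"
        if "integrable M p" "integrable M q" "integrable M r" for p q r :: "real ^ 3 \<Rightarrow> real" and c
        using that by simp
      have "(\<integral>x. V x * (cmod (?\<eta> x))\<^sup>2 \<partial>M) = (\<integral>x. V x * (cmod (cplx \<psi>\<^sub>0 x))\<^sup>2 \<partial>M)
          + 2 * (\<integral>x. Re (?v x * cnj (?e x)) \<partial>M) + (cmod z)\<^sup>2 * (\<integral>x. V x * (cmod wave_const)\<^sup>2 \<partial>M)"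
        unfolding pw by (rule lin[OF i1 integrable_Re[OF i2] i3])
      also have "(\<integral>x. Re (?v x * cnj (?e x)) \<partial>M) = Re (\<integral>x. ?v x * cnj (?e x) \<partial>M)"
        by (rule integral_Re[OF i2])
      also have "(\<integral>x. ?v x * cnj (?e x) \<partial>M) = ?U * cnj z"
      proof -
        have "(\<lambda>x. ?v x * cnj (?e x)) = (\<lambda>x. (cnj z * wave_const) * (?v x * cis (- (l \<bullet> x))))"
          by (simp add: fun_eq_iff cis_cnj mult_ac)
        then have "(\<integral>x. ?v x * cnj (?e x) \<partial>M) = (cnj z * wave_const) * (\<integral>x. ?v x * cis (- (l \<bullet> x)) \<partial>M)"
          by (simp only: integral_mult_right_zero)
        then show ?thesis unfolding fourier_def wave_const_def[symmetric] by (simp only: mult_ac)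
      qed
      finally show ?thesis .
    qed
    have "h_form L \<phi> ?\<eta> = ground_energy + (norm l)\<^sup>2 * s + 2 * Re (?U * cnj z) + (cmod z)\<^sup>2 * (\<integral>x. V x * (cmod wave_const)\<^sup>2 \<partial>M)"
      using h_form_psi unfolding h_form_def kin pot by linarith
    moreover have "ground_energy * (1 + s) \<le> h_form L \<phi> ?\<eta>" using h_form_ge[OF \<eta>H] by (simp only: norm)
    moreover have "Re (X * cnj z) = (norm l)\<^sup>2 * Re (?p * cnj z) + Re (?U * cnj z) - ground_energy * Re (?p * cnj z)"
      unfolding X_def by (simp add: algebra_simps)
    ultimately show ?thesis unfolding D_def s_def by (simp add: algebra_simps)
  qed
  have "X = 0"
  proof (rule ccontr)
    assume "X \<noteq> 0"
    \<comment> \<open>Small enough that along \<open>z = - t * X\<close> the linear term beats the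
      quadratic one: the value is \<open>t * (cmod X)\<^sup>2 * (t * D - 2)\<close>, which is
      negative.\<close>
    define t where "t = 1 / (\<bar>D\<bar> + 1)"
    have t: "0 < t" "t * D < 2"
    proof -
      show "0 < t" by (simp add: t_def)
      have "t * D \<le> t * \<bar>D\<bar>" using \<open>0 < t\<close> by simp
      also have "\<dots> < 2" by (simp add: t_def field_simps)
      finally show "t * D < 2" .
    qed
    have XX: "X * cnj X = of_real ((cmod X)\<^sup>2)" using complex_norm_square[of X] by simp
    have "X * cnj (- (of_real t * X)) = of_real (- t * (cmod X)\<^sup>2)"
      using XX by (simp add: mult.left_commute)
    then have "Re (X * cnj (- (of_real t * X))) = - t * (cmod X)\<^sup>2" by (simp only: Re_complex_of_real)
    moreover have "(cmod (- (of_real t * X)))\<^sup>2 = t\<^sup>2 * (cmod X)\<^sup>2" by (simp add: norm_mult power_mult_distrib)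
    ultimately have "0 \<le> t * (cmod X)\<^sup>2 * (t * D - 2)"
      using key[of "- (of_real t * X)"] by (simp add: algebra_simps power2_eq_square)
    moreover have "0 < t * (cmod X)\<^sup>2" using t \<open>X \<noteq> 0\<close> by simp
    ultimately show False using t(2) by (simp add: zero_le_mult_iff)
  qed
  then show ?thesis unfolding X_def by simp
qed

lemma not_AE_zero:
  fixes \<eta> :: "real ^ 3 \<Rightarrow> complex"
  assumes "\<eta> \<in> L2 L"
  shows "(AE x in M. \<eta> x = 0) \<longleftrightarrow> L2_norm L \<eta> = 0"
proof -
  have "L2_norm L \<eta> = 0 \<longleftrightarrow> (\<integral>x. (cmod (\<eta> x))\<^sup>2 \<partial>M) = 0" using L2_norm_sq[of \<eta>] by auto
  also have "\<dots> \<longleftrightarrow> (AE x in M. (cmod (\<eta> x))\<^sup>2 = 0)"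
    by (rule integral_nonneg_eq_0_iff_AE[OF L2D(3)[OF assms]]) simp
  finally show ?thesis by simp
qed

lemma psi_eigenfunction: "h_eigenfunction L \<phi> ground_energy (cplx \<psi>\<^sub>0)"
  unfolding h_eigenfunction_def not_AE_zero[OF psi_L2] using euler_lagrange M_E_D[OF psi_M_E] by auto

lemma eigenvalue_ge: assumes "h_eigenfunction L \<phi> E \<eta>" shows "ground_energy \<le> E"
proof -
  have \<eta>: "\<eta> \<in> H1 L" "\<not> (AE x in M. \<eta> x = 0)" using assms by (auto simp: h_eigenfunction_def)
  then have "0 < (L2_norm L \<eta>)\<^sup>2" using not_AE_zero[OF H1D(1)] by simp
  then show ?thesis using h_form_ge[OF \<eta>(1)] h_form_eigen[OF assms] by simp
qed

lemma psi_ground_state: "ground_state L \<phi> (cplx \<psi>\<^sub>0)"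
  unfolding ground_state_def using psi_eigenfunction eigenvalue_ge M_E_D(3)[OF psi_M_E] by blast

text \<open>Since \<open>\<psi>\<^sub>0\<close> is an eigenfunction, the lowest eigenvalue is
  \<open>ground_energy\<close>. The completed square then sums to \<open>e_min L\<close>, which
  leaves room neither for excess energy nor for a deviation of the fields.\<close>

lemma ground_state_M_E:
  assumes "ground_state L \<phi> \<eta>"
  shows "\<eta> \<in> M_E L" "AE x in M. \<phi> x = sigma_fun L \<eta> x"
proof -
  obtain E where E: "h_eigenfunction L \<phi> E \<eta>" "\<And>E' \<xi>. h_eigenfunction L \<phi> E' \<xi> \<Longrightarrow> E \<le> E'" and n: "L2_norm L \<eta> = 1"
    using assms unfolding ground_state_def by blast
  have "E = ground_energy" using E(2)[OF psi_eigenfunction] eigenvalue_ge[OF E(1)] by simp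
  have \<eta>: "\<eta> \<in> H1 L" using E(1) by (simp add: h_eigenfunction_def)
  then have st: "\<eta> \<in> states L" using n by (simp add: states_def)
  have eq: "E_explicit \<eta> + (L2_norm L (\<lambda>x. \<phi> x - sigma_fun L \<eta> x))\<^sup>2 = e_min L"
    using h_form_eigen[OF E(1)] h_form_eq[OF \<eta>] n \<open>E = ground_energy\<close> by (simp add: ground_energy_def)
  moreover have "0 \<le> (L2_norm L (\<lambda>x. \<phi> x - sigma_fun L \<eta> x))\<^sup>2" by simp
  ultimately have "E_explicit \<eta> = e_min L" "(L2_norm L (\<lambda>x. \<phi> x - sigma_fun L \<eta> x))\<^sup>2 = 0"
    using e_min_le[OF st] by linarith+
  then show "\<eta> \<in> M_E L" using st E_fun_eq[OF \<eta>] by (simp add: M_E_def)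
  have u: "(\<lambda>x. \<phi> x - sigma_fun L \<eta> x) \<in> L2 L" by (intro L2_diff phi_L2 sigma_L2 \<eta>)
  then have "cplx (\<lambda>x. \<phi> x - sigma_fun L \<eta> x) \<in> L2 L" by (simp only: L2_cplx_iff)
  from not_AE_zero[OF this] have "AE x in M. complex_of_real (\<phi> x - sigma_fun L \<eta> x) = 0"
    using \<open>(L2_norm L (\<lambda>x. \<phi> x - sigma_fun L \<eta> x))\<^sup>2 = 0\<close> by (simp only: L2_norm_cplx) simp
  then show "AE x in M. \<phi> x = sigma_fun L \<eta> x" by simp
qed

text \<open>A positive ground state minimizes the Pekar functional, so it is a translate of \<open>\<psi>\<^sub>0\<close>; its
  density generates the same field \<open>\<phi>\<close>, which forces the translate to coincide with \<open>\<psi>\<^sub>0\<close>.\<close>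

lemma psi_unique_positive_ground_state: "unique_positive_ground_state L \<phi> \<psi>\<^sub>0"
  unfolding unique_positive_ground_state_def
proof (intro conjI allI impI)
  show "positive_ground_state L \<phi> \<psi>\<^sub>0"
    unfolding positive_ground_state_def using psi_ground_state psi_pos by simp
  fix \<eta> assume "positive_ground_state L \<phi> \<eta>"
  then have gs: "ground_state L \<phi> (cplx \<eta>)" and pos: "AE x in M. 0 < \<eta> x"
    by (auto simp: positive_ground_state_def)
  note ME = ground_state_M_E[OF gs]
  obtain \<theta> y where AE: "AE x in M. cplx \<eta> x = cis \<theta> * translate y (cplx \<psi>\<^sub>0) x"
    and dens: "\<And>k. k \<in> \<Gamma> \<Longrightarrow> fourier L (\<lambda>x. of_real ((cmod (cplx \<eta> x))\<^sup>2)) k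
        = cis (- (k \<bullet> y)) * fourier L (\<lambda>x. of_real ((cmod (cplx \<psi>\<^sub>0 x))\<^sup>2)) k"
    and sig: "\<And>k. k \<in> \<Gamma> \<Longrightarrow> fourier L (cplx (sigma_fun L (cplx \<eta>))) k = cis (- (k \<bullet> y)) * fourier L (cplx \<phi>) k"
    by (rule M_E_density[OF ME(1)]) blast
  let ?\<rho> = "\<lambda>x. (cmod (cplx \<psi>\<^sub>0 x))\<^sup>2" and ?\<rho>' = "\<lambda>x. (cmod (cplx \<eta> x))\<^sup>2"
  have \<rho>: "?\<rho> \<in> L2 L" and \<rho>': "?\<rho>' \<in> L2 L"
    by (rule density_L2[OF M_E_D(2)[OF psi_M_E]], rule density_L2[OF M_E_D(2)[OF ME(1)]])
  have "AE x in M. ?\<rho>' x = ?\<rho> x"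
  proof (rule L2_real_unique[OF \<rho>' \<rho>])
    fix k assume k: "k \<in> \<Gamma>"
    have "fourier L (cplx \<phi>) k = fourier L (cplx (sigma_fun L (cplx \<eta>))) k"
    proof (rule fourier_cong_AE)
      show "cplx \<phi> \<in> borel_measurable borel" "cplx (sigma_fun L (cplx \<eta>)) \<in> borel_measurable borel"
        using L2D(2)[OF phi_L2] L2D(2)[OF sigma_L2[OF M_E_D(2)[OF ME(1)]]] by simp_all
    qed (use ME(2) in simp)
    then have mk: "of_real (inv_norm k) * fourier L (cplx ?\<rho>) k = of_real (inv_norm k) * fourier L (cplx ?\<rho>') k"
      unfolding sig[OF k] fourier_phi[OF k] dens[OF k] by (simp only: mult.left_commute)
    show "fourier L (cplx ?\<rho>') k = fourier L (cplx ?\<rho>) k"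
    \<comment> \<open>\<open>inv_norm\<close> erases the mean of the density, so equality of fields
      says nothing at \<open>k = 0\<close>; there the phase of the translation is 1.\<close>
    proof (cases "k = 0")
      case True
      then show ?thesis using dens[OF k] by simp
    next
      case False
      then have "complex_of_real (inv_norm k) \<noteq> 0" by (simp add: inv_norm_def)
      then show ?thesis using mk by (metis mult_left_cancel)
    qed
  qed
  \<comment> \<open>Both functions are positive almost everywhere, so equal squares give equal
    values.\<close>
  then show "AE x in M. \<eta> x = \<psi>\<^sub>0 x"
    using pos
  proof eventually_elim
    case (elim x)
    then show ?case using psi_pos[of x] by (simp add: power2_eq_iff_nonneg)
  qed
qed

end

section \<open>Constants uniform in the side length\<close>

theorem corollary2p4:
  fixes L\<^sub>1 \<kappa>\<^sub>1 :: real and \<psi> :: "real \<Rightarrow> real ^ 3 \<Rightarrow> real"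
  assumes L1_pos: "0 < L\<^sub>1" and kappa1_pos: "0 < \<kappa>\<^sub>1"
    and psi_pos: "\<And>L x. L\<^sub>1 < L \<Longrightarrow> 0 < \<psi> L x"
    and psi_smooth: "\<And>L. L\<^sub>1 < L \<Longrightarrow> smooth_torus L (\<psi> L)"
    and e_neg: "\<And>L. L\<^sub>1 < L \<Longrightarrow> e_min L < 0"
    and M_E_eq: "\<And>L. L\<^sub>1 < L \<Longrightarrow> M_E L = Theta L (cplx (\<psi> L))"
    and psi_translate: "\<And>L y. L\<^sub>1 < L \<Longrightarrow> y \<notin> cubic_lattice L \<Longrightarrow> translate y (\<psi> L) \<noteq> \<psi> L"
    and coercive: "\<And>L f. L\<^sub>1 < L \<Longrightarrow> f \<in> H1 L \<Longrightarrow> L2_norm L f = 1 \<Longrightarrow>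
          E_fun L f - e_min L \<ge> \<kappa>\<^sub>1 * (dist_H1 L (M_E L) f)\<^sup>2"
  shows "\<exists>\<phi> :: real \<Rightarrow> real ^ 3 \<Rightarrow> real.
     (\<forall>L>L\<^sub>1. smooth_torus L (\<phi> L) \<and>
        M_F L = Omega L (\<phi> L) \<and>
        (AE x in torus_measure L. \<phi> L x = sigma_fun L (cplx (\<psi> L)) x) \<and>
        unique_positive_ground_state L (\<phi> L) (\<psi> L)) \<and>
     (\<exists>\<kappa>'>0. \<forall>L>L\<^sub>1. \<forall>f\<in>L2 L.
        (\<exists>y. (\<forall>z. resolvent_form L \<kappa>' (\<lambda>x. f x - translate y (\<phi> L) x)
                   \<le> resolvent_form L \<kappa>' (\<lambda>x. f x - translate z (\<phi> L) x)) \<and>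
             F_fun L f - e_min L \<ge>
               resolvent_form L \<kappa>' (\<lambda>x. f x - translate y (\<phi> L) x)
               + \<bar>L powr (- 3 / 2) * (\<integral>x. f x \<partial>torus_measure L)\<bar>\<^sup>2) \<and>
        F_fun L f - e_min L \<ge> tau L \<kappa>' * (dist_L2 L (M_F L) f)\<^sup>2)"
proof -
  have "\<exists>\<phi>. pekar L (\<psi> L) \<phi> \<kappa>\<^sub>1" if L: "L\<^sub>1 < L" for L
  proof -
    interpret torus L by standard (use L1_pos L in simp)
    obtain \<phi> where "smooth_torus L \<phi>"
      "\<And>k. k \<in> \<Gamma> \<Longrightarrow> fourier L (cplx \<phi>) k = of_real (inv_norm k) * fourier L (\<lambda>x. of_real ((cmod (cplx (\<psi> L) x))\<^sup>2)) k"
      by (rule smooth_sigma[OF psi_smooth[OF L]]) blast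
    then have "pekar L (\<psi> L) \<phi> \<kappa>\<^sub>1"
      by unfold_locales (use kappa1_pos psi_pos[OF L] psi_smooth[OF L] M_E_eq[OF L] coercive[OF L] in \<open>auto simp: states_def\<close>)
    then show ?thesis by blast
  qed
  then obtain \<phi> where \<phi>: "\<And>L. L\<^sub>1 < L \<Longrightarrow> pekar L (\<psi> L) (\<phi> L) \<kappa>\<^sub>1" by metis
  \<comment> \<open>The spectral gap of \<open>(-\<Delta>) powr (1/2)\<close> is \<open>2 * pi / L\<close>, whereas \<open>tau\<close> contains its square: the factor
    \<open>L\<^sub>1 / (2 * pi)\<close> in \<open>\<kappa>'\<close> makes up for the case \<open>L < 2 * pi\<close>.\<close>
  define \<kappa>\<^sub>0 where "\<kappa>\<^sub>0 = \<kappa>\<^sub>1 / (4 * (4 + 2 / L\<^sub>1\<^sup>2))"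
  define \<kappa>' where "\<kappa>' = \<kappa>\<^sub>0 * min 1 (L\<^sub>1 / (2 * pi))"
  have pos: "0 < 4 * (4 + 2 / L\<^sub>1\<^sup>2)" by (simp add: add_pos_nonneg)
  have k0: "0 < \<kappa>\<^sub>0" using pos kappa1_pos by (simp add: \<kappa>\<^sub>0_def)
  have k': "0 < \<kappa>'" "\<kappa>' \<le> \<kappa>\<^sub>0" using k0 L1_pos by (auto simp: \<kappa>'_def mult_le_cancel_left1)
  \<comment> \<open>\<open>2 / L\<^sup>2\<close> decreases in \<open>L\<close>, so the constant
    computed at the threshold \<open>L\<^sub>1\<close> is admissible for all larger tori.\<close>
  have adm: "4 * (4 + 2 / L\<^sup>2) * \<kappa> \<le> \<kappa>\<^sub>1" if "L\<^sub>1 < L" "0 < \<kappa>" "\<kappa> \<le> \<kappa>\<^sub>0" for L \<kappa>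
  proof -
    have "2 / L\<^sup>2 \<le> 2 / L\<^sub>1\<^sup>2" using that L1_pos by (intro divide_left_mono power_mono) auto
    then have "4 * (4 + 2 / L\<^sup>2) * \<kappa> \<le> 4 * (4 + 2 / L\<^sub>1\<^sup>2) * \<kappa>\<^sub>0"
      using that pos by (intro mult_mono) auto
    also have "\<dots> = \<kappa>\<^sub>1" unfolding \<kappa>\<^sub>0_def using pos by simp
    finally show ?thesis .
  qed
  have scale: "\<kappa>' * (2 * pi / L) \<le> \<kappa>\<^sub>0" if "L\<^sub>1 < L" for L
  proof -
    have "\<kappa>' * (2 * pi / L) \<le> (\<kappa>\<^sub>0 * (L\<^sub>1 / (2 * pi))) * (2 * pi / L)"
      unfolding \<kappa>'_def using k0 L1_pos that by (intro mult_right_mono mult_left_mono) auto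
    also have "\<dots> = \<kappa>\<^sub>0 * (L\<^sub>1 / L)" by simp
    also have "\<dots> \<le> \<kappa>\<^sub>0 * 1" using k0 L1_pos that by (intro mult_left_mono) auto
    finally show ?thesis by simp
  qed
  show ?thesis
  proof (intro exI[of _ \<phi>] exI[of _ \<kappa>'] conjI allI impI ballI)
    fix L assume L: "L\<^sub>1 < L"
    interpret pekar L "\<psi> L" "\<phi> L" \<kappa>\<^sub>1 by (rule \<phi>[OF L])
    show "smooth_torus L (\<phi> L)" by (rule phi_smooth)
    show "M_F L = Omega L (\<phi> L)" by (rule M_F_eq)
    show "AE x in torus_measure L. \<phi> L x = sigma_fun L (cplx (\<psi> L)) x" by (rule phi_sigma)
    show "unique_positive_ground_state L (\<phi> L) (\<psi> L)" by (rule psi_unique_positive_ground_state)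
    fix f :: "real ^ 3 \<Rightarrow> real" assume f: "f \<in> L2 L"
    \<comment> \<open>This bound rests on the resolvent form with the larger constant
      \<open>\<kappa>\<^sub>0\<close>; \<open>\<kappa>'\<close> enters only through
      \<open>tau\<close>.\<close>
    show "F_fun L f - e_min L \<ge> tau L \<kappa>' * (dist_L2 L (M_F L) f)\<^sup>2"
      by (rule dist_bound[OF f k0 adm[OF L k0 order_refl] k'(1) scale[OF L]])
    show "\<exists>y. (\<forall>z. resolvent_form L \<kappa>' (\<lambda>x. f x - translate y (\<phi> L) x)
                   \<le> resolvent_form L \<kappa>' (\<lambda>x. f x - translate z (\<phi> L) x)) \<and>
             F_fun L f - e_min L \<ge>
               resolvent_form L \<kappa>' (\<lambda>x. f x - translate y (\<phi> L) x)
               + \<bar>L powr (- 3 / 2) * (\<integral>x. f x \<partial>torus_measure L)\<bar>\<^sup>2"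
      by (rule lower_bound[OF f k'(1) adm[OF L k']]) blast
  qed (rule k')
qed

end
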